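(* Let $A$ be a finite-dimensional Hopf algebra over the field $\Bbbk$. Then $\dim_{\Bbbk}(A^{\perp})$ is a gauge invariant of $A$; that is, if $A'$ is any finite-dimensional Hopf algebra over $\Bbbk$ gauge equivalent to $A$, then $\dim_{\Bbbk}((A')^{\perp})=\dim_{\Bbbk}(A^{\perp})$.
   Context: $\Bbbk$ is an arbitrary field. Two finite-dimensional Hopf algebras over $\Bbbk$ are gauge equivalent if their categories of finite-dimensional left modules are equivalent as ($\Bbbk$-linear) tensor categories; a quantity defined for every finite-dimensional Hopf algebra is a gauge invariant if it takes the same value on gauge equivalent Hopf algebras. For a finite-dimensional Hopf algebra $A$ with comultiplication $\Delta(a)=a_{(1)}\otimes a_{(2)}$ and antipode $S$, the (left) adjoint representation is $\mathrm{ad}:A\to\mathrm{End}_{\Bbbk}(A)$, $(\mathrm{ad}\,a)(b)=a_{(1)}bS(a_{(2)})$. The Killing form of $A$ is $(a,b)=\mathrm{tr}(\mathrm{ad}\,a\circ\mathrm{ad}\,b)=\mathrm{tr}(\mathrm{ad}(ab))$ for $a,b\in A$, and the Killing radical is $A^{\perp}=\{a\in A\mid (a,b)=0\text{ for all }b\in A\}$. *)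

theory Defs
  imports Complex_Main "Jordan_Normal_Form.Matrix"
begin

section \<open>Finite-dimensional Hopf algebras\<close>

text \<open>
  The underlying ring of a Hopf algebra is a type of class \<open>ring_1\<close>; the remaining structure is
  carried by a record.  An element of \<open>A \<otimes> A\<close> is written as a finite formal sum of pure
  tensors, \<open>[(x\<^sub>1, y\<^sub>1), \<dots>, (x\<^sub>n, y\<^sub>n)]\<close> standing for \<open>\<Sum>\<^sub>i x\<^sub>i \<otimes> y\<^sub>i\<close>, and similarly for
  \<open>A \<otimes> A \<otimes> A\<close>.  So \<open>comult H a\<close> is a choice of Sweedler representative of \<open>\<Delta>(a)\<close>.
  All axioms are equalities of tensors (\<open>tensor2_eq\<close>, \<open>tensor3_eq\<close>), not of formal sums, and
  everything built from \<open>comult\<close> below is multilinear in the factors, hence does not depend on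
  the representatives chosen.
\<close>

record ('k, 'a) hopf =
  scale :: "'k \<Rightarrow> 'a \<Rightarrow> 'a"
  comult :: "'a \<Rightarrow> ('a \<times> 'a) list"
  counit :: "'a \<Rightarrow> 'k"
  antipode :: "'a \<Rightarrow> 'a"

definition bilinear_form :: "('k::field \<Rightarrow> 'a::ab_group_add \<Rightarrow> 'a) \<Rightarrow> ('a \<Rightarrow> 'a \<Rightarrow> 'k) \<Rightarrow> bool" where
  "bilinear_form s \<beta> \<longleftrightarrow>
     (\<forall>y. Vector_Spaces.linear s (*) (\<lambda>x. \<beta> x y)) \<and>
     (\<forall>x. Vector_Spaces.linear s (*) (\<lambda>y. \<beta> x y))"

definition trilinear_form ::
    "('k::field \<Rightarrow> 'a::ab_group_add \<Rightarrow> 'a) \<Rightarrow> ('a \<Rightarrow> 'a \<Rightarrow> 'a \<Rightarrow> 'k) \<Rightarrow> bool" where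
  "trilinear_form s \<tau> \<longleftrightarrow>
     (\<forall>y z. Vector_Spaces.linear s (*) (\<lambda>x. \<tau> x y z)) \<and>
     (\<forall>x z. Vector_Spaces.linear s (*) (\<lambda>y. \<tau> x y z)) \<and>
     (\<forall>x y. Vector_Spaces.linear s (*) (\<lambda>z. \<tau> x y z))"

text \<open>
  By the universal property, linear forms on \<open>A \<otimes> A\<close> are the bilinear forms on \<open>A \<times> A\<close>; since
  linear forms separate the points of a vector space, two formal sums represent the same tensor iff
  every bilinear form takes the same value on them.
\<close>

definition tensor2_eq ::
    "('k::field \<Rightarrow> 'a::ab_group_add \<Rightarrow> 'a) \<Rightarrow> ('a \<times> 'a) list \<Rightarrow> ('a \<times> 'a) list \<Rightarrow> bool" where
  "tensor2_eq s t u \<longleftrightarrow>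
     (\<forall>\<beta>. bilinear_form s \<beta> \<longrightarrow> (\<Sum>(x, y)\<leftarrow>t. \<beta> x y) = (\<Sum>(x, y)\<leftarrow>u. \<beta> x y))"

definition tensor3_eq ::
    "('k::field \<Rightarrow> 'a::ab_group_add \<Rightarrow> 'a) \<Rightarrow> ('a \<times> 'a \<times> 'a) list \<Rightarrow> ('a \<times> 'a \<times> 'a) list \<Rightarrow> bool" where
  "tensor3_eq s t u \<longleftrightarrow>
     (\<forall>\<tau>. trilinear_form s \<tau> \<longrightarrow>
        (\<Sum>(x, y, z)\<leftarrow>t. \<tau> x y z) = (\<Sum>(x, y, z)\<leftarrow>u. \<tau> x y z))"

text \<open>
  The locale \<open>vector_space\<close> does not bound the dimension; \<open>finite_dim\<close> does.  The zero ring is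
  excluded by the class \<open>ring_1\<close>, which is no restriction because \<open>\<epsilon>(1) = 1\<close>.
\<close>

locale fd_hopf_algebra = vector_space "scale H" for H :: "('k::field, 'a::ring_1) hopf" +
  assumes finite_dim: "\<exists>B. finite B \<and> span B = UNIV"
    and mult_scale_left: "scale H c a * b = scale H c (a * b)"
    and mult_scale_right: "a * scale H c b = scale H c (a * b)"
    and comult_add: "tensor2_eq (scale H) (comult H (a + b)) (comult H a @ comult H b)"
    and comult_scale: "tensor2_eq (scale H) (comult H (scale H c a))
          [(scale H c x, y). (x, y) \<leftarrow> comult H a]"
    and comult_one: "tensor2_eq (scale H) (comult H 1) [(1, 1)]"
    and comult_mult: "tensor2_eq (scale H) (comult H (a * b))
          [(x * x', y * y'). (x, y) \<leftarrow> comult H a, (x', y') \<leftarrow> comult H b]"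
    and coassoc: "tensor3_eq (scale H)
          [(u, v, y). (x, y) \<leftarrow> comult H a, (u, v) \<leftarrow> comult H x]
          [(x, u, v). (x, y) \<leftarrow> comult H a, (u, v) \<leftarrow> comult H y]"
    and counit_linear: "Vector_Spaces.linear (scale H) (*) (counit H)"
    and counit_one: "counit H 1 = 1"
    and counit_mult: "counit H (a * b) = counit H a * counit H b"
    and counit_left: "(\<Sum>(x, y)\<leftarrow>comult H a. scale H (counit H x) y) = a"
    and counit_right: "(\<Sum>(x, y)\<leftarrow>comult H a. scale H (counit H y) x) = a"
    and antipode_linear: "Vector_Spaces.linear (scale H) (scale H) (antipode H)"
    and antipode_left: "(\<Sum>(x, y)\<leftarrow>comult H a. antipode H x * y) = scale H (counit H a) 1"
    and antipode_right: "(\<Sum>(x, y)\<leftarrow>comult H a. x * antipode H y) = scale H (counit H a) 1"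


section \<open>The Killing form and its radical\<close>

text \<open>
  The trace is computed in an arbitrary basis; it is meaningful for endomorphisms of
  finite-dimensional spaces only.
\<close>

definition (in vector_space) endo_trace :: "('b \<Rightarrow> 'b) \<Rightarrow> 'a" where
  "endo_trace f =
     (let B = (SOME B. independent B \<and> span B = UNIV) in \<Sum>b\<in>B. representation B (f b) b)"

definition adjoint_rep :: "('k, 'a::ring_1) hopf \<Rightarrow> 'a \<Rightarrow> 'a \<Rightarrow> 'a" where
  "adjoint_rep H a b = (\<Sum>(x, y)\<leftarrow>comult H a. x * b * antipode H y)"

definition killing_form :: "('k::field, 'a::ring_1) hopf \<Rightarrow> 'a \<Rightarrow> 'a \<Rightarrow> 'k" where
  "killing_form H a b = vector_space.endo_trace (scale H) (adjoint_rep H a \<circ> adjoint_rep H b)"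

definition killing_radical :: "('k::field, 'a::ring_1) hopf \<Rightarrow> 'a set" where
  "killing_radical H = {a. \<forall>b. killing_form H a b = 0}"


section \<open>Linear tensor categories and their equivalence\<close>

text \<open>
  Morphisms need not determine their source and target (the sets \<open>hom\<close> may overlap), so functors
  take them as extra arguments.  In \<open>comp C g f\<close>, the morphism \<open>f\<close> is applied first.
  The operations \<open>add\<close> and \<open>smult\<close> are the linear structure of the \<open>hom\<close> spaces.
\<close>

record ('o, 'm, 'k) tensor_cat =
  obj :: "'o set"
  hom :: "'o \<Rightarrow> 'o \<Rightarrow> 'm set"
  comp :: "'m \<Rightarrow> 'm \<Rightarrow> 'm"
  ident :: "'o \<Rightarrow> 'm"
  add :: "'m \<Rightarrow> 'm \<Rightarrow> 'm"
  smult :: "'k \<Rightarrow> 'm \<Rightarrow> 'm"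
  tensor :: "'o \<Rightarrow> 'o \<Rightarrow> 'o"
  tensor_mor :: "'m \<Rightarrow> 'm \<Rightarrow> 'm"
  unit :: "'o"
  associator :: "'o \<Rightarrow> 'o \<Rightarrow> 'o \<Rightarrow> 'm"  \<comment> \<open>\<open>(x \<otimes> y) \<otimes> z \<rightarrow> x \<otimes> (y \<otimes> z)\<close>\<close>
  left_unitor :: "'o \<Rightarrow> 'm"  \<comment> \<open>\<open>unit \<otimes> x \<rightarrow> x\<close>\<close>
  right_unitor :: "'o \<Rightarrow> 'm"  \<comment> \<open>\<open>x \<otimes> unit \<rightarrow> x\<close>\<close>

definition is_iso :: "('o, 'm, 'k) tensor_cat \<Rightarrow> 'o \<Rightarrow> 'o \<Rightarrow> 'm \<Rightarrow> bool" where
  "is_iso C x y f \<longleftrightarrow> f \<in> hom C x y \<and>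
     (\<exists>g\<in>hom C y x. comp C g f = ident C x \<and> comp C f g = ident C y)"

definition is_functor ::
    "('o, 'm, 'k) tensor_cat \<Rightarrow> ('p, 'n, 'k) tensor_cat \<Rightarrow>
     ('o \<Rightarrow> 'p) \<Rightarrow> ('o \<Rightarrow> 'o \<Rightarrow> 'm \<Rightarrow> 'n) \<Rightarrow> bool" where
  "is_functor C D Fo Fm \<longleftrightarrow>
     (\<forall>x\<in>obj C. Fo x \<in> obj D) \<and>
     (\<forall>x\<in>obj C. \<forall>y\<in>obj C. \<forall>f\<in>hom C x y. Fm x y f \<in> hom D (Fo x) (Fo y)) \<and>
     (\<forall>x\<in>obj C. Fm x x (ident C x) = ident D (Fo x)) \<and>
     (\<forall>x\<in>obj C. \<forall>y\<in>obj C. \<forall>z\<in>obj C. \<forall>f\<in>hom C x y. \<forall>g\<in>hom C y z.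
        Fm x z (comp C g f) = comp D (Fm y z g) (Fm x y f))"

definition is_linear ::
    "('o, 'm, 'k) tensor_cat \<Rightarrow> ('p, 'n, 'k) tensor_cat \<Rightarrow> ('o \<Rightarrow> 'o \<Rightarrow> 'm \<Rightarrow> 'n) \<Rightarrow> bool" where
  "is_linear C D Fm \<longleftrightarrow>
     (\<forall>x\<in>obj C. \<forall>y\<in>obj C. \<forall>f\<in>hom C x y.
        (\<forall>g\<in>hom C x y. Fm x y (add C f g) = add D (Fm x y f) (Fm x y g)) \<and>
        (\<forall>c. Fm x y (smult C c f) = smult D c (Fm x y f)))"

definition is_nat_iso ::
    "('o, 'm, 'k) tensor_cat \<Rightarrow> ('p, 'n, 'k) tensor_cat \<Rightarrow>
     ('o \<Rightarrow> 'p) \<Rightarrow> ('o \<Rightarrow> 'o \<Rightarrow> 'm \<Rightarrow> 'n) \<Rightarrow> ('o \<Rightarrow> 'p) \<Rightarrow> ('o \<Rightarrow> 'o \<Rightarrow> 'm \<Rightarrow> 'n) \<Rightarrow>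
     ('o \<Rightarrow> 'n) \<Rightarrow> bool" where
  "is_nat_iso C D Fo Fm Go Gm \<eta> \<longleftrightarrow>
     (\<forall>x\<in>obj C. is_iso D (Fo x) (Go x) (\<eta> x)) \<and>
     (\<forall>x\<in>obj C. \<forall>y\<in>obj C. \<forall>f\<in>hom C x y.
        comp D (\<eta> y) (Fm x y f) = comp D (Gm x y f) (\<eta> x))"

definition is_equivalence ::
    "('o, 'm, 'k) tensor_cat \<Rightarrow> ('p, 'n, 'k) tensor_cat \<Rightarrow>
     ('o \<Rightarrow> 'p) \<Rightarrow> ('o \<Rightarrow> 'o \<Rightarrow> 'm \<Rightarrow> 'n) \<Rightarrow> bool" where
  "is_equivalence C D Fo Fm \<longleftrightarrow> is_functor C D Fo Fm \<and>
     (\<exists>Go Gm \<eta> \<epsilon>. is_functor D C Go Gm \<and>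
        is_nat_iso C C (\<lambda>x. x) (\<lambda>x y f. f)
          (\<lambda>x. Go (Fo x)) (\<lambda>x y f. Gm (Fo x) (Fo y) (Fm x y f)) \<eta> \<and>
        is_nat_iso D D (\<lambda>x. Fo (Go x)) (\<lambda>x y f. Fm (Go x) (Go y) (Gm x y f))
          (\<lambda>x. x) (\<lambda>x y f. f) \<epsilon>)"

text \<open>
  The structure maps of a (strong) tensor functor are \<open>J x y : F x \<otimes> F y \<rightarrow> F (x \<otimes> y)\<close> and
  \<open>\<phi> : unit \<rightarrow> F unit\<close>.
\<close>

definition is_tensor_functor ::
    "('o, 'm, 'k) tensor_cat \<Rightarrow> ('p, 'n, 'k) tensor_cat \<Rightarrow>
     ('o \<Rightarrow> 'p) \<Rightarrow> ('o \<Rightarrow> 'o \<Rightarrow> 'm \<Rightarrow> 'n) \<Rightarrow> ('o \<Rightarrow> 'o \<Rightarrow> 'n) \<Rightarrow> 'n \<Rightarrow> bool" where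
  "is_tensor_functor C D Fo Fm J \<phi> \<longleftrightarrow>
     is_functor C D Fo Fm \<and>
     is_iso D (unit D) (Fo (unit C)) \<phi> \<and>
     (\<forall>x\<in>obj C. \<forall>y\<in>obj C. is_iso D (tensor D (Fo x) (Fo y)) (Fo (tensor C x y)) (J x y)) \<and>
     (\<forall>x\<in>obj C. \<forall>x'\<in>obj C. \<forall>y\<in>obj C. \<forall>y'\<in>obj C. \<forall>f\<in>hom C x x'. \<forall>g\<in>hom C y y'.
        comp D (J x' y') (tensor_mor D (Fm x x' f) (Fm y y' g)) =
        comp D (Fm (tensor C x y) (tensor C x' y') (tensor_mor C f g)) (J x y)) \<and>
     (\<forall>x\<in>obj C. \<forall>y\<in>obj C. \<forall>z\<in>obj C.
        comp D (Fm (tensor C (tensor C x y) z) (tensor C x (tensor C y z)) (associator C x y z))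
          (comp D (J (tensor C x y) z) (tensor_mor D (J x y) (ident D (Fo z)))) =
        comp D (J x (tensor C y z))
          (comp D (tensor_mor D (ident D (Fo x)) (J y z)) (associator D (Fo x) (Fo y) (Fo z)))) \<and>
     (\<forall>x\<in>obj C.
        comp D (Fm (tensor C (unit C) x) x (left_unitor C x))
          (comp D (J (unit C) x) (tensor_mor D \<phi> (ident D (Fo x)))) =
        left_unitor D (Fo x)) \<and>
     (\<forall>x\<in>obj C.
        comp D (Fm (tensor C x (unit C)) x (right_unitor C x))
          (comp D (J x (unit C)) (tensor_mor D (ident D (Fo x)) \<phi>)) =
        right_unitor D (Fo x))"

definition tensor_equivalent ::
    "('o, 'm, 'k) tensor_cat \<Rightarrow> ('p, 'n, 'k) tensor_cat \<Rightarrow> bool" where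
  "tensor_equivalent C D \<longleftrightarrow>
     (\<exists>Fo Fm J \<phi>. is_equivalence C D Fo Fm \<and> is_linear C D Fm \<and> is_tensor_functor C D Fo Fm J \<phi>)"


section \<open>The tensor category of finite-dimensional left modules\<close>

text \<open>
  A module is a pair \<open>(n, \<rho>)\<close> of a dimension and a matrix representation on \<open>k\<^sup>n\<close> (with
  \<open>n = 0\<close> allowed); every finite-dimensional left module is isomorphic to one of these.
  A morphism \<open>(n, \<rho>) \<rightarrow> (m, \<sigma>)\<close> is an intertwining matrix.  The space \<open>k\<^sup>n \<otimes> k\<^sup>m\<close> is identified
  with \<open>k\<^bsup>n m\<^esup>\<close> through \<open>e\<^sub>i \<otimes> e\<^sub>j = e\<^bsub>i m + j\<^esub>\<close> (counting from 0), so that the tensor product of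
  linear maps is the Kronecker product.  Under this identification the canonical isomorphisms
  \<open>(u \<otimes> v) \<otimes> w \<mapsto> u \<otimes> (v \<otimes> w)\<close>, \<open>1 \<otimes> v \<mapsto> v\<close>, \<open>v \<otimes> 1 \<mapsto> v\<close> are identity matrices.
\<close>

type_synonym ('k, 'a) rep = "nat \<times> ('a \<Rightarrow> 'k mat)"

definition kronecker :: "'k::semiring_0 mat \<Rightarrow> 'k mat \<Rightarrow> 'k mat" where
  "kronecker M N = mat (dim_row M * dim_row N) (dim_col M * dim_col N)
     (\<lambda>(i, j). M $$ (i div dim_row N, j div dim_col N) * N $$ (i mod dim_row N, j mod dim_col N))"

definition is_rep :: "('k::field, 'a::ring_1) hopf \<Rightarrow> ('k, 'a) rep \<Rightarrow> bool" where
  "is_rep H X \<longleftrightarrow> (case X of (n, \<rho>) \<Rightarrow>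
     (\<forall>a. \<rho> a \<in> carrier_mat n n) \<and>
     (\<forall>a b. \<rho> (a + b) = \<rho> a + \<rho> b) \<and>
     (\<forall>c a. \<rho> (scale H c a) = c \<cdot>\<^sub>m \<rho> a) \<and>
     \<rho> 1 = 1\<^sub>m n \<and>
     (\<forall>a b. \<rho> (a * b) = \<rho> a * \<rho> b))"

definition intertwiners :: "('k::field, 'a) rep \<Rightarrow> ('k, 'a) rep \<Rightarrow> 'k mat set" where
  "intertwiners X Y = {T \<in> carrier_mat (fst Y) (fst X). \<forall>a. T * snd X a = snd Y a * T}"

definition rep_tensor ::
    "('k::field, 'a::ring_1) hopf \<Rightarrow> ('k, 'a) rep \<Rightarrow> ('k, 'a) rep \<Rightarrow> ('k, 'a) rep" where
  "rep_tensor H X Y = (fst X * fst Y,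
     \<lambda>a. foldr (+) [kronecker (snd X x) (snd Y y). (x, y) \<leftarrow> comult H a]
           (0\<^sub>m (fst X * fst Y) (fst X * fst Y)))"

definition rep_unit :: "('k::field, 'a::ring_1) hopf \<Rightarrow> ('k, 'a) rep" where
  "rep_unit H = (1, \<lambda>a. counit H a \<cdot>\<^sub>m 1\<^sub>m 1)"

definition rep_cat ::
    "('k::field, 'a::ring_1) hopf \<Rightarrow> (('k, 'a) rep, 'k mat, 'k) tensor_cat" where
  "rep_cat H = \<lparr>
     obj = {X. is_rep H X},
     hom = intertwiners,
     comp = (*),
     ident = (\<lambda>X. 1\<^sub>m (fst X)),
     add = (+),
     smult = (\<cdot>\<^sub>m),
     tensor = rep_tensor H,
     tensor_mor = kronecker,
     unit = rep_unit H,
     associator = (\<lambda>X Y Z. 1\<^sub>m (fst X * fst Y * fst Z)),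
     left_unitor = (\<lambda>X. 1\<^sub>m (fst X)),
     right_unitor = (\<lambda>X. 1\<^sub>m (fst X))\<rparr>"

definition gauge_equivalent :: "('k::field, 'a::ring_1) hopf \<Rightarrow> ('k, 'b::ring_1) hopf \<Rightarrow> bool" where
  "gauge_equivalent H H' \<longleftrightarrow> tensor_equivalent (rep_cat H) (rep_cat H')"

end

theory Submission
  imports Defs "Jordan_Normal_Form.Determinant"
begin

text \<open>
  The Killing form depends only on the character of the adjoint module, and the adjoint module is
  determined by the tensor category: morphisms \<open>f : X \<rightarrow> A\<^sub>a\<^sub>d\<close> are the same as natural transformations
  \<open>x \<otimes> v \<mapsto> f(x) v\<close> from \<open>X \<otimes> -\<close> to the identity functor.  Such a transformation is known from its
  component at a progenerator.  This suggests attaching to a module \<open>R\<close> the space \<open>actions H R\<close> of all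
  morphisms \<open>R \<otimes> R \<rightarrow> R\<close> that commute with the endomorphisms of the second factor.  The algebra
  \<open>End R\<close> acts on it through the first factor; the traces of this action define a bilinear form on
  \<open>End R\<close>, whose radical is \<open>negligible H R\<close>.  If \<open>R\<close> is the regular module, then evaluation at \<open>1\<close>
  and \<open>1 \<otimes> 1\<close> identifies \<open>End R\<close> and \<open>actions H R\<close> with \<open>A\<close>, the action becomes the adjoint
  representation, and \<open>negligible H R\<close> becomes the Killing radical (\<open>negligible_regular\<close>).

  A tensor equivalence \<open>F\<close> carries all of this along (\<open>mat_dim_negligible_Fo\<close>), so the dimension of the
  Killing radical of \<open>A\<close> can be read off from the \<open>A'\<close>-module \<open>F(A)\<close>.  It remains to compare \<open>F(A)\<close>
  with the regular module of \<open>A'\<close>.  Instead of an isomorphism, a coarser relation is enough: if \<open>T\<close> is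
  isomorphic to \<open>R\<^sup>n\<close>, then the endomorphisms of \<open>T\<close> are the \<open>n \<times> n\<close> matrices over \<open>End R\<close>, the
  negligible ones are the matrices with negligible entries, and both dimensions get multiplied by
  \<open>n\<^sup>2\<close> (\<open>mat_dim_End_power\<close>, \<open>mat_dim_negligible_power\<close>).

  Modules with a common power come from two classical isomorphisms, \<open>A \<otimes> V \<cong> A\<^sup>n\<close> and
  \<open>V \<otimes> A\<^sup>* \<cong> (A\<^sup>*)\<^sup>n\<close> for every module \<open>V\<close> of dimension \<open>n\<close> (\<open>regular_tensor_biprod\<close>,
  \<open>tensor_coregular_biprod\<close>).  In this order of the factors the inverse isomorphisms are given by the
  antipode, in the opposite order they would be given by its inverse.  First,
  \<open>F(A) \<otimes> F(A) \<cong> F(A \<otimes> A)\<close> is a power of \<open>F(A)\<close> with exponent \<open>dim A\<close>, whence \<open>dim F(A) = dim A\<close>.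
  Next, write \<open>A'\<^sup>* \<cong> F(W)\<close>.  The module \<open>F(A) \<otimes> A'\<^sup>* \<cong> F(A \<otimes> W)\<close> is a power of \<open>A'\<^sup>*\<close> and, with
  exponent \<open>dim W\<close>, of \<open>F(A)\<close>; comparing dimensions gives \<open>dim W = dim A'\<close>.  Since \<open>A' \<otimes> A'\<^sup>*\<close> is
  a power of \<open>A'\<close> and of \<open>A'\<^sup>*\<close> with the same exponent, \<open>A'\<^sup>*\<close> may replace \<open>A'\<close>.  Counting
  endomorphisms of the common power yields \<open>dim A = dim A'\<close>, and counting negligible endomorphisms
  yields the theorem.
\<close>

section \<open>Finite-dimensional spaces of matrices\<close>

definition mat_sum :: "nat \<Rightarrow> nat \<Rightarrow> ('i \<Rightarrow> 'k::comm_monoid_add mat) \<Rightarrow> 'i set \<Rightarrow> 'k mat" where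
  "mat_sum nr nc f I = mat nr nc (\<lambda>ij. \<Sum>i\<in>I. f i $$ ij)"

lemma mat_sum_carrier [simp]: "mat_sum nr nc f I \<in> carrier_mat nr nc"
  and mat_sum_dims [simp]: "dim_row (mat_sum nr nc f I) = nr" "dim_col (mat_sum nr nc f I) = nc"
  by (simp_all add: mat_sum_def)

lemma mat_sum_index [simp]:
  "r < nr \<Longrightarrow> s < nc \<Longrightarrow> mat_sum nr nc f I $$ (r, s) = (\<Sum>i\<in>I. f i $$ (r, s))"
  by (simp add: mat_sum_def)

lemma mat_sum_empty [simp]: "mat_sum nr nc f {} = 0\<^sub>m nr nc"
  by (rule eq_matI) auto

lemma mat_sum_insert:
  assumes "finite I" "i \<notin> I" "f i \<in> carrier_mat nr nc"
  shows "mat_sum nr nc f (insert i I) = f i + mat_sum nr nc f I"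
  using assms by (intro eq_matI) auto

lemma mat_sum_cong: "(\<And>i. i \<in> I \<Longrightarrow> f i = g i) \<Longrightarrow> mat_sum nr nc f I = mat_sum nr nc g I"
  by (intro eq_matI) (auto intro!: sum.cong)

lemma mat_sum_single:
  assumes "finite I" "j \<in> I" "M \<in> carrier_mat nr nc"
  shows "mat_sum nr nc (\<lambda>i. if i = j then M else 0\<^sub>m nr nc) I = M"
proof (rule eq_matI)
  fix r s assume "r < dim_row M" "s < dim_col M"
  then have rs: "r < nr" "s < nc" using assms by auto
  have "(\<Sum>i\<in>I. (if i = j then M else 0\<^sub>m nr nc) $$ (r, s)) = (\<Sum>i\<in>I. if i = j then M $$ (r, s) else 0)"
    using rs by (intro sum.cong) auto
  then show "mat_sum nr nc (\<lambda>i. if i = j then M else 0\<^sub>m nr nc) I $$ (r, s) = M $$ (r, s)"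
    using rs assms by simp
qed (use assms in auto)

lemma mult_index:
  assumes "M \<in> carrier_mat nr n" "N \<in> carrier_mat n nc" "i < nr" "j < nc"
  shows "(M * N) $$ (i, j) = (\<Sum>k<n. M $$ (i, k) * N $$ (k, j))"
  using assms by (auto simp: scalar_prod_def atLeast0LessThan intro!: sum.cong)

lemma mult_mat_sum:
  fixes M :: "'k::comm_semiring_0 mat"
  assumes "M \<in> carrier_mat nr n" "\<And>i. i \<in> I \<Longrightarrow> f i \<in> carrier_mat n nc"
  shows "M * mat_sum n nc f I = mat_sum nr nc (\<lambda>i. M * f i) I"
proof (rule eq_matI; simp del: index_mult_mat(1))
  fix r s assume rs: "r < nr" "s < nc"
  have "(M * mat_sum n nc f I) $$ (r, s) = (\<Sum>k<n. M $$ (r, k) * (\<Sum>i\<in>I. f i $$ (k, s)))"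
    using rs assms by (subst mult_index[of _ nr n _ nc]) auto
  also have "\<dots> = (\<Sum>i\<in>I. \<Sum>k<n. M $$ (r, k) * f i $$ (k, s))"
    by (simp add: sum_distrib_left) (rule sum.swap)
  also have "\<dots> = (\<Sum>i\<in>I. (M * f i) $$ (r, s))"
    using rs assms by (intro sum.cong refl) (subst mult_index[of _ nr n _ nc], auto)
  finally show "(M * mat_sum n nc f I) $$ (r, s) = (\<Sum>i\<in>I. (M * f i) $$ (r, s))" .
qed (use assms in auto)

lemma mat_sum_mult:
  fixes M :: "'k::comm_semiring_0 mat"
  assumes "M \<in> carrier_mat n nc" "\<And>i. i \<in> I \<Longrightarrow> f i \<in> carrier_mat nr n"
  shows "mat_sum nr n f I * M = mat_sum nr nc (\<lambda>i. f i * M) I"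
proof (rule eq_matI; simp del: index_mult_mat(1))
  fix r s assume rs: "r < nr" "s < nc"
  have "(mat_sum nr n f I * M) $$ (r, s) = (\<Sum>k<n. (\<Sum>i\<in>I. f i $$ (r, k)) * M $$ (k, s))"
    using rs assms by (subst mult_index[of _ nr n _ nc]) auto
  also have "\<dots> = (\<Sum>i\<in>I. \<Sum>k<n. f i $$ (r, k) * M $$ (k, s))"
    by (simp add: sum_distrib_right) (rule sum.swap)
  also have "\<dots> = (\<Sum>i\<in>I. (f i * M) $$ (r, s))"
    using rs assms by (intro sum.cong refl) (subst mult_index[of _ nr n _ nc], auto)
  finally show "(mat_sum nr n f I * M) $$ (r, s) = (\<Sum>i\<in>I. (f i * M) $$ (r, s))" .
qed (use assms in auto)

definition mat_subspace :: "nat \<Rightarrow> nat \<Rightarrow> 'k::field mat set \<Rightarrow> bool" where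
  "mat_subspace nr nc S \<longleftrightarrow> S \<subseteq> carrier_mat nr nc \<and> 0\<^sub>m nr nc \<in> S \<and>
     (\<forall>x\<in>S. \<forall>y\<in>S. x + y \<in> S) \<and> (\<forall>a. \<forall>x\<in>S. a \<cdot>\<^sub>m x \<in> S)"

definition lin_map :: "'k::field mat set \<Rightarrow> 'k mat set \<Rightarrow> ('k mat \<Rightarrow> 'k mat) \<Rightarrow> bool" where
  "lin_map S S' L \<longleftrightarrow> (\<forall>x\<in>S. L x \<in> S') \<and>
     (\<forall>x\<in>S. \<forall>y\<in>S. L (x + y) = L x + L y) \<and> (\<forall>a. \<forall>x\<in>S. L (a \<cdot>\<^sub>m x) = a \<cdot>\<^sub>m L x)"

definition lin_form :: "'k::field mat set \<Rightarrow> ('k mat \<Rightarrow> 'k) \<Rightarrow> bool" where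
  "lin_form S c \<longleftrightarrow>
     (\<forall>x\<in>S. \<forall>y\<in>S. c (x + y) = c x + c y) \<and> (\<forall>a. \<forall>x\<in>S. c (a \<cdot>\<^sub>m x) = a * c x)"

text \<open>
  A basis \<open>b\<close> together with its coordinate forms \<open>c\<close>.  Matrices of varying sizes share one type,
  which therefore is not a vector space; so bases of spaces of matrices of a fixed size are described by
  explicit expansions instead.
\<close>

definition frame ::
    "nat \<Rightarrow> nat \<Rightarrow> 'k::field mat set \<Rightarrow> 'i set \<Rightarrow> ('i \<Rightarrow> 'k mat) \<Rightarrow> ('i \<Rightarrow> 'k mat \<Rightarrow> 'k) \<Rightarrow> bool"
  where
  "frame nr nc S I b c \<longleftrightarrow> finite I \<and> mat_subspace nr nc S \<and> (\<forall>i\<in>I. b i \<in> S \<and> lin_form S (c i)) \<and>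
     (\<forall>i\<in>I. \<forall>j\<in>I. c i (b j) = (if i = j then 1 else 0)) \<and>
     (\<forall>x\<in>S. x = mat_sum nr nc (\<lambda>i. c i x \<cdot>\<^sub>m b i) I)"

lemma mat_subspaceD:
  assumes "mat_subspace nr nc S"
  shows "x \<in> S \<Longrightarrow> x \<in> carrier_mat nr nc" "0\<^sub>m nr nc \<in> S"
    "x \<in> S \<Longrightarrow> y \<in> S \<Longrightarrow> x + y \<in> S" "x \<in> S \<Longrightarrow> a \<cdot>\<^sub>m x \<in> S"
  using assms by (auto simp: mat_subspace_def)

lemma lin_mapD:
  assumes "lin_map S S' L"
  shows "x \<in> S \<Longrightarrow> L x \<in> S'" "x \<in> S \<Longrightarrow> y \<in> S \<Longrightarrow> L (x + y) = L x + L y"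
    "x \<in> S \<Longrightarrow> L (a \<cdot>\<^sub>m x) = a \<cdot>\<^sub>m L x"
  using assms by (auto simp: lin_map_def)

lemma lin_formD:
  assumes "lin_form S c"
  shows "x \<in> S \<Longrightarrow> y \<in> S \<Longrightarrow> c (x + y) = c x + c y" "x \<in> S \<Longrightarrow> c (a \<cdot>\<^sub>m x) = a * c x"
  using assms by (auto simp: lin_form_def)

lemma lin_map_comp: "lin_map S S' L \<Longrightarrow> lin_map S' S'' L' \<Longrightarrow> lin_map S S'' (\<lambda>x. L' (L x))"
  by (auto simp: lin_map_def)

lemma lin_form_comp: "lin_map S S' L \<Longrightarrow> lin_form S' c \<Longrightarrow> lin_form S (\<lambda>x. c (L x))"
  by (auto simp: lin_map_def lin_form_def)

lemma lin_map_id: "lin_map S S (\<lambda>x. x)"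
  by (auto simp: lin_map_def)

lemma smult_zero_left: "x \<in> carrier_mat nr nc \<Longrightarrow> (0 :: 'k::field) \<cdot>\<^sub>m x = 0\<^sub>m nr nc"
  by (intro eq_matI) auto

lemma lin_form_zero:
  assumes "mat_subspace nr nc S" "lin_form S c" shows "c (0\<^sub>m nr nc) = 0"
  using lin_formD(2)[OF assms(2) mat_subspaceD(2)[OF assms(1)], of 0]
    smult_zero_left[of "0\<^sub>m nr nc" nr nc] by simp

lemma lin_map_zero:
  assumes "mat_subspace nr nc S" "lin_map S S' L" "mat_subspace nr' nc' S'" shows "L (0\<^sub>m nr nc) = 0\<^sub>m nr' nc'"
proof -
  have "L (0 \<cdot>\<^sub>m 0\<^sub>m nr nc) = 0 \<cdot>\<^sub>m L (0\<^sub>m nr nc)"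
    using lin_mapD(3)[OF assms(2)] mat_subspaceD(2)[OF assms(1)] by blast
  moreover have "L (0\<^sub>m nr nc) \<in> carrier_mat nr' nc'"
    using lin_mapD(1)[OF assms(2)] mat_subspaceD[OF assms(1)] mat_subspaceD(1)[OF assms(3)] by blast
  ultimately show ?thesis
    using smult_zero_left[OF zero_carrier_mat[of nr nc]] smult_zero_left by metis
qed

lemma mat_subspace_mat_sum:
  assumes S: "mat_subspace nr nc S" and I: "finite I" "\<And>i. i \<in> I \<Longrightarrow> f i \<in> S"
  shows "mat_sum nr nc f I \<in> S"
  using I
proof (induction I rule: finite_induct)
  case empty then show ?case using mat_subspaceD(2)[OF S] by simp
next
  case (insert i I)
  then have "f i \<in> S" "mat_sum nr nc f I \<in> S" by auto
  then show ?case using insert.hyps mat_subspaceD(1,3)[OF S] by (simp add: mat_sum_insert)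
qed

lemma lin_form_mat_sum:
  assumes S: "mat_subspace nr nc S" and c: "lin_form S c" and I: "finite I" "\<And>i. i \<in> I \<Longrightarrow> f i \<in> S"
  shows "c (mat_sum nr nc f I) = (\<Sum>i\<in>I. c (f i))"
  using I
proof (induction I rule: finite_induct)
  case empty then show ?case using lin_form_zero[OF S c] by simp
next
  case (insert i I)
  then have "f i \<in> S" "mat_sum nr nc f I \<in> S" using mat_subspace_mat_sum[OF S] by auto
  then show ?case using insert mat_subspaceD(1)[OF S] by (simp add: mat_sum_insert lin_formD[OF c])
qed

lemma lin_map_mat_sum:
  assumes S: "mat_subspace nr nc S" and S': "mat_subspace nr' nc' S'" and L: "lin_map S S' L"
    and I: "finite I" "\<And>i. i \<in> I \<Longrightarrow> f i \<in> S"
  shows "L (mat_sum nr nc f I) = mat_sum nr' nc' (\<lambda>i. L (f i)) I"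
  using I
proof (induction I rule: finite_induct)
  case empty then show ?case using lin_map_zero[OF S L S'] by simp
next
  case (insert i I)
  then have *: "f i \<in> S" "mat_sum nr nc f I \<in> S" using mat_subspace_mat_sum[OF S] by auto
  then have "L (f i) \<in> carrier_mat nr' nc'" using L S' by (meson lin_mapD(1) mat_subspaceD(1))
  with * show ?case using insert mat_subspaceD(1)[OF S] by (simp add: mat_sum_insert lin_mapD[OF L])
qed

lemma frameD:
  assumes "frame nr nc S I b c"
  shows "finite I" "mat_subspace nr nc S" "i \<in> I \<Longrightarrow> b i \<in> S" "i \<in> I \<Longrightarrow> lin_form S (c i)"
    "i \<in> I \<Longrightarrow> j \<in> I \<Longrightarrow> c i (b j) = (if i = j then 1 else 0)"
    "x \<in> S \<Longrightarrow> x = mat_sum nr nc (\<lambda>i. c i x \<cdot>\<^sub>m b i) I"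
  using assms by (auto simp: frame_def)

text \<open>
  Expanding \<open>L (b i)\<close> in the frame of the target turns both sides into the same double sum
  \<open>\<Sum>i j. c' j (L (b i)) * c i (L' (b' j))\<close>.
\<close>

lemma frame_trace_commute:
  assumes F: "frame nr nc S I b c" and F': "frame nr' nc' S' J b' c'"
    and L: "lin_map S S' L" and L': "lin_map S' S L'"
  shows "(\<Sum>i\<in>I. c i (L' (L (b i)))) = (\<Sum>j\<in>J. c' j (L (L' (b' j))))"
proof -
  have *: "d i (K' (K (e i))) = (\<Sum>j\<in>Y. d' j (K (e i)) * d i (K' (e' j)))"
    if "frame m n T X e d" "frame m' n' T' Y e' d'" "lin_map T T' K" "lin_map T' T K'" "i \<in> X"
    for m n T m' n' T' K K' i and X :: "'x set" and Y :: "'y set"  and e d e' d'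
  proof -
    note FT = frameD[OF that(1)] and FT' = frameD[OF that(2)]
    have mem: "K (e i) \<in> T'" using FT(3) that(3,5) by (auto simp: lin_map_def)
    have "d i (K' (K (e i))) = d i (K' (mat_sum m' n' (\<lambda>j. d' j (K (e i)) \<cdot>\<^sub>m e' j) Y))"
      using FT'(6)[OF mem] by simp
    also have "\<dots> = (\<Sum>j\<in>Y. d i (K' (d' j (K (e i)) \<cdot>\<^sub>m e' j)))"
      using lin_form_mat_sum[OF FT'(2) lin_form_comp[OF that(4) FT(4)[OF that(5)]] FT'(1)]
        FT'(2,3) by (simp add: mat_subspaceD)
    also have "\<dots> = (\<Sum>j\<in>Y. d' j (K (e i)) * d i (K' (e' j)))"
      using lin_formD(2)[OF lin_form_comp[OF that(4) FT(4)[OF that(5)]]] FT'(3)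
      by (intro sum.cong refl) auto
    finally show ?thesis .
  qed
  have "(\<Sum>i\<in>I. c i (L' (L (b i)))) = (\<Sum>i\<in>I. \<Sum>j\<in>J. c' j (L (b i)) * c i (L' (b' j)))"
    using *[OF F F' L L'] by (intro sum.cong refl) auto
  also have "\<dots> = (\<Sum>j\<in>J. \<Sum>i\<in>I. c i (L' (b' j)) * c' j (L (b i)))"
    by (subst sum.swap) (simp add: mult.commute)
  also have "\<dots> = (\<Sum>j\<in>J. c' j (L (L' (b' j))))"
    using *[OF F' F L' L] by (intro sum.cong refl) auto
  finally show ?thesis .
qed

lemma one_sided_inverse_dim_le:
  fixes U V :: "'k::field mat"
  assumes U: "U \<in> carrier_mat n m" and V: "V \<in> carrier_mat m n" and UV: "U * V = 1\<^sub>m n"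
  shows "n \<le> m"
proof (rule ccontr)
  assume "\<not> n \<le> m"
  then have mn: "m < n" by simp
  \<comment> \<open>pad by zeros to square matrices: a right inverse is then a left inverse, but row \<open>m\<close> of \<open>V'\<close> is zero\<close>
  define U' where "U' = mat n n (\<lambda>(i, j). if j < m then U $$ (i, j) else 0)"
  define V' where "V' = mat n n (\<lambda>(i, j). if i < m then V $$ (i, j) else 0)"
  have "U' * V' = 1\<^sub>m n"
  proof (rule eq_matI)
    fix i j assume "i < dim_row (1\<^sub>m n)" "j < dim_col (1\<^sub>m n)"
    then have ij: "i < n" "j < n" by auto
    have "(U' * V') $$ (i, j) = (\<Sum>k<n. U' $$ (i, k) * V' $$ (k, j))"
      using ij by (intro mult_index) (auto simp: U'_def V'_def)
    also have "\<dots> = (\<Sum>k<m. U $$ (i, k) * V $$ (k, j))"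
      using ij mn by (intro sum.mono_neutral_cong_right) (auto simp: U'_def V'_def)
    also have "\<dots> = (U * V) $$ (i, j)"
      using ij U V by (intro mult_index[symmetric]) auto
    finally show "(U' * V') $$ (i, j) = 1\<^sub>m n $$ (i, j)" using UV by simp
  qed (auto simp: U'_def V'_def)
  moreover have "U' \<in> carrier_mat n n" "V' \<in> carrier_mat n n"
    by (auto simp: U'_def V'_def)
  ultimately have "V' * U' = 1\<^sub>m n"
    using mat_mult_left_right_inverse by blast
  then have "(V' * U') $$ (m, m) = 1" using mn by simp
  moreover have "(V' * U') $$ (m, m) = (\<Sum>k<n. V' $$ (m, k) * U' $$ (k, m))"
    using mn by (intro mult_index) (auto simp: U'_def V'_def)
  ultimately show False using mn by (simp add: V'_def)
qed

lemma frame_card_le: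
  assumes F: "frame nr nc S I b c" and F': "frame nr nc S J b' c'"
  shows "card I \<le> card J"
proof -
  note FD = frameD[OF F] and FD' = frameD[OF F']
  obtain e where e: "bij_betw e {..<card I} I"
    using ex_bij_betw_nat_finite[OF FD(1)] by (auto simp: atLeast0LessThan)
  obtain e' where e': "bij_betw e' {..<card J} J"
    using ex_bij_betw_nat_finite[OF FD'(1)] by (auto simp: atLeast0LessThan)
  have eI: "\<And>i. i < card I \<Longrightarrow> e i \<in> I" and eJ: "\<And>i. i < card J \<Longrightarrow> e' i \<in> J"
    using e e' by (auto simp: bij_betw_def)
  define U where "U = mat (card I) (card J) (\<lambda>(i, j). c (e i) (b' (e' j)))"
  define V where "V = mat (card J) (card I) (\<lambda>(j, i). c' (e' j) (b (e i)))"
  have "U * V = 1\<^sub>m (card I)"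
  proof (rule eq_matI)
    fix i k assume "i < dim_row (1\<^sub>m (card I))" "k < dim_col (1\<^sub>m (card I))"
    then have ik: "i < card I" "k < card I" by auto
    have "(U * V) $$ (i, k) = (\<Sum>j<card J. U $$ (i, j) * V $$ (j, k))"
      using ik by (intro mult_index) (auto simp: U_def V_def)
    also have "\<dots> = (\<Sum>j<card J. c (e i) (b' (e' j)) * c' (e' j) (b (e k)))"
      using ik by (intro sum.cong) (auto simp: U_def V_def)
    also have "\<dots> = (\<Sum>j\<in>J. c (e i) (b' j) * c' j (b (e k)))"
      by (rule sum.reindex_bij_betw[OF e'])
    also have "\<dots> = (\<Sum>j\<in>J. c (e i) (c' j (b (e k)) \<cdot>\<^sub>m b' j))"
      using lin_formD(2)[OF FD(4)[OF eI[OF ik(1)]]] FD'(3)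
      by (intro sum.cong) (auto simp: mult.commute)
    also have "\<dots> = c (e i) (mat_sum nr nc (\<lambda>j. c' j (b (e k)) \<cdot>\<^sub>m b' j) J)"
      using FD'(3) FD(4)[OF eI[OF ik(1)]]
      by (intro lin_form_mat_sum[OF FD(2), symmetric] FD'(1)) (auto intro!: mat_subspaceD(4)[OF FD(2)])
    also have "\<dots> = c (e i) (b (e k))"
      using FD'(6)[OF FD(3)[OF eI[OF ik(2)]]] by simp
    also have "\<dots> = (if i = k then 1 else 0)"
      using FD(5)[OF eI[OF ik(1)] eI[OF ik(2)]] e ik by (auto simp: bij_betw_def inj_on_def)
    finally show "(U * V) $$ (i, k) = 1\<^sub>m (card I) $$ (i, k)" using ik by simp
  qed (auto simp: U_def V_def)
  then show ?thesis
    by (rule one_sided_inverse_dim_le[rotated 2]) (simp_all add: U_def V_def)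
qed

lemma mat_subspace_vanish:
  assumes "mat_subspace nr nc S" shows "mat_subspace nr nc {x \<in> S. r < nr \<and> s < nc \<longrightarrow> x $$ (r, s) = 0}"
proof -
  have c: "dim_row x = nr" "dim_col x = nc" if "x \<in> S" for x
    using mat_subspaceD(1)[OF assms that] by auto
  show ?thesis
    unfolding mat_subspace_def using mat_subspaceD[OF assms] c by (intro conjI subsetI ballI allI) simp_all
qed

text \<open>
  Induction on the set of positions where entries may be nonzero.  If some element is nonzero at a new
  position, a multiple of it spans a complement of the elements vanishing there.
\<close>

lemma frame_exists_supported:
  assumes "finite E" "mat_subspace nr nc S"
    and "\<And>x r s. x \<in> S \<Longrightarrow> r < nr \<Longrightarrow> s < nc \<Longrightarrow> (r, s) \<notin> E \<Longrightarrow> x $$ (r, s) = (0::'k::field)"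
  shows "\<exists>(I::nat set) b c. frame nr nc S I b c"
  using assms
proof (induction E arbitrary: S rule: finite_induct)
  case empty
  then have "x = 0\<^sub>m nr nc" if "x \<in> S" for x
    using that mat_subspaceD(1)[OF empty(1) that] by (intro eq_matI) auto
  then have "frame nr nc S ({}::nat set) (\<lambda>_. 0\<^sub>m nr nc) (\<lambda>_ _. 0)"
    using empty(1) by (auto simp: frame_def)
  then show ?case by blast
next
  case (insert e E)
  note S = mat_subspaceD[OF insert.prems(1)]
  obtain r s where e: "e = (r, s)" by (cases e)
  define S0 where "S0 = {x \<in> S. r < nr \<and> s < nc \<longrightarrow> x $$ (r, s) = 0}"
  have S0: "mat_subspace nr nc S0" unfolding S0_def by (rule mat_subspace_vanish[OF insert.prems(1)])
  have "\<exists>(I::nat set) b c. frame nr nc S0 I b c"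
    by (rule insert.IH[OF S0]) (use insert.prems(2) e in \<open>auto simp: S0_def\<close>)
  then obtain I :: "nat set" and b c where F: "frame nr nc S0 I b c" by blast
  note FD = frameD[OF F]
  show ?case
  proof (cases "S = S0")
    case True then show ?thesis using F by blast
  next
    case False
    then obtain t where t: "t \<in> S" "r < nr" "s < nc" "t $$ (r, s) \<noteq> 0" by (auto simp: S0_def)
    define u where "u = inverse (t $$ (r, s)) \<cdot>\<^sub>m t"
    have u: "u \<in> S" "u $$ (r, s) = 1" "u \<in> carrier_mat nr nc"
      using t S(4)[OF t(1)] S(1)[OF t(1)] by (auto simp: u_def)
    obtain n where n: "n \<notin> I" using FD(1) ex_new_if_finite infinite_UNIV_nat by blast
    define \<pi> where "\<pi> x = x + (- x $$ (r, s)) \<cdot>\<^sub>m u" for x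
    have \<pi>: "lin_map S S0 \<pi>"
      unfolding lin_map_def
    proof (intro conjI ballI allI)
      fix x assume x: "x \<in> S"
      note xc = S(1)[OF x]
      show "\<pi> x \<in> S0" using x xc u t S(3)[OF x S(4)[OF u(1)]] by (auto simp: S0_def \<pi>_def)
      fix y assume y: "y \<in> S"
      note yc = S(1)[OF y]
      show "\<pi> (x + y) = \<pi> x + \<pi> y"
        using xc yc u t by (intro eq_matI) (auto simp: \<pi>_def algebra_simps)
    next
      fix a x assume x: "x \<in> S"
      note xc = S(1)[OF x]
      show "\<pi> (a \<cdot>\<^sub>m x) = a \<cdot>\<^sub>m \<pi> x"
        using xc u t by (intro eq_matI) (auto simp: \<pi>_def algebra_simps)
    qed
    have \<pi>u: "\<pi> u = 0\<^sub>m nr nc" using u by (intro eq_matI) (auto simp: \<pi>_def)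
    have \<pi>S0: "\<pi> x = x" if "x \<in> S0" for x
      using that S(1)[of x] u t by (intro eq_matI) (auto simp: S0_def \<pi>_def)
    define b' where "b' = b(n := u)"
    define c' where "c' i x = (if i = n then x $$ (r, s) else c i (\<pi> x))" for i x
    \<comment> \<open>\<open>\<pi>\<close> projects onto the elements vanishing at \<open>(r, s)\<close> along \<open>u\<close>, the new basis vector\<close>
    have "frame nr nc S (insert n I) b' c'"
      unfolding frame_def
    proof (intro conjI ballI)
      show "finite (insert n I)" using FD(1) by simp
      show "mat_subspace nr nc S" by (rule insert.prems)
      fix i assume i: "i \<in> insert n I"
      show "b' i \<in> S" using i FD(3) u by (auto simp: b'_def S0_def)
      show "lin_form S (c' i)"
        using i n lin_form_comp[OF \<pi> FD(4)[of i]] t(2,3) S(1)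
        by (cases "i = n") (auto simp: c'_def lin_form_def carrier_matD[OF S(1)])
      fix j assume j: "j \<in> insert n I"
      have b0: "b k $$ (r, s) = 0" if "k \<in> I" for k using FD(3)[OF that] t by (auto simp: S0_def)
      show "c' i (b' j) = (if i = j then 1 else 0)"
        using i j n u b0 FD(5) \<pi>S0[OF FD(3)] \<pi>u lin_form_zero[OF S0 FD(4)]
        by (auto simp: b'_def c'_def)
    next
      fix x assume x: "x \<in> S"
      have \<pi>x: "\<pi> x \<in> S0" using \<pi> x by (auto simp: lin_map_def)
      have "mat_sum nr nc (\<lambda>i. c' i x \<cdot>\<^sub>m b' i) (insert n I)
          = x $$ (r, s) \<cdot>\<^sub>m u + mat_sum nr nc (\<lambda>i. c' i x \<cdot>\<^sub>m b' i) I"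
        using FD(1) n u by (subst mat_sum_insert) (auto simp: b'_def c'_def)
      also have "mat_sum nr nc (\<lambda>i. c' i x \<cdot>\<^sub>m b' i) I = mat_sum nr nc (\<lambda>i. c i (\<pi> x) \<cdot>\<^sub>m b i) I"
        using n by (intro mat_sum_cong) (auto simp: b'_def c'_def)
      also have "\<dots> = \<pi> x" using FD(6)[OF \<pi>x] by simp
      also have "x $$ (r, s) \<cdot>\<^sub>m u + \<pi> x = x"
        using u S(1)[OF x] t by (intro eq_matI) (auto simp: \<pi>_def)
      finally show "x = mat_sum nr nc (\<lambda>i. c' i x \<cdot>\<^sub>m b' i) (insert n I)" by simp
    qed
    then show ?thesis by blast
  qed
qed

lemma frame_exists: "mat_subspace nr nc S \<Longrightarrow> \<exists>(I::nat set) b c. frame nr nc S I b c"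
  by (rule frame_exists_supported[of "{..<nr} \<times> {..<nc}"]) auto

text \<open>
  A frame indexed by natural numbers, so that the choice does not depend on an index type; comparison with
  frames over other index sets then shows that dimensions and traces do not depend on the choice.
\<close>

definition std_frame where
  "std_frame nr nc (S :: 'k::field mat set) =
     (SOME (I :: nat set, b, c). frame nr nc S I b c)"

definition mat_dim :: "nat \<Rightarrow> nat \<Rightarrow> 'k::field mat set \<Rightarrow> nat" where
  "mat_dim nr nc S = (case std_frame nr nc S of (I, b, c) \<Rightarrow> card I)"

definition trace_on :: "nat \<Rightarrow> nat \<Rightarrow> 'k::field mat set \<Rightarrow> ('k mat \<Rightarrow> 'k mat) \<Rightarrow> 'k" where
  "trace_on nr nc S L = (case std_frame nr nc S of (I, b, c) \<Rightarrow> \<Sum>i\<in>I. c i (L (b i)))"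

lemma std_frame:
  assumes "mat_subspace nr nc S"
  shows "case std_frame nr nc S of (I, b, c) \<Rightarrow> frame nr nc S I b c"
proof -
  obtain I :: "nat set" and b c where "frame nr nc S I b c" using frame_exists[OF assms] by blast
  then have "case (I, b, c) of (I, b, c) \<Rightarrow> frame nr nc S I b c" by simp
  then show ?thesis unfolding std_frame_def by (rule someI)
qed

lemma mat_dim_frame:
  assumes F: "frame nr nc S I b c" shows "mat_dim nr nc S = card I"
proof -
  obtain J b' c' where J: "std_frame nr nc S = (J, b', c')" by (cases "std_frame nr nc S")
  then have F': "frame nr nc S J b' c'" using std_frame[OF frameD(2)[OF F]] by simp
  show ?thesis
    using frame_card_le[OF F F'] frame_card_le[OF F' F] by (simp add: mat_dim_def J)
qed

lemma trace_on_frame: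
  assumes F: "frame nr nc S I b c" and L: "lin_map S S L"
  shows "trace_on nr nc S L = (\<Sum>i\<in>I. c i (L (b i)))"
proof -
  obtain J b' c' where J: "std_frame nr nc S = (J, b', c')" by (cases "std_frame nr nc S")
  then have F': "frame nr nc S J b' c'" using std_frame[OF frameD(2)[OF F]] by simp
  show ?thesis
    using frame_trace_commute[OF F' F lin_map_id L] by (simp add: trace_on_def J)
qed

lemma mat_subspace_frame:
  assumes "mat_subspace nr nc S" obtains I :: "nat set" and b c where "frame nr nc S I b c"
  using frame_exists[OF assms] by blast

text \<open>
  A direct sum decomposition of \<open>S\<close> into copies of \<open>S0\<close>, with projections \<open>P k\<close> and embeddings
  \<open>E k\<close>.  Dimensions get multiplied by the number of copies, and traces are sums over the diagonal blocks.
  With a single copy this is the invariance under linear isomorphisms.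
\<close>

locale power_decomposition =
  fixes nr nc S nr0 nc0 S0 and K :: "'i set" and P :: "'i \<Rightarrow> 'k::field mat \<Rightarrow> 'k mat" and E
  assumes S: "mat_subspace nr nc S" and S0: "mat_subspace nr0 nc0 S0" and K: "finite K"
    and P: "\<And>k. k \<in> K \<Longrightarrow> lin_map S S0 (P k)" and E: "\<And>k. k \<in> K \<Longrightarrow> lin_map S0 S (E k)"
    and PE: "\<And>k l x. k \<in> K \<Longrightarrow> l \<in> K \<Longrightarrow> x \<in> S0 \<Longrightarrow>
              P k (E l x) = (if k = l then x else 0\<^sub>m nr0 nc0)"
    and EP: "\<And>x. x \<in> S \<Longrightarrow> mat_sum nr nc (\<lambda>k. E k (P k x)) K = x"
begin

lemma frame_power:
  assumes F: "frame nr0 nc0 S0 I b c"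
  shows "frame nr nc S (K \<times> I) (\<lambda>(k, i). E k (b i)) (\<lambda>(k, i) x. c i (P k x))"
  unfolding frame_def
proof (intro conjI ballI)
  note FD = frameD[OF F]
  show "finite (K \<times> I)" using K FD by simp
  show "mat_subspace nr nc S" by (rule S)
  fix p assume p: "p \<in> K \<times> I"
  show "(case p of (k, i) \<Rightarrow> E k (b i)) \<in> S" using p FD(3) lin_mapD(1)[OF E] by auto
  show "lin_form S (case p of (k, i) \<Rightarrow> \<lambda>x. c i (P k x))"
    using p lin_form_comp[OF P FD(4)] by auto
  fix q assume q: "q \<in> K \<times> I"
  show "(case p of (k, i) \<Rightarrow> \<lambda>x. c i (P k x)) (case q of (k, i) \<Rightarrow> E k (b i)) = (if p = q then 1 else 0)"
    using p q PE FD(3,5) lin_form_zero[OF S0 FD(4)] by (cases "fst p = fst q") (auto split: if_splits)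
next
  note FD = frameD[OF F]
  fix x assume x: "x \<in> S"
  have "x = mat_sum nr nc (\<lambda>k. E k (P k x)) K" by (rule EP[OF x, symmetric])
  also have "\<dots> = mat_sum nr nc (\<lambda>k. mat_sum nr nc (\<lambda>i. c i (P k x) \<cdot>\<^sub>m E k (b i)) I) K"
  proof (rule mat_sum_cong)
    fix k assume k: "k \<in> K"
    have "E k (P k x) = E k (mat_sum nr0 nc0 (\<lambda>i. c i (P k x) \<cdot>\<^sub>m b i) I)"
      using FD(6)[OF lin_mapD(1)[OF P[OF k] x]] by simp
    also have "\<dots> = mat_sum nr nc (\<lambda>i. E k (c i (P k x) \<cdot>\<^sub>m b i)) I"
      using FD(3) by (intro lin_map_mat_sum[OF S0 S E[OF k] FD(1)]) (auto intro: mat_subspaceD(4)[OF S0])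
    also have "\<dots> = mat_sum nr nc (\<lambda>i. c i (P k x) \<cdot>\<^sub>m E k (b i)) I"
      using FD(3) lin_mapD(3)[OF E[OF k]] by (intro mat_sum_cong) auto
    finally show "E k (P k x) = mat_sum nr nc (\<lambda>i. c i (P k x) \<cdot>\<^sub>m E k (b i)) I" .
  qed
  also have "\<dots> = mat_sum nr nc (\<lambda>p. (case p of (k, i) \<Rightarrow> \<lambda>x. c i (P k x)) x \<cdot>\<^sub>m (case p of (k, i) \<Rightarrow> E k (b i))) (K \<times> I)"
    by (intro eq_matI) (auto simp: sum.cartesian_product intro!: sum.cong)
  finally show "x = \<dots>" .
qed

lemma mat_dim_power: "mat_dim nr nc S = card K * mat_dim nr0 nc0 S0"
proof -
  obtain I :: "nat set" and b c where F: "frame nr0 nc0 S0 I b c" using mat_subspace_frame[OF S0] .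
  show ?thesis
    unfolding mat_dim_frame[OF F] mat_dim_frame[OF frame_power[OF F]] by (rule card_cartesian_product)
qed

lemma trace_power:
  assumes L: "lin_map S S L"
  shows "trace_on nr nc S L = (\<Sum>k\<in>K. trace_on nr0 nc0 S0 (\<lambda>x. P k (L (E k x))))"
proof -
  obtain I :: "nat set" and b c where F: "frame nr0 nc0 S0 I b c" using mat_subspace_frame[OF S0] .
  have "trace_on nr0 nc0 S0 (\<lambda>x. P k (L (E k x))) = (\<Sum>i\<in>I. c i (P k (L (E k (b i)))))"
    if "k \<in> K" for k
    by (rule trace_on_frame[OF F lin_map_comp[OF lin_map_comp[OF E[OF that] L] P[OF that]]])
  then show ?thesis
    by (simp add: trace_on_frame[OF frame_power[OF F] L] sum.cartesian_product split_def)
qed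

end

lemma trace_on_add:
  assumes "mat_subspace nr nc S" "lin_map S S L" "lin_map S S L'" 
    "lin_map S S M" "\<And>x. x \<in> S \<Longrightarrow> M x = L x + L' x"
  shows "trace_on nr nc S M = trace_on nr nc S L + trace_on nr nc S L'"
proof -
  obtain I :: "nat set" and b c where F: "frame nr nc S I b c" using mat_subspace_frame[OF assms(1)] .
  note FD = frameD[OF F]
  show ?thesis unfolding trace_on_frame[OF F assms(2)] trace_on_frame[OF F assms(3)]
      trace_on_frame[OF F assms(4)] sum.distrib[symmetric]
    using FD(3) assms(5) lin_formD(1)[OF FD(4)] lin_mapD(1)[OF assms(2)] lin_mapD(1)[OF assms(3)]
    by (intro sum.cong refl) simp
qed

lemma trace_on_smult:
  assumes "mat_subspace nr nc S" "lin_map S S L" "lin_map S S M" "\<And>x. x \<in> S \<Longrightarrow> M x = a \<cdot>\<^sub>m L x"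
  shows "trace_on nr nc S M = a * trace_on nr nc S L"
proof -
  obtain I :: "nat set" and b c where F: "frame nr nc S I b c" using mat_subspace_frame[OF assms(1)] .
  note FD = frameD[OF F]
  show ?thesis unfolding trace_on_frame[OF F assms(2)] trace_on_frame[OF F assms(3)]
      sum_distrib_left
    using FD(3) assms(4) lin_formD(2)[OF FD(4)] lin_mapD(1)[OF assms(2)] 
    by (intro sum.cong refl) simp
qed

lemma trace_on_cong:
  assumes "mat_subspace nr nc S" "\<And>x. x \<in> S \<Longrightarrow> L x = M x"
  shows "trace_on nr nc S L = trace_on nr nc S M"
proof -
  obtain J b c where J: "std_frame nr nc S = (J, b, c)" by (cases "std_frame nr nc S")
  then have F: "frame nr nc S J b c" using std_frame[OF assms(1)] by simp
  show ?thesis using frameD(3)[OF F] assms(2) by (simp add: trace_on_def J)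
qed

lemma power_decomposition_bij:
  assumes S: "mat_subspace nr nc S" and S': "mat_subspace nr' nc' S'" and L: "lin_map S S' L" and bij: "bij_betw L S S'"
  shows "power_decomposition nr nc S nr' nc' S' {()} (\<lambda>_. L) (\<lambda>_. inv_into S L)"
proof
  have inv: "inv_into S L y \<in> S" "L (inv_into S L y) = y" if "y \<in> S'" for y
    using that bij by (auto simp: bij_betw_def inv_into_into f_inv_into_f)
  have inv_L: "inv_into S L (L x) = x" if "x \<in> S" for x
    using that bij by (simp add: bij_betw_def)
  show "lin_map S' S (inv_into S L)"
    unfolding lin_map_def
  proof (intro conjI ballI allI)
    fix x assume x: "x \<in> S'"
    show "inv_into S L x \<in> S" by (rule inv[OF x])
    show "inv_into S L (a \<cdot>\<^sub>m x) = a \<cdot>\<^sub>m inv_into S L x" for a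
      using inv_L[OF mat_subspaceD(4)[OF S inv(1)[OF x]], of a] lin_mapD(3)[OF L inv(1)[OF x]] inv(2)[OF x] by simp
    fix y assume y: "y \<in> S'"
    show "inv_into S L (x + y) = inv_into S L x + inv_into S L y"
      using inv_L[OF mat_subspaceD(3)[OF S inv(1)[OF x] inv(1)[OF y]]] lin_mapD(2)[OF L inv(1)[OF x] inv(1)[OF y]]
        inv(2)[OF x] inv(2)[OF y] by simp
  qed
  show "L (inv_into S L x) = (if k = l then x else 0\<^sub>m nr' nc')" if "x \<in> S'" for k l :: unit and x
    using inv[OF that] by simp
  show "mat_sum nr nc (\<lambda>k. inv_into S L (L x)) {()} = x" if x: "x \<in> S" for x
    using mat_subspaceD(1)[OF S x] inv_L[OF x] by (intro eq_matI) auto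
qed (use S S' L in auto)

lemma mat_dim_bij:
  assumes "mat_subspace nr nc S" "mat_subspace nr' nc' S'" "lin_map S S' L" "bij_betw L S S'"
  shows "mat_dim nr nc S = mat_dim nr' nc' S'"
  using power_decomposition.mat_dim_power[OF power_decomposition_bij[OF assms]] by simp

lemma trace_on_bij:
  assumes S: "mat_subspace nr nc S" and S': "mat_subspace nr' nc' S'" and L: "lin_map S S' L" "bij_betw L S S'"
    and M: "lin_map S S M" and eq: "\<And>x. x \<in> S \<Longrightarrow> L (M x) = M' (L x)"
  shows "trace_on nr nc S M = trace_on nr' nc' S' M'"
proof -
  have inv: "inv_into S L y \<in> S" "L (inv_into S L y) = y" if "y \<in> S'" for y
    using that L(2) by (auto simp: bij_betw_def inv_into_into f_inv_into_f)
  have "trace_on nr nc S M = trace_on nr' nc' S' (\<lambda>x. L (M (inv_into S L x)))"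
    using power_decomposition.trace_power[OF power_decomposition_bij[OF S S' L] M] by simp
  also have "\<dots> = trace_on nr' nc' S' M'"
    using inv eq by (intro trace_on_cong[OF S']) simp
  finally show ?thesis .
qed

section \<open>Kronecker products and intertwiners\<close>

lemma mat_assoc:
  "dim_col A = dim_row B \<Longrightarrow> dim_col B = dim_row C \<Longrightarrow> (A * B) * C = A * (B * (C::'k::semiring_0 mat))"
  by (rule assoc_mult_mat[of _ "dim_row A" "dim_row B" _ "dim_row C" _ "dim_col C"]) auto

lemma mat_add_mult:
  "dim_row A = dim_row B \<Longrightarrow> dim_col A = dim_col B \<Longrightarrow> dim_col B = dim_row C \<Longrightarrow>
    (A + B) * C = A * C + B * (C::'k::semiring_0 mat)"
  by (rule add_mult_distrib_mat[of _ "dim_row A" "dim_col A" _ _ "dim_col C"]) auto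

lemma mat_mult_add:
  "dim_row B = dim_row C \<Longrightarrow> dim_col B = dim_col C \<Longrightarrow> dim_col A = dim_row B \<Longrightarrow>
    A * (B + C) = A * B + A * (C::'k::semiring_0 mat)"
  by (rule mult_add_distrib_mat[of _ "dim_row A" "dim_col A" _ "dim_col C"]) auto

lemma mat_smult_mult:
  "dim_col A = dim_row B \<Longrightarrow> (c \<cdot>\<^sub>m A) * B = c \<cdot>\<^sub>m (A * (B::'k::comm_semiring_0 mat))"
  by (rule mult_smult_assoc_mat[of _ "dim_row A" "dim_col A" _ "dim_col B"]) auto

lemma mat_mult_smult:
  "dim_col A = dim_row B \<Longrightarrow> A * (c \<cdot>\<^sub>m B) = c \<cdot>\<^sub>m (A * (B::'k::comm_semiring_0 mat))"
  by (rule mult_smult_distrib[of _ "dim_row A" "dim_col A" _ "dim_col B"]) auto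

lemma kronecker_dims [simp]:
  "dim_row (kronecker M N) = dim_row M * dim_row N" "dim_col (kronecker M N) = dim_col M * dim_col N"
  by (simp_all add: kronecker_def)

lemma kronecker_index:
  "i < dim_row M * dim_row N \<Longrightarrow> j < dim_col M * dim_col N \<Longrightarrow>
    kronecker M N $$ (i, j) =
      M $$ (i div dim_row N, j div dim_col N) * N $$ (i mod dim_row N, j mod dim_col N)"
  by (simp add: kronecker_def)

lemma div_mod_less:
  "(i::nat) < m * n \<Longrightarrow> i div n < m" "(i::nat) < m * n \<Longrightarrow> i mod n < n"
proof -
  assume i: "i < m * n"
  then have "0 < n" by (cases n) auto
  then show "i div n < m" "i mod n < n" using i by (simp_all add: less_mult_imp_div_less)
qed

text \<open>
  Splitting an index of \<open>k\<^bsup>p q\<^esup> = k\<^sup>p \<otimes> k\<^sup>q\<close> into the indices of its two factors.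
\<close>

lemma sum_div_mod:
  fixes f :: "nat \<Rightarrow> nat \<Rightarrow> 'k::comm_monoid_add"
  shows "(\<Sum>k<p * q. f (k div q) (k mod q)) = (\<Sum>a<p. \<Sum>b<q. f a b)"
proof -
  have "(\<Sum>k<p * q. f (k div q) (k mod q)) = (\<Sum>(a, b)\<in>{..<p} \<times> {..<q}. f a b)"
  proof (rule sum.reindex_bij_witness[where i = "\<lambda>(a, b). a * q + b" and j = "\<lambda>k. (k div q, k mod q)"])
    fix x assume "x \<in> {..<p} \<times> {..<q}"
    then obtain a b where x: "x = (a, b)" "a < p" "b < q" by auto
    have "a * q + b < (a + 1) * q" using x by simp
    also have "\<dots> \<le> p * q" using x by (intro mult_right_mono) auto
    finally show "(case x of (a, b) \<Rightarrow> a * q + b) \<in> {..<p * q}" using x by simp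
  qed (auto simp: div_mod_less)
  then show ?thesis by (simp add: sum.cartesian_product)
qed

lemma kronecker_mult:
  fixes M N :: "'k::comm_semiring_0 mat"
  assumes "dim_col M = dim_row M'" "dim_col N = dim_row N'"
  shows "kronecker M N * kronecker M' N' = kronecker (M * M') (N * N')"
proof (rule eq_matI)
  fix i j assume "i < dim_row (kronecker (M * M') (N * N'))" "j < dim_col (kronecker (M * M') (N * N'))"
  then have i: "i < dim_row M * dim_row N" and j: "j < dim_col M' * dim_col N'" by auto
  note d = div_mod_less[OF i] div_mod_less[OF j]
  let ?p = "dim_row M'" and ?q = "dim_row N'"
  have "(kronecker M N * kronecker M' N') $$ (i, j)
      = (\<Sum>k<?p * ?q. kronecker M N $$ (i, k) * kronecker M' N' $$ (k, j))"
    using i j assms by (intro mult_index) auto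
  also have "\<dots> = (\<Sum>k<?p * ?q.
      (M $$ (i div dim_row N, k div ?q) * M' $$ (k div ?q, j div dim_col N')) *
      (N $$ (i mod dim_row N, k mod ?q) * N' $$ (k mod ?q, j mod dim_col N')))"
    using i j assms by (intro sum.cong refl) (simp add: kronecker_index ac_simps)
  also have "\<dots> = (\<Sum>a<?p. \<Sum>b<?q.
      (M $$ (i div dim_row N, a) * M' $$ (a, j div dim_col N')) *
      (N $$ (i mod dim_row N, b) * N' $$ (b, j mod dim_col N')))"
    by (rule sum_div_mod)
  also have "\<dots> = (\<Sum>a<?p. M $$ (i div dim_row N, a) * M' $$ (a, j div dim_col N')) *
      (\<Sum>b<?q. N $$ (i mod dim_row N, b) * N' $$ (b, j mod dim_col N'))"
    by (rule sum_product[symmetric])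
  also have "\<dots> = (M * M') $$ (i div dim_row N, j div dim_col N') *
      (N * N') $$ (i mod dim_row N, j mod dim_col N')"
    using d assms by (subst (1 2) mult_index[OF carrier_matI carrier_matI]) auto
  also have "\<dots> = kronecker (M * M') (N * N') $$ (i, j)"
    using i j by (simp add: kronecker_index)
  finally show "(kronecker M N * kronecker M' N') $$ (i, j) = kronecker (M * M') (N * N') $$ (i, j)" .
qed (use assms in auto)

lemma kronecker_one: "kronecker (1\<^sub>m m) (1\<^sub>m n) = (1\<^sub>m (m * n) :: 'k::semiring_1 mat)"
proof (rule eq_matI)
  fix i j assume "i < dim_row (1\<^sub>m (m * n) :: 'k mat)" "j < dim_col (1\<^sub>m (m * n) :: 'k mat)"
  then have ij: "i < m * n" "j < m * n" by auto
  have "i = j \<longleftrightarrow> i div n = j div n \<and> i mod n = j mod n" by (metis div_mult_mod_eq)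
  then show "kronecker (1\<^sub>m m) (1\<^sub>m n) $$ (i, j) = (1\<^sub>m (m * n) :: 'k mat) $$ (i, j)"
    using ij div_mod_less[OF ij(1)] div_mod_less[OF ij(2)] by (auto simp: kronecker_index)
qed auto

lemma kronecker_add_left:
  fixes M N :: "'k::semiring_0 mat"
  shows "dim_row M = dim_row M' \<Longrightarrow> dim_col M = dim_col M' \<Longrightarrow>
    kronecker (M + M') N = kronecker M N + kronecker M' N"
  by (rule eq_matI) (auto simp: kronecker_index div_mod_less algebra_simps)

lemma kronecker_smult_left:
  fixes M N :: "'k::comm_semiring_0 mat"
  shows "kronecker (c \<cdot>\<^sub>m M) N = c \<cdot>\<^sub>m kronecker M N"
  by (rule eq_matI) (auto simp: kronecker_index div_mod_less algebra_simps)

lemma kronecker_zero [simp]: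
  fixes M :: "'k::semiring_0 mat"
  shows "kronecker (0\<^sub>m a b) M = 0\<^sub>m (a * dim_row M) (b * dim_col M)"
    "kronecker M (0\<^sub>m a b) = 0\<^sub>m (dim_row M * a) (dim_col M * b)"
  by (rule eq_matI; auto simp: kronecker_index div_mod_less)+

lemma kronecker_mat_sum_left:
  fixes N :: "'k::semiring_0 mat"
  assumes "\<And>i. i \<in> I \<Longrightarrow> f i \<in> carrier_mat a b"
  shows "kronecker (mat_sum a b f I) N
    = mat_sum (a * dim_row N) (b * dim_col N) (\<lambda>i. kronecker (f i) N) I"
proof (rule eq_matI)
  fix r s assume "r < dim_row (mat_sum (a * dim_row N) (b * dim_col N) (\<lambda>i. kronecker (f i) N) I)"
    "s < dim_col (mat_sum (a * dim_row N) (b * dim_col N) (\<lambda>i. kronecker (f i) N) I)"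
  then have rs: "r < a * dim_row N" "s < b * dim_col N" by auto
  then show "kronecker (mat_sum a b f I) N $$ (r, s)
      = mat_sum (a * dim_row N) (b * dim_col N) (\<lambda>i. kronecker (f i) N) I $$ (r, s)"
    using carrier_matD[OF assms] by (auto simp: kronecker_index div_mod_less sum_distrib_right)
qed auto

lemma kronecker_mat_sum_right:
  fixes N :: "'k::semiring_0 mat"
  assumes "\<And>i. i \<in> I \<Longrightarrow> f i \<in> carrier_mat a b"
  shows "kronecker N (mat_sum a b f I)
    = mat_sum (dim_row N * a) (dim_col N * b) (\<lambda>i. kronecker N (f i)) I"
proof (rule eq_matI)
  fix r s assume "r < dim_row (mat_sum (dim_row N * a) (dim_col N * b) (\<lambda>i. kronecker N (f i)) I)"
    "s < dim_col (mat_sum (dim_row N * a) (dim_col N * b) (\<lambda>i. kronecker N (f i)) I)"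
  then have rs: "r < dim_row N * a" "s < dim_col N * b" by auto
  then show "kronecker N (mat_sum a b f I) $$ (r, s)
      = mat_sum (dim_row N * a) (dim_col N * b) (\<lambda>i. kronecker N (f i)) I $$ (r, s)"
    using carrier_matD[OF assms] by (auto simp: kronecker_index div_mod_less sum_distrib_left)
qed auto

lemma repD:
  assumes "is_rep H X"
  shows "snd X a \<in> carrier_mat (fst X) (fst X)" "dim_row (snd X a) = fst X" "dim_col (snd X a) = fst X"
    "snd X (a + b) = snd X a + snd X b" "snd X (scale H c a) = c \<cdot>\<^sub>m snd X a"
    "snd X 1 = 1\<^sub>m (fst X)" "snd X (a * b) = snd X a * snd X b"
  using assms by (auto simp: is_rep_def split: prod.splits)

lemma HomD:
  assumes "T \<in> intertwiners X Y"
  shows "T \<in> carrier_mat (fst Y) (fst X)" "dim_row T = fst Y" "dim_col T = fst X"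
    "T * snd X a = snd Y a * T"
  using assms by (auto simp: intertwiners_def)

lemma HomI:
  "T \<in> carrier_mat (fst Y) (fst X) \<Longrightarrow> (\<And>a. T * snd X a = snd Y a * T) \<Longrightarrow> T \<in> intertwiners X Y"
  by (auto simp: intertwiners_def)

lemma Hom_comp:
  assumes "is_rep H X" "is_rep H Y" "is_rep H Z" "T \<in> intertwiners X Y" "U \<in> intertwiners Y Z"
  shows "U * T \<in> intertwiners X Z"
proof (rule HomI)
  note d = HomD[OF assms(4)] HomD[OF assms(5)] repD(2,3)[OF assms(1)] repD(2,3)[OF assms(2)]
    repD(2,3)[OF assms(3)]
  show "U * T \<in> carrier_mat (fst Z) (fst X)" using d by auto
  fix a
  have "U * T * snd X a = U * (T * snd X a)" using d by (simp add: mat_assoc)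
  also have "\<dots> = (U * snd Y a) * T" unfolding d(4) using d(2,3,6,7,9-) by (simp add: mat_assoc)
  also have "\<dots> = snd Z a * (U * T)" unfolding d(8) using d(2,3,6,7,9-) by (simp add: mat_assoc)
  finally show "U * T * snd X a = snd Z a * (U * T)" .
qed

lemma Hom_one: "is_rep H X \<Longrightarrow> 1\<^sub>m (fst X) \<in> intertwiners X X"
  by (rule HomI) (simp_all add: repD(2,3))

lemma Hom_mat_subspace:
  assumes "is_rep H X" "is_rep H Y"
  shows "mat_subspace (fst Y) (fst X) (intertwiners X Y)"
  unfolding mat_subspace_def
proof (intro conjI subsetI ballI allI)
  note d = repD(2,3)[OF assms(1)] repD(2,3)[OF assms(2)]
  show "0\<^sub>m (fst Y) (fst X) \<in> intertwiners X Y" using d by (intro HomI) auto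
  fix T assume T: "T \<in> intertwiners X Y"
  note dT = HomD[OF T]
  show "T \<in> carrier_mat (fst Y) (fst X)" by (rule dT)
  show "c \<cdot>\<^sub>m T \<in> intertwiners X Y" for c
    using d dT by (intro HomI) (auto simp: mat_smult_mult mat_mult_smult)
  fix U assume U: "U \<in> intertwiners X Y"
  note dU = HomD[OF U]
  show "T + U \<in> intertwiners X Y"
    using d dT dU by (intro HomI) (auto simp: mat_add_mult mat_mult_add)
qed

lemma foldr_add_mat_sum:
  assumes "\<And>p. p \<in> set xs \<Longrightarrow> f p \<in> carrier_mat m n"
  shows "foldr (+) (map f xs) (0\<^sub>m m n) = mat_sum m n (\<lambda>k. f (xs ! k)) {..<length xs}"
  using assms
proof (induction xs)
  case (Cons p xs)
  have "mat_sum m n (\<lambda>k. f ((p # xs) ! k)) {..<length (p # xs)} = f p + mat_sum m n (\<lambda>k. f (xs ! k)) {..<length xs}"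
    using Cons.prems by (intro eq_matI) (auto simp: sum.lessThan_Suc_shift simp del: sum.lessThan_Suc)
  then show ?case using Cons by simp
qed (simp add: lessThan_def)

lemma fst_rep_tensor [simp]: "fst (rep_tensor H X Y) = fst X * fst Y"
  by (simp add: rep_tensor_def)

lemma rep_tensor_mat_sum:
  assumes "is_rep H X" "is_rep H Y"
  shows "snd (rep_tensor H X Y) a = mat_sum (fst X * fst Y) (fst X * fst Y)
    (\<lambda>k. kronecker (snd X (fst (comult H a ! k))) (snd Y (snd (comult H a ! k)))) {..<length (comult H a)}"
  unfolding rep_tensor_def snd_conv split_def
  by (rule foldr_add_mat_sum[of "comult H a" "\<lambda>p. kronecker (snd X (fst p)) (snd Y (snd p))"])
     (auto intro!: carrier_matI simp: repD[OF assms(1)] repD[OF assms(2)])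

lemma rep_tensor_index:
  assumes "is_rep H X" "is_rep H Y" "i < fst X * fst Y" "j < fst X * fst Y"
  shows "snd (rep_tensor H X Y) a $$ (i, j) = (\<Sum>(x, y)\<leftarrow>comult H a.
     snd X x $$ (i div fst Y, j div fst Y) * snd Y y $$ (i mod fst Y, j mod fst Y))"
proof -
  have "snd (rep_tensor H X Y) a $$ (i, j) = (\<Sum>k<length (comult H a).
     snd X (fst (comult H a ! k)) $$ (i div fst Y, j div fst Y) *
     snd Y (snd (comult H a ! k)) $$ (i mod fst Y, j mod fst Y))"
    using assms by (simp add: rep_tensor_mat_sum kronecker_index repD)
  also have "\<dots> = (\<Sum>(x, y)\<leftarrow>comult H a.
     snd X x $$ (i div fst Y, j div fst Y) * snd Y y $$ (i mod fst Y, j mod fst Y))"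
    by (simp add: sum_list_sum_nth split_def atLeast0LessThan)
  finally show ?thesis .
qed

lemma Hom_kronecker:
  assumes "is_rep H X" "is_rep H X'" "is_rep H Y" "is_rep H Y'"
    and f: "f \<in> intertwiners X X'" and g: "g \<in> intertwiners Y Y'"
  shows "kronecker f g \<in> intertwiners (rep_tensor H X Y) (rep_tensor H X' Y')"
proof (rule HomI)
  note d = repD(2,3)[OF assms(1)] repD(2,3)[OF assms(2)] repD(2,3)[OF assms(3)] repD(2,3)[OF assms(4)]
  note df = HomD[OF f] and dg = HomD[OF g]
  show c: "kronecker f g \<in> carrier_mat (fst (rep_tensor H X' Y')) (fst (rep_tensor H X Y))"
    using df dg by (auto intro: carrier_matI)
  fix a
  let ?l = "length (comult H a)" and ?x = "\<lambda>k. fst (comult H a ! k)" and ?y = "\<lambda>k. snd (comult H a ! k)"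
  have c: "kronecker f g \<in> carrier_mat (fst X' * fst Y') (fst X * fst Y)" using c by simp
  have "kronecker f g * snd (rep_tensor H X Y) a = mat_sum (fst X' * fst Y') (fst X * fst Y)
      (\<lambda>k. kronecker f g * kronecker (snd X (?x k)) (snd Y (?y k))) {..<?l}"
    unfolding rep_tensor_mat_sum[OF assms(1,3)] by (rule mult_mat_sum[OF c]) (auto intro!: carrier_matI simp: d)
  also have "\<dots> = mat_sum (fst X' * fst Y') (fst X * fst Y)
      (\<lambda>k. kronecker (snd X' (?x k)) (snd Y' (?y k)) * kronecker f g) {..<?l}"
    using d df dg by (intro mat_sum_cong) (simp add: kronecker_mult)
  also have "\<dots> = snd (rep_tensor H X' Y') a * kronecker f g"
    unfolding rep_tensor_mat_sum[OF assms(2,4)] by (rule mat_sum_mult[OF c, symmetric]) (auto intro!: carrier_matI simp: d)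
  finally show "kronecker f g * snd (rep_tensor H X Y) a = snd (rep_tensor H X' Y') a * kronecker f g" .
qed

lemma sum_list_concat_map:
  "sum_list (map f (concat (map g xs))) = (\<Sum>x\<leftarrow>xs. sum_list (map (f :: _ \<Rightarrow> 'k::monoid_add) (g x)))"
  by (induction xs) auto

lemma (in fd_hopf_algebra) bilinear_formI:
  assumes "\<And>x x' y. \<beta> (x + x') y = \<beta> x y + \<beta> x' y" "\<And>c x y. \<beta> (scale H c x) y = c * \<beta> x y"
    "\<And>x y y'. \<beta> x (y + y') = \<beta> x y + \<beta> x y'" "\<And>c x y. \<beta> x (scale H c y) = c * \<beta> x y"
  shows "bilinear_form (scale H) \<beta>"
proof -
  have "vector_space ((*) :: 'k \<Rightarrow> 'k \<Rightarrow> 'k)" by unfold_locales (auto simp: algebra_simps)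
  then show ?thesis
    using assms vector_space_axioms by (auto simp: bilinear_form_def Vector_Spaces.linear_iff)
qed

text \<open>
  The matrix entries of the action of \<open>a\<close> are values of bilinear forms on \<open>\<Delta>(a)\<close>, so each condition on
  a representation is one of the axioms for \<open>\<Delta>\<close> tested with these forms.
\<close>

lemma (in fd_hopf_algebra) rep_tensor_is_rep:
  assumes X: "is_rep H X" and Y: "is_rep H Y"
  shows "is_rep H (rep_tensor H X Y)"
proof -
  let ?n = "fst X * fst Y" and ?T = "snd (rep_tensor H X Y)"
  have car: "?T a \<in> carrier_mat ?n ?n" for a unfolding rep_tensor_mat_sum[OF X Y] by simp
  define \<beta> where "\<beta> i j x y = snd X x $$ (i div fst Y, j div fst Y) * snd Y y $$ (i mod fst Y, j mod fst Y)"
    for i j x y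
  have bil: "bilinear_form (scale H) (\<beta> i j)" if "i < ?n" "j < ?n" for i j
    using div_mod_less[OF that(1)] div_mod_less[OF that(2)]
    by (intro bilinear_formI) (simp_all add: \<beta>_def repD[OF X] repD[OF Y] algebra_simps)
  have ix: "?T a $$ (i, j) = (\<Sum>(x, y)\<leftarrow>comult H a. \<beta> i j x y)" if "i < ?n" "j < ?n" for a i j
    using rep_tensor_index[OF X Y that] by (simp add: \<beta>_def)
  have eq: "(\<Sum>(x, y)\<leftarrow>t. \<beta> i j x y) = (\<Sum>(x, y)\<leftarrow>u. \<beta> i j x y)"
    if "i < ?n" "j < ?n" "tensor2_eq (scale H) t u" for i j t u
    using bil[OF that(1,2)] that(3) by (auto simp: tensor2_eq_def)
  have add: "?T (a + b) = ?T a + ?T b" for a b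
    using car by (intro eq_matI) (simp_all add: ix eq[OF _ _ comult_add] carrier_matD[OF car])
  have sc: "?T (scale H c a) = c \<cdot>\<^sub>m ?T a" for c a
  proof (rule eq_matI)
    fix i j assume "i < dim_row (c \<cdot>\<^sub>m ?T a)" "j < dim_col (c \<cdot>\<^sub>m ?T a)"
    then have ij: "i < ?n" "j < ?n" using carrier_matD[OF car] by auto
    have "\<beta> i j (scale H c x) y = c * \<beta> i j x y" for x y
      using div_mod_less[OF ij(1)] div_mod_less[OF ij(2)] by (simp add: \<beta>_def repD[OF X])
    then have "?T (scale H c a) $$ (i, j) = (\<Sum>(x, y)\<leftarrow>comult H a. c * \<beta> i j x y)"
      unfolding ix[OF ij] eq[OF ij comult_scale] by (simp add: o_def split_def)
    then show "?T (scale H c a) $$ (i, j) = (c \<cdot>\<^sub>m ?T a) $$ (i, j)"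
      using ij carrier_matD[OF car] by (simp add: ix split_def sum_list_const_mult)
  qed (simp_all add: carrier_matD[OF car])
  have one: "?T 1 = 1\<^sub>m ?n"

  proof (intro eq_matI)
    fix i j assume "i < dim_row (1\<^sub>m ?n :: 'k mat)" "j < dim_col (1\<^sub>m ?n :: 'k mat)"
    then have ij: "i < ?n" "j < ?n" by auto
    have "i = j \<longleftrightarrow> i div fst Y = j div fst Y \<and> i mod fst Y = j mod fst Y" by (metis div_mult_mod_eq)
    then show "?T 1 $$ (i, j) = 1\<^sub>m ?n $$ (i, j)"
      unfolding ix[OF ij] eq[OF ij comult_one]
      using ij div_mod_less[OF ij(1)] div_mod_less[OF ij(2)]
      by (auto simp add: \<beta>_def repD[OF X] repD[OF Y])
  qed (simp_all add: carrier_matD[OF car])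
  have mult: "?T (a * b) = ?T a * ?T b" for a b
  proof (rule eq_matI)
    fix i j assume "i < dim_row (?T a * ?T b)" "j < dim_col (?T a * ?T b)"
    then have ij: "i < ?n" "j < ?n" using carrier_matD[OF car] by auto
    note d = div_mod_less[OF ij(1)] div_mod_less[OF ij(2)]
    have *: "\<beta> i j (x * x') (y * y') = (\<Sum>k<?n. \<beta> i k x y * \<beta> k j x' y')" for x x' y y'
    proof -
      have "(snd X x * snd X x') $$ (i div fst Y, j div fst Y) * (snd Y y * snd Y y') $$ (i mod fst Y, j mod fst Y)
        = (\<Sum>p<fst X. \<Sum>q<fst Y. (snd X x $$ (i div fst Y, p) * snd X x' $$ (p, j div fst Y)) *
             (snd Y y $$ (i mod fst Y, q) * snd Y y' $$ (q, j mod fst Y)))"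
        using d by (simp add: mult_index[OF repD(1)[OF X] repD(1)[OF X]]
            mult_index[OF repD(1)[OF Y] repD(1)[OF Y]] sum_product del: index_mult_mat)
      then show ?thesis
        unfolding \<beta>_def repD(7)[OF X] repD(7)[OF Y] sum_div_mod[symmetric] by (simp add: ac_simps)
    qed
    have "?T (a * b) $$ (i, j) = (\<Sum>(x, y)\<leftarrow>comult H a. \<Sum>(x', y')\<leftarrow>comult H b. \<beta> i j (x * x') (y * y'))"
      unfolding ix[OF ij] eq[OF ij comult_mult]
      by (simp add: o_def split_def sum_list_concat_map)
    also have "\<dots> = (\<Sum>k<?n. (\<Sum>(x, y)\<leftarrow>comult H a. \<beta> i k x y) * (\<Sum>(x', y')\<leftarrow>comult H b. \<beta> k j x' y'))"
      unfolding * sum_list_sum_nth length_map split_def atLeast0LessThan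
      by (simp add: sum_product sum_list_sum_nth atLeast0LessThan)
         (simp add: sum.swap[of _ _ "{..<?n}"])
    also have "\<dots> = (?T a * ?T b) $$ (i, j)"
      using ij by (simp add: mult_index[OF car car] ix del: index_mult_mat)
    finally show "?T (a * b) $$ (i, j) = (?T a * ?T b) $$ (i, j)" .
  qed (simp_all add: carrier_matD[OF car])
  show ?thesis
    using car add sc one mult by (simp add: is_rep_def split_def)
qed

section \<open>The negligible endomorphisms of a module\<close>

text \<open>
  For a progenerator \<open>R\<close>, these are the components at \<open>R\<close> of the natural transformations from
  \<open>R \<otimes> -\<close> to the identity functor.
\<close>

definition actions :: "('k::field, 'a::ring_1) hopf \<Rightarrow> ('k, 'a) rep \<Rightarrow> 'k mat set" where
  "actions H R = {t \<in> intertwiners (rep_tensor H R R) R.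
     \<forall>g\<in>intertwiners R R. t * kronecker (1\<^sub>m (fst R)) g = g * t}"

definition action_trace :: "('k::field, 'a::ring_1) hopf \<Rightarrow> ('k, 'a) rep \<Rightarrow> 'k mat \<Rightarrow> 'k" where
  "action_trace H R f = trace_on (fst R) (fst R * fst R) (actions H R) (\<lambda>t. t * kronecker f (1\<^sub>m (fst R)))"

text \<open>
  The radical of the trace form of the action of \<open>End R\<close> on \<open>actions H R\<close> by precomposition with
  \<open>f \<otimes> 1\<close>.  For regular \<open>R\<close> this form is the Killing form.
\<close>

definition negligible :: "('k::field, 'a::ring_1) hopf \<Rightarrow> ('k, 'a) rep \<Rightarrow> 'k mat set" where
  "negligible H R = {f \<in> intertwiners R R. \<forall>g\<in>intertwiners R R. action_trace H R (g * f) = 0}"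

lemma actionsD:
  assumes "t \<in> actions H R"
  shows "t \<in> intertwiners (rep_tensor H R R) R" "dim_row t = fst R" "dim_col t = fst R * fst R"
    "g \<in> intertwiners R R \<Longrightarrow> t * kronecker (1\<^sub>m (fst R)) g = g * t"
  using assms HomD[of t "rep_tensor H R R" R] by (auto simp: actions_def)

context fd_hopf_algebra
begin

lemma actions_mat_subspace:
  assumes R: "is_rep H R" shows "mat_subspace (fst R) (fst R * fst R) (actions H R)"
proof -
  note S = mat_subspaceD[OF Hom_mat_subspace[OF rep_tensor_is_rep[OF R R] R], unfolded fst_rep_tensor]
  show ?thesis
    unfolding mat_subspace_def
  proof (intro conjI subsetI ballI allI)
    show "0\<^sub>m (fst R) (fst R * fst R) \<in> actions H R"
      using S(2) HomD(2,3)[of _ R R] by (auto simp: actions_def)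
    fix t assume t: "t \<in> actions H R"
    note dt = actionsD[OF t]
    show "t \<in> carrier_mat (fst R) (fst R * fst R)" by (rule S(1)[OF dt(1)])
    show "c \<cdot>\<^sub>m t \<in> actions H R" for c
      using S(4)[OF dt(1)] dt(2-4) HomD(2,3)[of _ R R]
      by (auto simp: actions_def mat_smult_mult mat_mult_smult)
    fix u assume u: "u \<in> actions H R"
    note du = actionsD[OF u]
    show "t + u \<in> actions H R"
      using S(3)[OF dt(1) du(1)] dt(2-4) du(2-4) HomD(2,3)[of _ R R]
      by (auto simp: actions_def mat_add_mult mat_mult_add)
  qed
qed

lemma actions_precomp:
  assumes R: "is_rep H R" and f: "f \<in> intertwiners R R"
  shows "lin_map (actions H R) (actions H R) (\<lambda>t. t * kronecker f (1\<^sub>m (fst R)))"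
proof -
  note df = HomD[OF f] and RR = rep_tensor_is_rep[OF R R]
  have "t * kronecker f (1\<^sub>m (fst R)) \<in> actions H R" if t: "t \<in> actions H R" for t
  proof -
    note dt = actionsD[OF t]
    have "t * kronecker f (1\<^sub>m (fst R)) * kronecker (1\<^sub>m (fst R)) g = g * (t * kronecker f (1\<^sub>m (fst R)))"
      if g: "g \<in> intertwiners R R" for g
    proof -
      note dg = HomD[OF g]
      have "t * kronecker f (1\<^sub>m (fst R)) * kronecker (1\<^sub>m (fst R)) g
          = (t * kronecker (1\<^sub>m (fst R)) g) * kronecker f (1\<^sub>m (fst R))"
        using dt(2,3) df(2,3) dg(2,3) by (simp add: mat_assoc kronecker_mult)
      then show ?thesis unfolding dt(4)[OF g] using dt(2,3) df(2,3) dg(2,3) by (simp add: mat_assoc)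
    qed
    then show ?thesis
      using Hom_comp[OF RR RR R Hom_kronecker[OF R R R R f Hom_one[OF R]] dt(1)] by (auto simp: actions_def)
  qed
  then show ?thesis
    using df actionsD(2,3)[of _ H R] by (auto simp: lin_map_def mat_add_mult mat_smult_mult)
qed

lemma action_trace_lin_form:
  assumes R: "is_rep H R" shows "lin_form (intertwiners R R) (action_trace H R)"
  unfolding lin_form_def
proof (intro conjI ballI allI)
  note S = mat_subspaceD[OF Hom_mat_subspace[OF R R]]
  fix f assume f: "f \<in> intertwiners R R"
  note df = HomD(2,3)[OF f]
  show "action_trace H R (c \<cdot>\<^sub>m f) = c * action_trace H R f" for c
    unfolding action_trace_def
    by (rule trace_on_smult[OF actions_mat_subspace[OF R] actions_precomp[OF R f] actions_precomp[OF R S(4)[OF f]]])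
       (simp add: kronecker_smult_left mat_mult_smult df actionsD(2,3))
  fix g assume g: "g \<in> intertwiners R R"
  note dg = HomD(2,3)[OF g]
  show "action_trace H R (f + g) = action_trace H R f + action_trace H R g"
    unfolding action_trace_def
    by (rule trace_on_add[OF actions_mat_subspace[OF R] actions_precomp[OF R f] actions_precomp[OF R g]
          actions_precomp[OF R S(3)[OF f g]]])
       (simp add: kronecker_add_left mat_mult_add df dg actionsD(2,3))
qed

lemma negligible_mat_subspace:
  assumes R: "is_rep H R" shows "mat_subspace (fst R) (fst R) (negligible H R)"
  unfolding mat_subspace_def
proof (intro conjI subsetI ballI allI)
  note S = mat_subspaceD[OF Hom_mat_subspace[OF R R]]
  note lin = lin_formD[OF action_trace_lin_form[OF R]]
  note comp = Hom_comp[OF R R R]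
  show "0\<^sub>m (fst R) (fst R) \<in> negligible H R"
    using S(2) HomD(2,3)[of _ R R] lin_form_zero[OF Hom_mat_subspace[OF R R] action_trace_lin_form[OF R]]
    by (auto simp: negligible_def)
  fix f assume f: "f \<in> negligible H R"
  then have fE: "f \<in> intertwiners R R" and f0: "\<And>g. g \<in> intertwiners R R \<Longrightarrow> action_trace H R (g * f) = 0"
    by (auto simp: negligible_def)
  note df = HomD(2,3)[OF fE]
  show "f \<in> carrier_mat (fst R) (fst R)" by (rule S(1)[OF fE])
  show "c \<cdot>\<^sub>m f \<in> negligible H R" for c
    using S(4)[OF fE] f0 lin(2)[OF comp[OF fE]] df HomD(2,3)[of _ R R]
    by (auto simp: negligible_def mat_mult_smult)
  fix g assume g: "g \<in> negligible H R"
  then have gE: "g \<in> intertwiners R R" and g0: "\<And>h. h \<in> intertwiners R R \<Longrightarrow> action_trace H R (h * g) = 0"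
    by (auto simp: negligible_def)
  show "f + g \<in> negligible H R"
    using S(3)[OF fE gE] f0 g0 lin(1)[OF comp[OF fE] comp[OF gE]] df HomD(2,3)[OF gE] HomD(2,3)[of _ R R]
    by (auto simp: negligible_def mat_mult_add)
qed

end

section \<open>Powers of a module\<close>

text \<open>
  A presentation of \<open>T\<close> as the direct sum of \<open>n\<close> copies of \<open>X\<close>, in terms of morphisms only, so that
  it is preserved by additive functors.
\<close>

definition biprod :: "nat \<Rightarrow> ('k::field, 'a) rep \<Rightarrow> ('k, 'a) rep \<Rightarrow>
    (nat \<Rightarrow> 'k mat) \<Rightarrow> (nat \<Rightarrow> 'k mat) \<Rightarrow> bool" where
  "biprod n X T \<iota> \<pi> \<longleftrightarrow> (\<forall>j<n. \<iota> j \<in> intertwiners X T \<and> \<pi> j \<in> intertwiners T X) \<and>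
     (\<forall>j<n. \<forall>k<n. \<pi> j * \<iota> k = (if j = k then 1\<^sub>m (fst X) else 0\<^sub>m (fst X) (fst X))) \<and>
     mat_sum (fst T) (fst T) (\<lambda>j. \<iota> j * \<pi> j) {..<n} = 1\<^sub>m (fst T)"

locale module_power = fd_hopf_algebra H for H :: "('k::field, 'a::ring_1) hopf" +
  fixes n X T \<iota> \<pi>
  assumes X: "is_rep H X" and T: "is_rep H T" and biprod: "biprod n X T \<iota> \<pi>"
begin

lemma \<iota>: "j < n \<Longrightarrow> \<iota> j \<in> intertwiners X T" and \<pi>: "j < n \<Longrightarrow> \<pi> j \<in> intertwiners T X"
  and \<pi>_\<iota>: "j < n \<Longrightarrow> k < n \<Longrightarrow> \<pi> j * \<iota> k = (if j = k then 1\<^sub>m (fst X) else 0\<^sub>m (fst X) (fst X))"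
  and sum_\<iota>_\<pi>: "mat_sum (fst T) (fst T) (\<lambda>j. \<iota> j * \<pi> j) {..<n} = 1\<^sub>m (fst T)"
  using biprod by (auto simp: biprod_def)

lemma dims [simp]: "j < n \<Longrightarrow> dim_row (\<iota> j) = fst T" "j < n \<Longrightarrow> dim_col (\<iota> j) = fst X"
  "j < n \<Longrightarrow> dim_row (\<pi> j) = fst X" "j < n \<Longrightarrow> dim_col (\<pi> j) = fst T"
  using HomD(2,3)[OF \<iota>] HomD(2,3)[OF \<pi>] by auto

lemma carriers [simp]: "j < n \<Longrightarrow> \<iota> j \<in> carrier_mat (fst T) (fst X)" "j < n \<Longrightarrow> \<pi> j \<in> carrier_mat (fst X) (fst T)"
  by (auto intro: carrier_matI)

lemma sum_cut_left:
  assumes "dim_row v = fst T"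
  shows "mat_sum (fst T) (dim_col v) (\<lambda>j. \<iota> j * (\<pi> j * v)) {..<n} = v"
proof -
  have "mat_sum (fst T) (dim_col v) (\<lambda>j. \<iota> j * (\<pi> j * v)) {..<n}
      = mat_sum (fst T) (dim_col v) (\<lambda>j. (\<iota> j * \<pi> j) * v) {..<n}"
    using assms by (intro mat_sum_cong) (simp add: mat_assoc)
  also have "\<dots> = mat_sum (fst T) (fst T) (\<lambda>j. \<iota> j * \<pi> j) {..<n} * v"
    using assms by (intro mat_sum_mult[symmetric]) (auto intro!: carrier_matI)
  finally show ?thesis using assms by (simp add: sum_\<iota>_\<pi>)
qed

lemma sum_cut_right:
  assumes "dim_col v = fst T"
  shows "mat_sum (dim_row v) (fst T) (\<lambda>j. v * \<iota> j * \<pi> j) {..<n} = v"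
proof -
  have "mat_sum (dim_row v) (fst T) (\<lambda>j. v * \<iota> j * \<pi> j) {..<n}
      = mat_sum (dim_row v) (fst T) (\<lambda>j. v * (\<iota> j * \<pi> j)) {..<n}"
    using assms by (intro mat_sum_cong) (simp add: mat_assoc)
  also have "\<dots> = v * mat_sum (fst T) (fst T) (\<lambda>j. \<iota> j * \<pi> j) {..<n}"
    using assms by (intro mult_mat_sum[symmetric]) (auto intro!: carrier_matI)
  finally show ?thesis using assms by (simp add: sum_\<iota>_\<pi>)
qed

lemma frame_columns:
  "frame m 1 (carrier_mat m 1) {..<m} (\<lambda>i. mat m 1 (\<lambda>(r, s). if r = i then 1 else 0))
     (\<lambda>i (x :: 'k mat). x $$ (i, 0))"
  unfolding frame_def
proof (intro conjI ballI)
  fix x :: "'k mat" assume x: "x \<in> carrier_mat m 1"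
  show "x = mat_sum m 1 (\<lambda>i. x $$ (i, 0) \<cdot>\<^sub>m mat m 1 (\<lambda>(r, s). if r = i then 1 else 0)) {..<m}"
    using x by (intro eq_matI) (auto simp: if_distrib cong: if_cong)
qed (auto simp: mat_subspace_def lin_form_def)

text \<open>
  Column vectors of \<open>T\<close> are tuples of \<open>n\<close> column vectors of \<open>X\<close>.
\<close>

lemma dim_power: "fst T = n * fst X"
proof -
  interpret P: power_decomposition "fst T" 1 "carrier_mat (fst T) 1" "fst X" 1 "carrier_mat (fst X) 1"
    "{..<n}" "\<lambda>k v. \<pi> k * v" "\<lambda>k v. \<iota> k * v"
  proof
    show "lin_map (carrier_mat (fst T) 1) (carrier_mat (fst X) 1) (\<lambda>v. \<pi> k * v)" if "k \<in> {..<n}" for k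
      using that by (auto simp: lin_map_def mat_mult_add mat_mult_smult intro!: carrier_matI)
    show "lin_map (carrier_mat (fst X) 1) (carrier_mat (fst T) 1) (\<lambda>v. \<iota> k * v)" if "k \<in> {..<n}" for k
      using that by (auto simp: lin_map_def mat_mult_add mat_mult_smult intro!: carrier_matI)
    show "\<pi> k * (\<iota> l * x) = (if k = l then x else 0\<^sub>m (fst X) 1)"
      if "k \<in> {..<n}" "l \<in> {..<n}" "x \<in> carrier_mat (fst X) 1" for k l x
    proof -
      have "\<pi> k * (\<iota> l * x) = (\<pi> k * \<iota> l) * x" using that by (intro mat_assoc[symmetric]) auto
      then show ?thesis using that by (simp add: \<pi>_\<iota>)
    qed
    show "mat_sum (fst T) 1 (\<lambda>k. \<iota> k * (\<pi> k * x)) {..<n} = x" if "x \<in> carrier_mat (fst T) 1" for x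
      using sum_cut_left[of x] that by auto
  qed (auto simp: mat_subspace_def)
  show ?thesis
    using P.mat_dim_power mat_dim_frame[OF frame_columns[of "fst T"]] mat_dim_frame[OF frame_columns[of "fst X"]]
    by simp
qed

text \<open>
  Endomorphisms of \<open>T\<close> are \<open>n \<times> n\<close> matrices with entries \<open>\<pi> k * x * \<iota> l\<close> in \<open>End X\<close>; the lemma
  treats a subspace cut out by conditions on the individual entries.
\<close>

lemma endo_power:
  assumes S: "mat_subspace (fst T) (fst T) S" and S0: "mat_subspace (fst X) (fst X) S0"
    and P: "\<And>k l x. k < n \<Longrightarrow> l < n \<Longrightarrow> x \<in> S \<Longrightarrow> \<pi> k * (x * \<iota> l) \<in> S0"
    and E: "\<And>k l x. k < n \<Longrightarrow> l < n \<Longrightarrow> x \<in> S0 \<Longrightarrow> \<iota> k * (x * \<pi> l) \<in> S"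
  shows "mat_dim (fst T) (fst T) S = n\<^sup>2 * mat_dim (fst X) (fst X) S0"
proof -
  note dS = carrier_matD[OF mat_subspaceD(1)[OF S]] and dS0 = carrier_matD[OF mat_subspaceD(1)[OF S0]]
  interpret P: power_decomposition "fst T" "fst T" S "fst X" "fst X" S0 "{..<n} \<times> {..<n}"
    "\<lambda>(k, l) x. \<pi> k * (x * \<iota> l)" "\<lambda>(k, l) x. \<iota> k * (x * \<pi> l)"
  proof
    show "lin_map S S0 (case p of (k, l) \<Rightarrow> \<lambda>x. \<pi> k * (x * \<iota> l))" if "p \<in> {..<n} \<times> {..<n}" for p
      using that P dS by (auto simp: lin_map_def mat_mult_add mat_add_mult mat_mult_smult mat_smult_mult)
    show "lin_map S0 S (case p of (k, l) \<Rightarrow> \<lambda>x. \<iota> k * (x * \<pi> l))" if "p \<in> {..<n} \<times> {..<n}" for p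
      using that E dS0 by (auto simp: lin_map_def mat_mult_add mat_add_mult mat_mult_smult mat_smult_mult)
    show "(case p of (k, l) \<Rightarrow> \<lambda>x. \<pi> k * (x * \<iota> l)) ((case q of (k, l) \<Rightarrow> \<lambda>x. \<iota> k * (x * \<pi> l)) x) =
        (if p = q then x else 0\<^sub>m (fst X) (fst X))"
      if mem: "p \<in> {..<n} \<times> {..<n}" "q \<in> {..<n} \<times> {..<n}" and x: "x \<in> S0" for p q x
    proof -
      obtain k l k' l' where pq: "p = (k, l)" "q = (k', l')" "k < n" "l < n" "k' < n" "l' < n"
        using mem by (cases p; cases q) auto
      have "\<pi> k * ((\<iota> k' * (x * \<pi> l')) * \<iota> l) = (\<pi> k * \<iota> k') * (x * (\<pi> l' * \<iota> l))"
        using pq dS0[OF x] by (simp add: mat_assoc)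
      also have "\<dots> = (if p = q then x else 0\<^sub>m (fst X) (fst X))"
        using pq dS0[OF x] by (auto simp: \<pi>_\<iota>)
      finally show ?thesis using pq by simp
    qed
    show "mat_sum (fst T) (fst T) (\<lambda>p. (case p of (k, l) \<Rightarrow> \<lambda>x. \<iota> k * (x * \<pi> l))
        ((case p of (k, l) \<Rightarrow> \<lambda>x. \<pi> k * (x * \<iota> l)) x)) ({..<n} \<times> {..<n}) = x" if x: "x \<in> S" for x
    proof -
      have "x = mat_sum (fst T) (fst T) (\<lambda>k. \<iota> k * (\<pi> k * x)) {..<n}"
        using sum_cut_left[of x] dS[OF x] by simp
      also have "\<dots> = mat_sum (fst T) (fst T) (\<lambda>k. mat_sum (fst T) (fst T) (\<lambda>l. \<iota> k * (\<pi> k * x) * \<iota> l * \<pi> l) {..<n}) {..<n}"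
      proof (rule mat_sum_cong)
        fix k assume "k \<in> {..<n}"
        then show "\<iota> k * (\<pi> k * x) = mat_sum (fst T) (fst T) (\<lambda>l. \<iota> k * (\<pi> k * x) * \<iota> l * \<pi> l) {..<n}"
          using sum_cut_right[of "\<iota> k * (\<pi> k * x)"] dS[OF x] by simp
      qed
      also have "\<dots> = mat_sum (fst T) (fst T) (\<lambda>(k, l). \<iota> k * (\<pi> k * x) * \<iota> l * \<pi> l) ({..<n} \<times> {..<n})"
        by (intro eq_matI) (auto simp: sum.cartesian_product intro!: sum.cong)
      also have "\<dots> = mat_sum (fst T) (fst T) (\<lambda>p. (case p of (k, l) \<Rightarrow> \<lambda>x. \<iota> k * (x * \<pi> l))
        ((case p of (k, l) \<Rightarrow> \<lambda>x. \<pi> k * (x * \<iota> l)) x)) ({..<n} \<times> {..<n})"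
        using dS[OF x] by (intro mat_sum_cong) (auto simp: mat_assoc)
      finally show ?thesis by simp
    qed
  qed (use S S0 in auto)
  show ?thesis using P.mat_dim_power by (simp add: power2_eq_square)
qed

lemma cut_Hom:
  assumes "k < n" "l < n"
  shows "x \<in> intertwiners T T \<Longrightarrow> \<pi> k * (x * \<iota> l) \<in> intertwiners X X"
    "x \<in> intertwiners X X \<Longrightarrow> \<iota> k * (x * \<pi> l) \<in> intertwiners T T"
  using Hom_comp[OF X T X Hom_comp[OF X T T \<iota>[OF assms(2)]] \<pi>[OF assms(1)]]
    Hom_comp[OF T X T Hom_comp[OF T X X \<pi>[OF assms(2)]] \<iota>[OF assms(1)]] by auto

lemma mat_dim_End_power: "mat_dim (fst T) (fst T) (intertwiners T T) = n\<^sup>2 * mat_dim (fst X) (fst X) (intertwiners X X)"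
  using cut_Hom by (intro endo_power Hom_mat_subspace[OF T T] Hom_mat_subspace[OF X X])

lemma actions_cut:
  assumes n: "0 < n" and k: "k < n" and s: "s \<in> actions H X"
    and v: "dim_row v = fst T" "dim_col v = fst X"
  shows "\<pi> 0 * (mat_sum (fst T) (fst T * fst T) (\<lambda>j. \<iota> j * (s * kronecker (\<pi> k) (\<pi> j))) {..<n}
      * kronecker v (\<iota> 0)) = s * kronecker (\<pi> k * v) (1\<^sub>m (fst X))"
proof -
  note ds = actionsD[OF s]
  let ?w = "s * kronecker (\<pi> k * v) (1\<^sub>m (fst X))"
  have "mat_sum (fst T) (fst T * fst T) (\<lambda>j. \<iota> j * (s * kronecker (\<pi> k) (\<pi> j))) {..<n} * kronecker v (\<iota> 0)
      = mat_sum (fst T) (fst X * fst X) (\<lambda>j. \<iota> j * (s * kronecker (\<pi> k) (\<pi> j)) * kronecker v (\<iota> 0)) {..<n}"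
    using n k ds v by (intro mat_sum_mult) (auto intro!: carrier_matI)
  also have "\<dots> = mat_sum (fst T) (fst X * fst X) (\<lambda>j. if j = 0 then \<iota> 0 * ?w else 0\<^sub>m (fst T) (fst X * fst X)) {..<n}"
    using n k ds v by (intro mat_sum_cong) (auto simp: mat_assoc kronecker_mult \<pi>_\<iota>)
  also have "\<dots> = \<iota> 0 * ?w"
    using n k ds v by (intro mat_sum_single) (auto intro!: carrier_matI)
  also have "\<pi> 0 * (\<iota> 0 * ?w) = (\<pi> 0 * \<iota> 0) * ?w"
    using n k ds v by (simp add: mat_assoc)
  finally show ?thesis using n k ds v by (simp add: \<pi>_\<iota>)
qed

text \<open>
  Cutting \<open>t : T \<otimes> T \<rightarrow> T\<close> into its components between copies of \<open>X\<close> gives \<open>n\<^sup>3\<close> maps, but \<open>t\<close> commutes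
  with the endomorphisms \<open>\<iota> j * \<pi> l\<close> in the second factor.  Hence it is diagonal in the second factor
  and the target, with equal diagonal entries, and the components \<open>\<pi> 0 * t * (\<iota> k \<otimes> \<iota> 0)\<close>
  determine it: \<open>actions H T\<close> consists of \<open>n\<close> copies of \<open>actions H X\<close>.
\<close>

lemma actions_power:
  assumes n: "0 < n"
  shows "power_decomposition (fst T) (fst T * fst T) (actions H T) (fst X) (fst X * fst X) (actions H X) {..<n}
    (\<lambda>k t. \<pi> 0 * (t * kronecker (\<iota> k) (\<iota> 0)))
    (\<lambda>k s. mat_sum (fst T) (fst T * fst T) (\<lambda>j. \<iota> j * (s * kronecker (\<pi> k) (\<pi> j))) {..<n})"
proof
  note TT = rep_tensor_is_rep[OF T T] and XX = rep_tensor_is_rep[OF X X]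
  show ST: "mat_subspace (fst T) (fst T * fst T) (actions H T)" by (rule actions_mat_subspace[OF T])
  show SX: "mat_subspace (fst X) (fst X * fst X) (actions H X)" by (rule actions_mat_subspace[OF X])
  show "lin_map (actions H T) (actions H X) (\<lambda>t. \<pi> 0 * (t * kronecker (\<iota> k) (\<iota> 0)))" if "k \<in> {..<n}" for k
  proof -
    have k: "k < n" using that by simp
    have "\<pi> 0 * (t * kronecker (\<iota> k) (\<iota> 0)) \<in> actions H X" if t: "t \<in> actions H T" for t
    proof -
      note dt = actionsD[OF t]
      have "\<pi> 0 * (t * kronecker (\<iota> k) (\<iota> 0)) * kronecker (1\<^sub>m (fst X)) g
          = g * (\<pi> 0 * (t * kronecker (\<iota> k) (\<iota> 0)))" if g: "g \<in> intertwiners X X" for g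
      proof -
        note dg = HomD(2,3)[OF g]
        \<comment> \<open>\<open>\<iota> 0 * g\<close> factors through the endomorphism \<open>\<iota> 0 * g * \<pi> 0\<close> of \<open>T\<close>, with which \<open>t\<close> commutes\<close>
        let ?h = "\<iota> 0 * (g * \<pi> 0)"
        have h: "?h * \<iota> 0 = \<iota> 0 * g" using n dg by (simp add: mat_assoc \<pi>_\<iota>)
        have "\<pi> 0 * (t * kronecker (\<iota> k) (\<iota> 0)) * kronecker (1\<^sub>m (fst X)) g
            = \<pi> 0 * (t * kronecker (\<iota> k) (\<iota> 0 * g))"
          using n k dg dt by (simp add: mat_assoc kronecker_mult)
        also have "kronecker (\<iota> k) (\<iota> 0 * g) = kronecker (1\<^sub>m (fst T)) ?h * kronecker (\<iota> k) (\<iota> 0)"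
          unfolding h[symmetric] using n k dg by (subst kronecker_mult) simp_all
        also have "\<pi> 0 * (t * (kronecker (1\<^sub>m (fst T)) ?h * kronecker (\<iota> k) (\<iota> 0)))
            = \<pi> 0 * ((t * kronecker (1\<^sub>m (fst T)) ?h) * kronecker (\<iota> k) (\<iota> 0))"
          using n k dg dt by (subst mat_assoc) simp_all
        also have "\<dots> = (\<pi> 0 * \<iota> 0) * (g * (\<pi> 0 * (t * kronecker (\<iota> k) (\<iota> 0))))"
          unfolding dt(4)[OF cut_Hom(2)[OF n n g]] using n k dg dt(2,3) by (simp add: mat_assoc)
        finally show ?thesis using n k dg dt by (simp add: \<pi>_\<iota>)
      qed
      moreover have "\<pi> 0 * (t * kronecker (\<iota> k) (\<iota> 0)) \<in> intertwiners (rep_tensor H X X) X"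
        by (rule Hom_comp[OF XX T X Hom_comp[OF XX TT T Hom_kronecker[OF X T X T \<iota>[OF k] \<iota>[OF n]] dt(1)] \<pi>[OF n]])
      ultimately show ?thesis by (auto simp: actions_def)
    qed
    then show ?thesis
      using actionsD(2,3)[of _ H T] n k
      by (auto simp: lin_map_def mat_add_mult mat_mult_add mat_smult_mult mat_mult_smult)
  qed
  show "lin_map (actions H X) (actions H T)
      (\<lambda>s. mat_sum (fst T) (fst T * fst T) (\<lambda>j. \<iota> j * (s * kronecker (\<pi> k) (\<pi> j))) {..<n})"
    (is "lin_map _ _ ?E") if "k \<in> {..<n}" for k
  proof -
    have k: "k < n" using that by simp
    have "?E s \<in> actions H T" if s: "s \<in> actions H X" for s
    proof -
      note ds = actionsD[OF s]
      have "?E s * kronecker (1\<^sub>m (fst T)) g = g * ?E s" if g: "g \<in> intertwiners T T" for g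
      proof -
        note dg = HomD(2,3)[OF g]
        let ?t = "fst T" and ?tt = "fst T * fst T"
        let ?m = "\<lambda>j l. \<iota> j * (\<pi> j * (g * (\<iota> l * (s * kronecker (\<pi> k) (\<pi> l)))))"
        have 1: "\<iota> j * (s * kronecker (\<pi> k) (\<pi> j)) * kronecker (1\<^sub>m (fst T)) g
            = mat_sum ?t ?tt (\<lambda>l. ?m j l) {..<n}" if j: "j < n" for j
        proof -
          have "\<iota> j * (s * kronecker (\<pi> k) (\<pi> j)) * kronecker (1\<^sub>m (fst T)) g
              = \<iota> j * (s * kronecker (\<pi> k) (\<pi> j * g))"
            using j k dg ds by (simp add: mat_assoc kronecker_mult)
          also have "\<pi> j * g = mat_sum (fst X) ?t (\<lambda>l. \<pi> j * g * \<iota> l * \<pi> l) {..<n}"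
            using sum_cut_right[of "\<pi> j * g"] j dg by simp
          also have "kronecker (\<pi> k) \<dots> = mat_sum (fst X * fst X) ?tt (\<lambda>l. kronecker (\<pi> k) (\<pi> j * g * \<iota> l * \<pi> l)) {..<n}"
            using k j dg by (subst kronecker_mat_sum_right) (auto intro!: carrier_matI)
          also have "\<iota> j * (s * \<dots>) = \<iota> j * mat_sum (fst X) ?tt (\<lambda>l. s * kronecker (\<pi> k) (\<pi> j * g * \<iota> l * \<pi> l)) {..<n}"
            using k j dg ds by (subst mult_mat_sum) (auto intro!: carrier_matI)
          also have "\<dots> = mat_sum ?t ?tt (\<lambda>l. \<iota> j * (s * kronecker (\<pi> k) (\<pi> j * g * \<iota> l * \<pi> l))) {..<n}"
            using k j dg ds by (intro mult_mat_sum) (auto intro!: carrier_matI)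
          also have "\<dots> = mat_sum ?t ?tt (\<lambda>l. ?m j l) {..<n}"
          proof (rule mat_sum_cong)
            fix l assume "l \<in> {..<n}"
            then have l: "l < n" by simp
            let ?h = "\<pi> j * (g * \<iota> l)"
            have "s * kronecker (\<pi> k) (\<pi> j * g * \<iota> l * \<pi> l)
                = (s * kronecker (1\<^sub>m (fst X)) ?h) * kronecker (\<pi> k) (\<pi> l)"
              using k j l dg ds by (simp add: mat_assoc kronecker_mult)
            then show "\<iota> j * (s * kronecker (\<pi> k) (\<pi> j * g * \<iota> l * \<pi> l)) = ?m j l"
              unfolding ds(4)[OF cut_Hom(1)[OF j l g]] using k j l dg ds(2,3) by (simp add: mat_assoc)
          qed
          finally show ?thesis .
        qed
        have "?E s * kronecker (1\<^sub>m (fst T)) g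
            = mat_sum ?t ?tt (\<lambda>j. \<iota> j * (s * kronecker (\<pi> k) (\<pi> j)) * kronecker (1\<^sub>m (fst T)) g) {..<n}"
          using k dg ds by (intro mat_sum_mult) (auto intro!: carrier_matI)
        also have "\<dots> = mat_sum ?t ?tt (\<lambda>j. mat_sum ?t ?tt (\<lambda>l. ?m j l) {..<n}) {..<n}"
          using 1 by (intro mat_sum_cong) simp
        also have "\<dots> = mat_sum ?t ?tt (\<lambda>l. mat_sum ?t ?tt (\<lambda>j. ?m j l) {..<n}) {..<n}"
          by (intro eq_matI) (auto intro: sum.swap)
        also have "\<dots> = mat_sum ?t ?tt (\<lambda>l. g * (\<iota> l * (s * kronecker (\<pi> k) (\<pi> l)))) {..<n}"
        proof (rule mat_sum_cong)
          fix l assume "l \<in> {..<n}"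
          then show "mat_sum ?t ?tt (\<lambda>j. ?m j l) {..<n} = g * (\<iota> l * (s * kronecker (\<pi> k) (\<pi> l)))"
            using sum_cut_left[of "g * (\<iota> l * (s * kronecker (\<pi> k) (\<pi> l)))"] k dg ds by simp
        qed
        also have "\<dots> = g * ?E s"
          using k dg ds by (intro mult_mat_sum[symmetric]) (auto intro!: carrier_matI)
        finally show ?thesis .
      qed
      moreover have "?E s \<in> intertwiners (rep_tensor H T T) T"
        using mat_subspace_mat_sum[OF Hom_mat_subspace[OF TT T], of "{..<n}", unfolded fst_rep_tensor]
          Hom_comp[OF TT X T Hom_comp[OF TT XX X Hom_kronecker[OF T X T X \<pi>[OF k] \<pi>] ds(1)] \<iota>]
        by simp
      ultimately show ?thesis by (auto simp: actions_def)
    qed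
    moreover have "?E (s + s') = ?E s + ?E s'" "?E (c \<cdot>\<^sub>m s) = c \<cdot>\<^sub>m ?E s"
      if "s \<in> actions H X" "s' \<in> actions H X" for s s' c
      using k actionsD(2,3)[OF that(1)] actionsD(2,3)[OF that(2)]
      by (intro eq_matI; simp add: mat_add_mult mat_mult_add mat_smult_mult mat_mult_smult sum.distrib
          sum_distrib_left del: index_mult_mat(1))+
    ultimately show ?thesis by (auto simp: lin_map_def)
  qed
  show "\<pi> 0 * (mat_sum (fst T) (fst T * fst T) (\<lambda>j. \<iota> j * (s * kronecker (\<pi> l) (\<pi> j))) {..<n} * kronecker (\<iota> k) (\<iota> 0))
      = (if k = l then s else 0\<^sub>m (fst X) (fst X * fst X))"
    if "k \<in> {..<n}" "l \<in> {..<n}" and s: "s \<in> actions H X" for k l s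
    using actions_cut[OF n _ s, of l "\<iota> k"] that actionsD(2,3)[OF s]
    by (auto simp: \<pi>_\<iota> kronecker_one)
  show "mat_sum (fst T) (fst T * fst T) (\<lambda>k. mat_sum (fst T) (fst T * fst T)
      (\<lambda>j. \<iota> j * (\<pi> 0 * (t * kronecker (\<iota> k) (\<iota> 0)) * kronecker (\<pi> k) (\<pi> j))) {..<n}) {..<n} = t"
    if t: "t \<in> actions H T" for t
  proof -
    note dt = actionsD[OF t]
    let ?t = "fst T" and ?tt = "fst T * fst T"
    have "mat_sum ?t ?tt (\<lambda>k. mat_sum ?t ?tt
        (\<lambda>j. \<iota> j * (\<pi> 0 * (t * kronecker (\<iota> k) (\<iota> 0)) * kronecker (\<pi> k) (\<pi> j))) {..<n}) {..<n}
      = mat_sum ?t ?tt (\<lambda>j. mat_sum ?t ?tt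
        (\<lambda>k. \<iota> j * (\<pi> 0 * (t * kronecker (\<iota> k) (\<iota> 0)) * kronecker (\<pi> k) (\<pi> j))) {..<n}) {..<n}"
      by (intro eq_matI) (auto intro: sum.swap)
    also have "\<dots> = mat_sum ?t ?tt (\<lambda>j. \<iota> j * (\<pi> j * t)) {..<n}"
    proof (rule mat_sum_cong)
      fix j assume "j \<in> {..<n}"
      then have j: "j < n" by simp
      let ?h = "\<iota> 0 * \<pi> j"
      have h: "?h \<in> intertwiners T T" by (rule Hom_comp[OF T X T \<pi>[OF j] \<iota>[OF n]])
      have "mat_sum ?t ?tt (\<lambda>k. \<iota> j * (\<pi> 0 * (t * kronecker (\<iota> k) (\<iota> 0)) * kronecker (\<pi> k) (\<pi> j))) {..<n}
          = mat_sum ?t ?tt (\<lambda>k. (\<iota> j * (\<pi> 0 * t)) * kronecker (\<iota> k * \<pi> k) ?h) {..<n}"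
        using n j dt by (intro mat_sum_cong) (simp add: mat_assoc kronecker_mult)
      also have "\<dots> = (\<iota> j * (\<pi> 0 * t)) * mat_sum ?tt ?tt (\<lambda>k. kronecker (\<iota> k * \<pi> k) ?h) {..<n}"
        using n j dt by (intro mult_mat_sum[symmetric]) (auto intro!: carrier_matI)
      also have "mat_sum ?tt ?tt (\<lambda>k. kronecker (\<iota> k * \<pi> k) ?h) {..<n}
          = kronecker (mat_sum ?t ?t (\<lambda>k. \<iota> k * \<pi> k) {..<n}) ?h"
        using n j by (subst kronecker_mat_sum_left) (auto intro!: carrier_matI)
      also have "(\<iota> j * (\<pi> 0 * t)) * \<dots> = \<iota> j * (\<pi> 0 * (t * kronecker (1\<^sub>m ?t) ?h))"
        using n j dt by (simp add: sum_\<iota>_\<pi> mat_assoc)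
      also have "\<dots> = \<iota> j * ((\<pi> 0 * \<iota> 0) * (\<pi> j * t))"
        unfolding dt(4)[OF h] using n j dt(2,3) by (simp add: mat_assoc)
      finally show "mat_sum ?t ?tt (\<lambda>k. \<iota> j * (\<pi> 0 * (t * kronecker (\<iota> k) (\<iota> 0)) * kronecker (\<pi> k) (\<pi> j))) {..<n}
          = \<iota> j * (\<pi> j * t)" using n j dt by (simp add: \<pi>_\<iota>)
    qed
    also have "\<dots> = t" using sum_cut_left[of t] dt by simp
    finally show ?thesis .
  qed
qed simp

lemma action_trace_power:
  assumes n: "0 < n" and f: "f \<in> intertwiners T T"
  shows "action_trace H T f = (\<Sum>k<n. action_trace H X (\<pi> k * (f * \<iota> k)))"
proof -
  note df = HomD(2,3)[OF f]
  have "action_trace H T f = (\<Sum>k<n. trace_on (fst X) (fst X * fst X) (actions H X)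
     (\<lambda>s. \<pi> 0 * (mat_sum (fst T) (fst T * fst T) (\<lambda>j. \<iota> j * (s * kronecker (\<pi> k) (\<pi> j))) {..<n}
        * kronecker f (1\<^sub>m (fst T)) * kronecker (\<iota> k) (\<iota> 0))))"
    unfolding action_trace_def by (rule power_decomposition.trace_power[OF actions_power[OF n] actions_precomp[OF T f]])
  also have "\<dots> = (\<Sum>k<n. action_trace H X (\<pi> k * (f * \<iota> k)))"
    unfolding action_trace_def
  proof (intro sum.cong refl trace_on_cong[OF actions_mat_subspace[OF X]])
    fix k s assume "k \<in> {..<n}" and s: "s \<in> actions H X"
    then have k: "k < n" by simp
    have "mat_sum (fst T) (fst T * fst T) (\<lambda>j. \<iota> j * (s * kronecker (\<pi> k) (\<pi> j))) {..<n}
        * kronecker f (1\<^sub>m (fst T)) * kronecker (\<iota> k) (\<iota> 0)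
      = mat_sum (fst T) (fst T * fst T) (\<lambda>j. \<iota> j * (s * kronecker (\<pi> k) (\<pi> j))) {..<n}
        * kronecker (f * \<iota> k) (\<iota> 0)"
      using n k df by (simp add: mat_assoc kronecker_mult)
    then show "\<pi> 0 * (mat_sum (fst T) (fst T * fst T) (\<lambda>j. \<iota> j * (s * kronecker (\<pi> k) (\<pi> j))) {..<n}
        * kronecker f (1\<^sub>m (fst T)) * kronecker (\<iota> k) (\<iota> 0)) = s * kronecker (\<pi> k * (f * \<iota> k)) (1\<^sub>m (fst X))"
      using actions_cut[OF n k s, of "f * \<iota> k"] df k by simp
  qed
  finally show ?thesis .
qed

text \<open>
  Pairing \<open>x\<close> with the elementary endomorphisms \<open>\<iota> l * g * \<pi> k\<close> of \<open>T\<close> isolates the entries of \<open>x\<close>.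
  So \<open>x\<close> is negligible iff all its entries are.
\<close>

lemma mat_dim_negligible_power:
  assumes n: "0 < n"
  shows "mat_dim (fst T) (fst T) (negligible H T) = n\<^sup>2 * mat_dim (fst X) (fst X) (negligible H X)"
proof (rule endo_power[OF negligible_mat_subspace[OF T] negligible_mat_subspace[OF X]])
  fix k l x assume k: "k < n" and l: "l < n"
  have z: "action_trace H X (0\<^sub>m (fst X) (fst X)) = 0"
    by (rule lin_form_zero[OF Hom_mat_subspace[OF X X] action_trace_lin_form[OF X]])
  note comp = Hom_comp[OF X X X] Hom_comp[OF T T T]
  {
    assume x: "x \<in> negligible H T"
    then have xE: "x \<in> intertwiners T T" and x0: "\<And>g. g \<in> intertwiners T T \<Longrightarrow> action_trace H T (g * x) = 0"
      by (auto simp: negligible_def)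
    note dx = HomD(2,3)[OF xE]
    have "action_trace H X (g * (\<pi> k * (x * \<iota> l))) = 0" if g: "g \<in> intertwiners X X" for g
    proof -
      note dg = HomD(2,3)[OF g]
      have G: "\<iota> l * (g * \<pi> k) \<in> intertwiners T T" by (rule cut_Hom(2)[OF l k g])
      have "\<pi> m * ((\<iota> l * (g * \<pi> k) * x) * \<iota> m)
          = (if m = l then g * (\<pi> k * (x * \<iota> l)) else 0\<^sub>m (fst X) (fst X))" if "m < n" for m
      proof -
        have "\<pi> m * ((\<iota> l * (g * \<pi> k) * x) * \<iota> m) = (\<pi> m * \<iota> l) * (g * (\<pi> k * (x * \<iota> m)))"
          using that k l dg dx by (simp add: mat_assoc)
        then show ?thesis using that k l dg dx by (simp add: \<pi>_\<iota>)
      qed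
      then have "action_trace H T (\<iota> l * (g * \<pi> k) * x)
          = (\<Sum>m<n. if m = l then action_trace H X (g * (\<pi> k * (x * \<iota> l))) else 0)"
        unfolding action_trace_power[OF n comp(2)[OF xE G]] by (intro sum.cong) (auto simp: z)
      then show ?thesis using x0[OF G] l by simp
    qed
    then show "\<pi> k * (x * \<iota> l) \<in> negligible H X" using cut_Hom(1)[OF k l xE] by (simp add: negligible_def)
  next
    assume x: "x \<in> negligible H X"
    then have xE: "x \<in> intertwiners X X" and x0: "\<And>g. g \<in> intertwiners X X \<Longrightarrow> action_trace H X (g * x) = 0"
      by (auto simp: negligible_def)
    note dx = HomD(2,3)[OF xE]
    have "action_trace H T (g * (\<iota> k * (x * \<pi> l))) = 0" if g: "g \<in> intertwiners T T" for g
    proof -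
      note dg = HomD(2,3)[OF g]
      have "\<pi> m * ((g * (\<iota> k * (x * \<pi> l))) * \<iota> m)
          = (if m = l then (\<pi> l * (g * \<iota> k)) * x else 0\<^sub>m (fst X) (fst X))" if "m < n" for m
      proof -
        have "\<pi> m * ((g * (\<iota> k * (x * \<pi> l))) * \<iota> m) = (\<pi> m * (g * \<iota> k)) * (x * (\<pi> l * \<iota> m))"
          using that k l dg dx by (simp add: mat_assoc)
        then show ?thesis using that k l dg dx by (auto simp: \<pi>_\<iota>)
      qed
      then have "action_trace H T (g * (\<iota> k * (x * \<pi> l)))
          = (\<Sum>m<n. if m = l then action_trace H X ((\<pi> l * (g * \<iota> k)) * x) else 0)"
        unfolding action_trace_power[OF n comp(2)[OF cut_Hom(2)[OF k l xE] g]] by (intro sum.cong) (auto simp: z)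
      then show ?thesis using x0[OF cut_Hom(1)[OF l k g]] l by simp
    qed
    then show "\<iota> k * (x * \<pi> l) \<in> negligible H T" using cut_Hom(2)[OF k l xE] by (simp add: negligible_def)
  }
qed

end

section \<open>Linear forms on a Hopf algebra and their convolution\<close>

lemma sum_list_product:
  fixes f :: "_ \<Rightarrow> 'r::semiring_0"
  shows "(\<Sum>x\<leftarrow>xs. f x) * (\<Sum>y\<leftarrow>ys. g y) = (\<Sum>x\<leftarrow>xs. \<Sum>y\<leftarrow>ys. f x * g y)"
  by (induction xs) (simp_all add: algebra_simps sum_list_const_mult)

context fd_hopf_algebra
begin

definition basis_set :: "'a set" where
  "basis_set = (SOME B. independent B \<and> span B = UNIV)"

definition hdim :: nat where "hdim = card basis_set"

definition basis :: "nat \<Rightarrow> 'a" where "basis = (SOME e. bij_betw e {..<hdim} basis_set)"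

definition coord :: "nat \<Rightarrow> 'a \<Rightarrow> 'k" where "coord i x = representation basis_set x (basis i)"

lemma basis_set: "independent basis_set" "span basis_set = UNIV" "finite basis_set"
proof -
  obtain B where B: "independent B" "UNIV \<subseteq> span B" using basis_exists[of UNIV] by blast
  then have "independent B \<and> span B = UNIV" by auto
  then have *: "independent basis_set \<and> span basis_set = UNIV" unfolding basis_set_def by (rule someI)
  then show "independent basis_set" "span basis_set = UNIV" by auto
  show "finite basis_set" using finite_dim independent_span_bound[of _ basis_set] * by auto
qed

lemma basis: "bij_betw basis {..<hdim} basis_set"
proof -
  have "\<exists>e. bij_betw e {..<hdim} basis_set"
    using ex_bij_betw_nat_finite[OF basis_set(3)] by (simp add: hdim_def atLeast0LessThan)
  then show ?thesis unfolding basis_def by (rule someI_ex)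
qed

lemma basis_mem: "i < hdim \<Longrightarrow> basis i \<in> basis_set" using basis by (auto simp: bij_betw_def)

lemma coord_add [simp]: "coord i (x + y) = coord i x + coord i y"
  using basis_set by (simp add: coord_def representation_add)

lemma coord_scale [simp]: "coord i (scale H c x) = c * coord i x"
  using basis_set by (simp add: coord_def representation_scale)

lemma coord_basis: "i < hdim \<Longrightarrow> j < hdim \<Longrightarrow> coord i (basis j) = (if i = j then 1 else 0)"
  using basis basis_set(1) representation_basis[OF basis_set(1) basis_mem]
  by (auto simp: coord_def bij_betw_def inj_on_def)

lemma expand: "x = (\<Sum>i<hdim. scale H (coord i x) (basis i))"
proof -
  have "x = (\<Sum>b\<in>basis_set. scale H (representation basis_set x b) b)"
    using sum_representation_eq[OF basis_set(1) _ basis_set(3) order_refl, of x] basis_set(2) by simp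
  also have "\<dots> = (\<Sum>i<hdim. scale H (coord i x) (basis i))"
    unfolding coord_def by (rule sum.reindex_bij_betw[OF basis, symmetric])
  finally show ?thesis .
qed

lemma hdim_pos: "0 < hdim"
proof (rule ccontr)
  assume "\<not> 0 < hdim"
  then have "(1::'a) = 0" using expand[of 1] by simp
  then show False by simp
qed

lemma endo_trace_coord: "endo_trace f = (\<Sum>i<hdim. coord i (f (basis i)))"
  unfolding endo_trace_def Let_def basis_set_def[symmetric] coord_def
  by (rule sum.reindex_bij_betw[OF basis, symmetric])

definition lform :: "('a \<Rightarrow> 'k) \<Rightarrow> bool" where
  "lform f \<longleftrightarrow> (\<forall>x y. f (x + y) = f x + f y) \<and> (\<forall>c x. f (scale H c x) = c * f x)"

lemma lformI: "(\<And>x y. f (x + y) = f x + f y) \<Longrightarrow> (\<And>c x. f (scale H c x) = c * f x) \<Longrightarrow> lform f"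
  by (auto simp: lform_def)

lemma lform_add: "lform f \<Longrightarrow> f (x + y) = f x + f y" and lform_scale: "lform f \<Longrightarrow> f (scale H c x) = c * f x"
  by (auto simp: lform_def)

lemma lform_zero: "lform f \<Longrightarrow> f 0 = 0" using lform_scale[of f 0 0] by simp

lemma lform_sum: "lform f \<Longrightarrow> f (\<Sum>i\<in>I. g i) = (\<Sum>i\<in>I. f (g i))"
  by (induction I rule: infinite_finite_induct) (auto simp: lform_zero lform_add)

lemma lform_sum_list: "lform f \<Longrightarrow> f (\<Sum>x\<leftarrow>xs. g x) = (\<Sum>x\<leftarrow>xs. f (g x))"
  by (induction xs) (auto simp: lform_zero lform_add)

lemma lform_coord: "lform (coord i)" by (auto simp: lform_def)

text \<open>
  Tensors are only accessible through bilinear forms, so identities between elements of \<open>A\<close> that involve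
  \<open>\<Delta>\<close> are obtained by applying linear forms to both sides.
\<close>

lemma lform_eqI: "(\<And>g. lform g \<Longrightarrow> g x = g y) \<Longrightarrow> x = y"
proof -
  assume "\<And>g. lform g \<Longrightarrow> g x = g y"
  then have "coord i x = coord i y" for i using lform_coord by blast
  then have "(\<Sum>i<hdim. scale H (coord i x) (basis i)) = (\<Sum>i<hdim. scale H (coord i y) (basis i))" by simp
  then show "x = y" using expand by metis
qed

lemma lform_expand: "lform g \<Longrightarrow> g x = (\<Sum>i<hdim. coord i x * g (basis i))"
  by (subst expand[of x]) (simp add: lform_sum lform_scale)

lemma lform_iff_linear: "Vector_Spaces.linear (scale H) (*) f \<longleftrightarrow> lform f"
proof -
  have "vector_space ((*) :: 'k \<Rightarrow> 'k \<Rightarrow> 'k)" by unfold_locales (auto simp: algebra_simps)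
  then show ?thesis using vector_space_axioms by (auto simp: lform_def Vector_Spaces.linear_iff)
qed

lemma antipode_add: "antipode H (x + y) = antipode H x + antipode H y"
  and antipode_scale: "antipode H (scale H c x) = scale H c (antipode H x)"
  using antipode_linear by (auto simp: Vector_Spaces.linear_iff)

lemma lform_mult_left: "lform g \<Longrightarrow> lform (\<lambda>x. g (a * x))"
  and lform_mult_right: "lform g \<Longrightarrow> lform (\<lambda>x. g (x * a))"
  and lform_antipode: "lform g \<Longrightarrow> lform (\<lambda>x. g (antipode H x))"
  by (auto simp: lform_def algebra_simps mult_scale_left mult_scale_right antipode_add antipode_scale)

lemma lform_const_mult: "lform g \<Longrightarrow> lform (\<lambda>x. c * g x)" "lform g \<Longrightarrow> lform (\<lambda>x. g x * c)"
  by (auto simp: lform_def algebra_simps)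

lemma comult_form:
  assumes "\<And>y. lform (\<lambda>x. \<beta> x y)" "\<And>x. lform (\<beta> x)"
  shows "tensor2_eq (scale H) t u \<Longrightarrow> (\<Sum>(x, y)\<leftarrow>t. \<beta> x y) = (\<Sum>(x, y)\<leftarrow>u. \<beta> x y)"
  using assms by (simp add: tensor2_eq_def bilinear_form_def lform_iff_linear)

lemma comult_form_add:
  assumes "\<And>y. lform (\<lambda>x. \<beta> x y)" "\<And>x. lform (\<beta> x)"
  shows "(\<Sum>(x, y)\<leftarrow>comult H (a + b). \<beta> x y) = (\<Sum>(x, y)\<leftarrow>comult H a. \<beta> x y) + (\<Sum>(x, y)\<leftarrow>comult H b. \<beta> x y)"
  using comult_form[OF assms comult_add] by simp

lemma comult_form_scale:
  assumes "\<And>y. lform (\<lambda>x. \<beta> x y)" "\<And>x. lform (\<beta> x)"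
  shows "(\<Sum>(x, y)\<leftarrow>comult H (scale H c a). \<beta> x y) = c * (\<Sum>(x, y)\<leftarrow>comult H a. \<beta> x y)"
  using comult_form[OF assms comult_scale]
  by (simp add: o_def split_def lform_scale[OF assms(1)] sum_list_const_mult)

lemma comult_form_mult:
  assumes "\<And>y. lform (\<lambda>x. \<beta> x y)" "\<And>x. lform (\<beta> x)"
  shows "(\<Sum>(x, y)\<leftarrow>comult H (a * b). \<beta> x y)
    = (\<Sum>(x, y)\<leftarrow>comult H a. \<Sum>(x', y')\<leftarrow>comult H b. \<beta> (x * x') (y * y'))"
  using comult_form[OF assms comult_mult] by (simp add: o_def split_def sum_list_concat_map)

lemma comult_form_coassoc:
  assumes "\<And>y z. lform (\<lambda>x. \<tau> x y z)" "\<And>x z. lform (\<lambda>y. \<tau> x y z)" "\<And>x y. lform (\<tau> x y)"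
  shows "(\<Sum>(x, y)\<leftarrow>comult H a. \<Sum>(u, v)\<leftarrow>comult H x. \<tau> u v y)
    = (\<Sum>(x, y)\<leftarrow>comult H a. \<Sum>(u, v)\<leftarrow>comult H y. \<tau> x u v)"
  using coassoc[of a] assms
  by (simp add: tensor3_eq_def trilinear_form_def lform_iff_linear o_def split_def sum_list_concat_map)

lemma comult_form_counit_left: "lform g \<Longrightarrow> (\<Sum>(x, y)\<leftarrow>comult H a. counit H x * g y) = g a"
  by (subst (2) counit_left[of a, symmetric]) (simp add: lform_sum_list lform_scale split_def)

lemma comult_form_counit_right: "lform g \<Longrightarrow> (\<Sum>(x, y)\<leftarrow>comult H a. g x * counit H y) = g a"
  by (subst (2) counit_right[of a, symmetric]) (simp add: lform_sum_list lform_scale split_def mult.commute)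

text \<open>
  The product of the dual algebra \<open>A\<^sup>*\<close>.
\<close>

definition conv :: "('a \<Rightarrow> 'k) \<Rightarrow> ('a \<Rightarrow> 'k) \<Rightarrow> 'a \<Rightarrow> 'k" where
  "conv f g a = (\<Sum>(x, y)\<leftarrow>comult H a. f x * g y)"

lemma lform_conv:
  assumes "lform f" "lform g" shows "lform (conv f g)"
proof -
  note b = lform_const_mult(2)[OF assms(1)] lform_const_mult(1)[OF assms(2)]
  show ?thesis
    unfolding conv_def lform_def using comult_form_add[OF b] comult_form_scale[OF b] by blast
qed

lemma conv_assoc:
  assumes "lform f" "lform g" "lform h" shows "conv (conv f g) h a = conv f (conv g h) a"
proof -
  have "conv (conv f g) h a = (\<Sum>(x, y)\<leftarrow>comult H a. \<Sum>(u, v)\<leftarrow>comult H x. f u * g v * h y)"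
    by (simp add: conv_def sum_list_mult_const[symmetric] split_def)
  also have "\<dots> = (\<Sum>(x, y)\<leftarrow>comult H a. \<Sum>(u, v)\<leftarrow>comult H y. f x * g u * h v)"
    by (rule comult_form_coassoc) (use assms in \<open>auto simp: lform_def algebra_simps\<close>)
  also have "\<dots> = conv f (conv g h) a"
    by (simp add: conv_def sum_list_const_mult[symmetric] split_def mult.assoc)
  finally show ?thesis .
qed

lemma conv_sum_right: "(\<Sum>j\<in>I. conv f (g j) a) = conv f (\<lambda>x. \<Sum>j\<in>I. g j x) a"
  unfolding conv_def sum_list_sum_nth split_def by (simp add: sum_distrib_left) (rule sum.swap)

lemma conv_sum_left: "(\<Sum>j\<in>I. conv (f j) g a) = conv (\<lambda>x. \<Sum>j\<in>I. f j x) g a"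
  unfolding conv_def sum_list_sum_nth split_def by (simp add: sum_distrib_right) (rule sum.swap)

text \<open>
  The two actions of \<open>A\<^sup>*\<close> on \<open>A\<close>: \<open>right_hit f a = f(a\<^sub>2) a\<^sub>1\<close> and \<open>left_hit f a = f(a\<^sub>1) a\<^sub>2\<close>.
\<close>

definition right_hit :: "('a \<Rightarrow> 'k) \<Rightarrow> 'a \<Rightarrow> 'a" where "right_hit f a = (\<Sum>(x, y)\<leftarrow>comult H a. scale H (f y) x)"
definition left_hit :: "('a \<Rightarrow> 'k) \<Rightarrow> 'a \<Rightarrow> 'a" where "left_hit f a = (\<Sum>(x, y)\<leftarrow>comult H a. scale H (f x) y)"

lemma lform_right_hit: "lform g \<Longrightarrow> g (right_hit f a) = conv g f a"
  and lform_left_hit: "lform g \<Longrightarrow> g (left_hit f a) = conv f g a"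
  by (simp_all add: right_hit_def left_hit_def conv_def lform_sum_list lform_scale split_def mult.commute)

lemma lform_right_hit_comp: "lform g \<Longrightarrow> lform f \<Longrightarrow> lform (\<lambda>a. g (right_hit f a))"
  and lform_left_hit_comp: "lform g \<Longrightarrow> lform f \<Longrightarrow> lform (\<lambda>a. g (left_hit f a))"
  by (simp_all add: lform_right_hit lform_left_hit lform_conv)

section \<open>Matrix coefficients of a module\<close>

definition coef :: "('k, 'a) rep \<Rightarrow> nat \<Rightarrow> nat \<Rightarrow> 'a \<Rightarrow> 'k" where "coef V i j a = snd V a $$ (i, j)"
definition coefS :: "('k, 'a) rep \<Rightarrow> nat \<Rightarrow> nat \<Rightarrow> 'a \<Rightarrow> 'k" where "coefS V i j a = coef V i j (antipode H a)"

context
  fixes V assumes V: "is_rep H V"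
begin

lemma lform_coef: "i < fst V \<Longrightarrow> j < fst V \<Longrightarrow> lform (coef V i j)"
  by (auto simp: lform_def coef_def repD[OF V])

lemma lform_coefS: "i < fst V \<Longrightarrow> j < fst V \<Longrightarrow> lform (coefS V i j)"
  unfolding coefS_def by (intro lform_antipode lform_coef)

lemma coef_mult:
  "i < fst V \<Longrightarrow> k < fst V \<Longrightarrow> coef V i k (a * b) = (\<Sum>j<fst V. coef V i j a * coef V j k b)"
  by (simp add: coef_def repD(7)[OF V] mult_index[OF repD(1)[OF V] repD(1)[OF V]] del: index_mult_mat)

lemma coef_scalar:
  "i < fst V \<Longrightarrow> j < fst V \<Longrightarrow> coef V i j (scale H c 1) = (if i = j then c else 0)"
  by (auto simp: coef_def repD[OF V])

text \<open>
  The matrices \<open>coef V\<close> and \<open>coefS V\<close> over the algebra \<open>A\<^sup>*\<close> are inverse to each other, because the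
  antipode is the convolution inverse of the identity.
\<close>

lemma conv_coef_coefS:
  assumes "i < fst V" "k < fst V"
  shows "(\<Sum>j<fst V. conv (coef V i j) (coefS V j k) a) = (if i = k then counit H a else 0)"
proof -
  have "(\<Sum>j<fst V. conv (coef V i j) (coefS V j k) a) = (\<Sum>(x, y)\<leftarrow>comult H a. coef V i k (x * antipode H y))"
    unfolding conv_def sum_list_sum_nth split_def coef_mult[OF assms] coefS_def
    by (simp add: sum.swap[of _ "{..<fst V}"])
  also have "\<dots> = coef V i k (\<Sum>(x, y)\<leftarrow>comult H a. x * antipode H y)"
    by (simp add: lform_sum_list[OF lform_coef[OF assms]] split_def)
  finally show ?thesis using assms by (simp add: antipode_right coef_scalar)
qed

lemma conv_coefS_coef:
  assumes "i < fst V" "k < fst V"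
  shows "(\<Sum>j<fst V. conv (coefS V i j) (coef V j k) a) = (if i = k then counit H a else 0)"
proof -
  have "(\<Sum>j<fst V. conv (coefS V i j) (coef V j k) a) = (\<Sum>(x, y)\<leftarrow>comult H a. coef V i k (antipode H x * y))"
    unfolding conv_def sum_list_sum_nth split_def coef_mult[OF assms] coefS_def
    by (simp add: sum.swap[of _ "{..<fst V}"])
  also have "\<dots> = coef V i k (\<Sum>(x, y)\<leftarrow>comult H a. antipode H x * y)"
    by (simp add: lform_sum_list[OF lform_coef[OF assms]] split_def)
  finally show ?thesis using assms by (simp add: antipode_left coef_scalar)
qed

lemma conv_delta:
  assumes "lform g"
  shows "conv g (\<lambda>x. if i = k then counit H x else 0) a = (if i = k then g a else 0)"
    "conv (\<lambda>x. if i = k then counit H x else 0) g a = (if i = k then g a else 0)"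
  using comult_form_counit_right[OF assms] comult_form_counit_left[OF assms] by (auto simp: conv_def split_def)

text \<open>
  Inverse matrices over \<open>A\<^sup>*\<close> act as inverse matrices of operators on \<open>A\<close>, in the order of the factors
  for \<open>right_hit\<close> and in the opposite order for \<open>left_hit\<close>.  Applying a linear form \<open>g\<close> turns these
  operators into convolution with \<open>g\<close>.
\<close>

lemma right_hit_right_hit_inverse:
  assumes g: "lform g" and u: "\<And>j. j < n \<Longrightarrow> lform (u j)" and v: "\<And>j. j < n \<Longrightarrow> lform (v j)"
    and inv: "\<And>a. (\<Sum>j<n. conv (u j) (v j) a) = (if i = k then counit H a else 0)"
  shows "(\<Sum>j<n. g (right_hit (u j) (right_hit (v j) a))) = (if i = k then g a else 0)"
proof -
  have "(\<Sum>j<n. g (right_hit (u j) (right_hit (v j) a))) = (\<Sum>j<n. conv g (conv (u j) (v j)) a)"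
    using g u v by (intro sum.cong refl) (simp add: lform_right_hit lform_conv conv_assoc)
  also have "\<dots> = conv g (\<lambda>x. if i = k then counit H x else 0) a" unfolding conv_sum_right inv ..
  finally show ?thesis by (simp only: conv_delta[OF g])
qed

lemma left_hit_left_hit_inverse:
  assumes g: "lform g" and u: "\<And>j. j < n \<Longrightarrow> lform (u j)" and v: "\<And>j. j < n \<Longrightarrow> lform (v j)"
    and inv: "\<And>a. (\<Sum>j<n. conv (u j) (v j) a) = (if i = k then counit H a else 0)"
  shows "(\<Sum>j<n. g (left_hit (v j) (left_hit (u j) a))) = (if i = k then g a else 0)"
proof -
  have "(\<Sum>j<n. g (left_hit (v j) (left_hit (u j) a))) = (\<Sum>j<n. conv (conv (u j) (v j)) g a)"
    using g u v by (intro sum.cong refl) (simp add: lform_left_hit lform_conv conv_assoc)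
  also have "\<dots> = conv (\<lambda>x. if i = k then counit H x else 0) g a" unfolding conv_sum_left inv ..
  finally show ?thesis by (simp only: conv_delta[OF g])
qed

lemmas coef_inverse =
  right_hit_right_hit_inverse[OF _ lform_coefS lform_coef conv_coefS_coef]
  right_hit_right_hit_inverse[OF _ lform_coef lform_coefS conv_coef_coefS]
  left_hit_left_hit_inverse[OF _ lform_coef lform_coefS conv_coef_coefS]
  left_hit_left_hit_inverse[OF _ lform_coefS lform_coef conv_coefS_coef]

lemma right_hit_coef_mult:
  assumes ik: "i < fst V" "k < fst V"
  shows "right_hit (coef V i k) (a * b) = (\<Sum>j<fst V. right_hit (coef V i j) a * right_hit (coef V j k) b)"
proof (rule lform_eqI)
  fix g assume g: "lform g"
  have "g (right_hit (coef V i k) (a * b))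
      = (\<Sum>(x, y)\<leftarrow>comult H a. \<Sum>(x', y')\<leftarrow>comult H b. g (x * x') * coef V i k (y * y'))"
    unfolding lform_right_hit[OF g] conv_def
    by (rule comult_form_mult) (use g lform_coef[OF ik] in \<open>auto intro: lform_const_mult\<close>)
  also have "\<dots> = (\<Sum>j<fst V. \<Sum>(x, y)\<leftarrow>comult H a. \<Sum>(x', y')\<leftarrow>comult H b. 
      g (x * x') * (coef V i j y * coef V j k y'))"
    unfolding coef_mult[OF ik] sum_list_sum_nth split_def
    by (simp add: sum_distrib_left sum.swap[of _ "{..<fst V}"])
  also have "\<dots> = (\<Sum>j<fst V. g (right_hit (coef V i j) a * right_hit (coef V j k) b))"
    by (simp only: right_hit_def sum_list_product lform_sum_list[OF g] split_def)
      (simp add: lform_scale[OF g] mult_scale_left mult_scale_right mult.assoc mult.left_commute mult.commute[where 'a = 'k])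
  also have "\<dots> = g (\<Sum>j<fst V. right_hit (coef V i j) a * right_hit (coef V j k) b)"
    by (rule lform_sum[OF g, symmetric])
  finally show "g (right_hit (coef V i k) (a * b)) = g (\<Sum>j<fst V. right_hit (coef V i j) a * right_hit (coef V j k) b)" .
qed

lemma left_hit_coef_mult:
  assumes ik: "i < fst V" "k < fst V"
  shows "left_hit (coef V i k) (a * b) = (\<Sum>j<fst V. left_hit (coef V i j) a * left_hit (coef V j k) b)"
proof (rule lform_eqI)
  fix g assume g: "lform g"
  have "g (left_hit (coef V i k) (a * b))
      = (\<Sum>(x, y)\<leftarrow>comult H a. \<Sum>(x', y')\<leftarrow>comult H b. coef V i k (x * x') * g (y * y'))"
    unfolding lform_left_hit[OF g] conv_def
    by (rule comult_form_mult) (use g lform_coef[OF ik] in \<open>auto intro: lform_const_mult\<close>)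
  also have "\<dots> = (\<Sum>j<fst V. \<Sum>(x, y)\<leftarrow>comult H a. \<Sum>(x', y')\<leftarrow>comult H b. 
      (coef V i j x * coef V j k x') * g (y * y'))"
    unfolding coef_mult[OF ik] sum_list_sum_nth split_def
    by (simp add: sum_distrib_right sum.swap[of _ "{..<fst V}"])
  also have "\<dots> = (\<Sum>j<fst V. g (left_hit (coef V i j) a * left_hit (coef V j k) b))"
    by (simp only: left_hit_def sum_list_product lform_sum_list[OF g] split_def)
      (simp add: lform_scale[OF g] mult_scale_left mult_scale_right mult.assoc mult.left_commute mult.commute[where 'a = 'k])
  also have "\<dots> = g (\<Sum>j<fst V. left_hit (coef V i j) a * left_hit (coef V j k) b)"
    by (rule lform_sum[OF g, symmetric])
  finally show "g (left_hit (coef V i k) (a * b)) = g (\<Sum>j<fst V. left_hit (coef V i j) a * left_hit (coef V j k) b)" .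
qed

end

text \<open>
  Projections that are inverse to equivariant embeddings are equivariant: insert the decomposition of the
  identity of \<open>T\<close> to the right of the action of \<open>a\<close> on \<open>T\<close> and move \<open>a\<close> through the embeddings.
\<close>

lemma biprod_of_section:
  assumes X: "is_rep H X" and T: "is_rep H T" and \<iota>: "\<And>j. j < n \<Longrightarrow> \<iota> j \<in> intertwiners X T"
    and \<pi>: "\<And>j. j < n \<Longrightarrow> \<pi> j \<in> carrier_mat (fst X) (fst T)"
    and \<pi>_\<iota>: "\<And>j k. j < n \<Longrightarrow> k < n \<Longrightarrow> \<pi> j * \<iota> k = (if j = k then 1\<^sub>m (fst X) else 0\<^sub>m (fst X) (fst X))"
    and sum: "mat_sum (fst T) (fst T) (\<lambda>j. \<iota> j * \<pi> j) {..<n} = 1\<^sub>m (fst T)"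
  shows "biprod n X T \<iota> \<pi>"
proof -
  note hdim\<iota> = HomD(2,3)[OF \<iota>] and hdim\<pi> = carrier_matD[OF \<pi>]
  note dX = repD(2,3)[OF X] and dT = repD(2,3)[OF T]
  have "\<pi> j * snd T a = snd X a * \<pi> j" if j: "j < n" for j a
  proof -
    have "\<pi> j * snd T a = \<pi> j * (snd T a * mat_sum (fst T) (fst T) (\<lambda>l. \<iota> l * \<pi> l) {..<n})"
      by (simp add: sum dT)
    also have "\<dots> = \<pi> j * mat_sum (fst T) (fst T) (\<lambda>l. snd T a * (\<iota> l * \<pi> l)) {..<n}"
      using dT hdim\<iota> hdim\<pi> by (subst mult_mat_sum) (auto intro!: carrier_matI)
    also have "\<dots> = mat_sum (fst X) (fst T) (\<lambda>l. \<pi> j * (snd T a * (\<iota> l * \<pi> l))) {..<n}"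
      using j dT hdim\<iota> hdim\<pi> by (intro mult_mat_sum) (auto intro!: carrier_matI)
    also have "\<dots> = mat_sum (fst X) (fst T) (\<lambda>l. if l = j then snd X a * \<pi> j else 0\<^sub>m (fst X) (fst T)) {..<n}"
    proof (rule mat_sum_cong)
      fix l assume "l \<in> {..<n}"
      then have l: "l < n" by simp
      have "snd T a * (\<iota> l * \<pi> l) = (snd T a * \<iota> l) * \<pi> l" using l dT hdim\<iota> hdim\<pi> by (simp add: mat_assoc)
      also have "\<dots> = \<iota> l * (snd X a * \<pi> l)"
        unfolding HomD(4)[OF \<iota>[OF l], symmetric] using l dX hdim\<iota> hdim\<pi> by (simp add: mat_assoc)
      also have "\<pi> j * \<dots> = (\<pi> j * \<iota> l) * (snd X a * \<pi> l)"
        using j l dX hdim\<iota> hdim\<pi> by (simp add: mat_assoc)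
      finally show "\<pi> j * (snd T a * (\<iota> l * \<pi> l)) = (if l = j then snd X a * \<pi> j else 0\<^sub>m (fst X) (fst T))"
        using j l dX hdim\<pi> by (auto simp: \<pi>_\<iota>)
    qed
    also have "\<dots> = snd X a * \<pi> j"
      using j dX hdim\<pi> by (intro mat_sum_single) (auto intro!: carrier_matI)
    finally show ?thesis .
  qed
  then have "\<pi> j \<in> intertwiners T X" if "j < n" for j using \<pi>[OF that] that by (auto intro: HomI)
  then show ?thesis using \<iota> \<pi>_\<iota> sum by (simp add: biprod_def)
qed

lemma biprod_of_retraction:
  assumes X: "is_rep H X" and T: "is_rep H T" and \<pi>: "\<And>j. j < n \<Longrightarrow> \<pi> j \<in> intertwiners T X"
    and \<iota>: "\<And>j. j < n \<Longrightarrow> \<iota> j \<in> carrier_mat (fst T) (fst X)"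
    and \<pi>_\<iota>: "\<And>j k. j < n \<Longrightarrow> k < n \<Longrightarrow> \<pi> j * \<iota> k = (if j = k then 1\<^sub>m (fst X) else 0\<^sub>m (fst X) (fst X))"
    and sum: "mat_sum (fst T) (fst T) (\<lambda>j. \<iota> j * \<pi> j) {..<n} = 1\<^sub>m (fst T)"
  shows "biprod n X T \<iota> \<pi>"
proof -
  note hdim\<pi> = HomD(2,3)[OF \<pi>] and hdim\<iota> = carrier_matD[OF \<iota>]
  note dX = repD(2,3)[OF X] and dT = repD(2,3)[OF T]
  have "\<iota> j * snd X a = snd T a * \<iota> j" if j: "j < n" for j a
  proof -
    have "snd T a * \<iota> j = mat_sum (fst T) (fst T) (\<lambda>l. \<iota> l * \<pi> l) {..<n} * (snd T a * \<iota> j)"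
      using j by (simp add: sum dT hdim\<iota>)
    also have "\<dots> = mat_sum (fst T) (fst X) (\<lambda>l. \<iota> l * \<pi> l * (snd T a * \<iota> j)) {..<n}"
      using j dT hdim\<iota> hdim\<pi> by (intro mat_sum_mult) (auto intro!: carrier_matI)
    also have "\<dots> = mat_sum (fst T) (fst X) (\<lambda>l. if l = j then \<iota> j * snd X a else 0\<^sub>m (fst T) (fst X)) {..<n}"
    proof (rule mat_sum_cong)
      fix l assume "l \<in> {..<n}"
      then have l: "l < n" by simp
      have "\<iota> l * \<pi> l * (snd T a * \<iota> j) = \<iota> l * ((\<pi> l * snd T a) * \<iota> j)"
        using j l dT hdim\<iota> hdim\<pi> by (simp add: mat_assoc)
      also have "\<dots> = \<iota> l * (snd X a * (\<pi> l * \<iota> j))"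
        unfolding HomD(4)[OF \<pi>[OF l]] using j l dX hdim\<iota> hdim\<pi> by (simp add: mat_assoc)
      finally show "\<iota> l * \<pi> l * (snd T a * \<iota> j) = (if l = j then \<iota> j * snd X a else 0\<^sub>m (fst T) (fst X))"
        using j l dX hdim\<iota> by (auto simp: \<pi>_\<iota>)
    qed
    also have "\<dots> = \<iota> j * snd X a"
      using j dX hdim\<iota> by (intro mat_sum_single) (auto intro!: carrier_matI)
    finally show ?thesis by simp
  qed
  then have "\<iota> j \<in> intertwiners X T" if "j < n" for j using \<iota>[OF that] that by (auto intro: HomI)
  then show ?thesis using \<pi> \<pi>_\<iota> sum by (simp add: biprod_def)
qed

section \<open>The regular and the coregular module\<close>

definition regular :: "('k, 'a) rep" where
  "regular = (hdim, \<lambda>a. mat hdim hdim (\<lambda>(i, c). coord i (a * basis c)))"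

text \<open>
  The dual \<open>A\<^sup>*\<close> with the action \<open>(a f)(b) = f(b a)\<close>, where \<open>f\<close> is represented by its values on the
  basis.
\<close>

definition coregular :: "('k, 'a) rep" where
  "coregular = (hdim, \<lambda>a. mat hdim hdim (\<lambda>(i, c). coord c (basis i * a)))"

lemma fst_regular [simp]: "fst regular = hdim" and fst_coregular [simp]: "fst coregular = hdim"
  by (simp_all add: regular_def coregular_def)

lemma regular_index: "i < hdim \<Longrightarrow> c < hdim \<Longrightarrow> snd regular a $$ (i, c) = coord i (a * basis c)"
  and coregular_index: "i < hdim \<Longrightarrow> c < hdim \<Longrightarrow> snd coregular a $$ (i, c) = coord c (basis i * a)"
  by (simp_all add: regular_def coregular_def)

lemma sum_coord_left: "lform g \<Longrightarrow> (\<Sum>q<hdim. g (basis q) * coord q x) = g x"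
  and sum_coord_right: "lform g \<Longrightarrow> (\<Sum>q<hdim. coord q x * g (basis q)) = g x"
  by (simp_all add: lform_expand[of g x] mult.commute)

lemma regular_rep: "is_rep H regular"
proof -
  have "mat hdim hdim (\<lambda>(i, c). coord i (a * b * basis c)) = mat hdim hdim (\<lambda>(i, c). coord i (a * basis c)) * mat hdim hdim (\<lambda>(i, c). coord i (b * basis c))" for a b
  proof (rule eq_matI)
    fix i c assume "i < dim_row (mat hdim hdim (\<lambda>(i, c). coord i (a * basis c)) * mat hdim hdim (\<lambda>(i, c). coord i (b * basis c)))"
      "c < dim_col (mat hdim hdim (\<lambda>(i, c). coord i (a * basis c)) * mat hdim hdim (\<lambda>(i, c). coord i (b * basis c)))"
    then have ic: "i < hdim" "c < hdim" by auto
    have "(\<Sum>q<hdim. coord i (a * basis q) * coord q (b * basis c)) = coord i (a * (b * basis c))"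
      by (rule sum_coord_left[OF lform_mult_left[OF lform_coord]])
    then show "mat hdim hdim (\<lambda>(i, c). coord i (a * b * basis c)) $$ (i, c)
        = (mat hdim hdim (\<lambda>(i, c). coord i (a * basis c)) * mat hdim hdim (\<lambda>(i, c). coord i (b * basis c))) $$ (i, c)"
      using ic by (simp add: mult_index[of _ hdim hdim _ hdim] mult.assoc del: index_mult_mat)
  qed auto
  moreover have "mat hdim hdim (\<lambda>(i, c). coord i (1 * basis c)) = 1\<^sub>m hdim" by (rule eq_matI) (auto simp: coord_basis)
  ultimately show ?thesis
    by (auto simp: is_rep_def regular_def mult_scale_left algebra_simps intro!: eq_matI)
qed

lemma coregular_rep: "is_rep H coregular"
proof -
  have "mat hdim hdim (\<lambda>(i, c). coord c (basis i * (a * b))) = mat hdim hdim (\<lambda>(i, c). coord c (basis i * a)) * mat hdim hdim (\<lambda>(i, c). coord c (basis i * b))" for a b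
  proof (rule eq_matI)
    fix i c assume "i < dim_row (mat hdim hdim (\<lambda>(i, c). coord c (basis i * a)) * mat hdim hdim (\<lambda>(i, c). coord c (basis i * b)))"
      "c < dim_col (mat hdim hdim (\<lambda>(i, c). coord c (basis i * a)) * mat hdim hdim (\<lambda>(i, c). coord c (basis i * b)))"
    then have ic: "i < hdim" "c < hdim" by auto
    have "(\<Sum>q<hdim. coord q (basis i * a) * coord c (basis q * b)) = coord c (basis i * a * b)"
      by (rule sum_coord_right[OF lform_mult_right[OF lform_coord]])
    then show "mat hdim hdim (\<lambda>(i, c). coord c (basis i * (a * b))) $$ (i, c)
        = (mat hdim hdim (\<lambda>(i, c). coord c (basis i * a)) * mat hdim hdim (\<lambda>(i, c). coord c (basis i * b))) $$ (i, c)"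
      using ic by (simp add: mult_index[of _ hdim hdim _ hdim] mult.assoc del: index_mult_mat)
  qed auto
  moreover have "mat hdim hdim (\<lambda>(i, c). coord c (basis i * 1)) = 1\<^sub>m hdim" by (rule eq_matI) (auto simp: coord_basis)
  ultimately show ?thesis
    by (auto simp: is_rep_def coregular_def mult_scale_right algebra_simps intro!: eq_matI)
qed

lemma regular_tensor_index:
  assumes V: "is_rep H V" and ij: "i < hdim * fst V" "j < hdim * fst V"
  shows "snd (rep_tensor H regular V) a $$ (i, j)
    = coord (i div fst V) (right_hit (coef V (i mod fst V) (j mod fst V)) a * basis (j div fst V))"
proof -
  note dm = div_mod_less[OF ij(1)] div_mod_less[OF ij(2)]
  have "snd (rep_tensor H regular V) a $$ (i, j)
      = conv (\<lambda>x. coord (i div fst V) (x * basis (j div fst V))) (coef V (i mod fst V) (j mod fst V)) a"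
    using rep_tensor_index[OF regular_rep V, of i j a] ij dm by (simp add: conv_def coef_def regular_index)
  then show ?thesis by (simp add: lform_right_hit[OF lform_mult_right[OF lform_coord]])
qed

lemma tensor_coregular_index:
  assumes V: "is_rep H V" and ij: "i < fst V * hdim" "j < fst V * hdim"
  shows "snd (rep_tensor H V coregular) a $$ (i, j)
    = coord (j mod hdim) (basis (i mod hdim) * left_hit (coef V (i div hdim) (j div hdim)) a)"
proof -
  note dm = div_mod_less[OF ij(1)] div_mod_less[OF ij(2)]
  have "snd (rep_tensor H V coregular) a $$ (i, j)
      = conv (coef V (i div hdim) (j div hdim)) (\<lambda>y. coord (j mod hdim) (basis (i mod hdim) * y)) a"
    using rep_tensor_index[OF V coregular_rep, of i j a] ij dm by (simp add: conv_def coef_def coregular_index)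
  then show ?thesis by (simp add: lform_left_hit[OF lform_mult_left[OF lform_coord]])
qed

text \<open>
  The embeddings \<open>a \<mapsto> a\<^sub>1 \<otimes> a\<^sub>2 e\<^sub>j\<close> of \<open>A\<close> into \<open>A \<otimes> V\<close> and the projections
  \<open>a \<otimes> v \<mapsto> (S(a\<^sub>2) v)\<^sub>j a\<^sub>1\<close> back.
\<close>

definition regular_\<iota> where
  "regular_\<iota> V j = mat (hdim * fst V) hdim (\<lambda>(p, c). coord (p div fst V) (right_hit (coef V (p mod fst V) j) (basis c)))"
definition regular_\<pi> where
  "regular_\<pi> V j = mat hdim (hdim * fst V) (\<lambda>(i, p). coord i (right_hit (coefS V j (p mod fst V)) (basis (p div fst V))))"

lemma regular_tensor_biprod:
  assumes V: "is_rep H V"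
  shows "biprod (fst V) regular (rep_tensor H regular V) (regular_\<iota> V) (regular_\<pi> V)"
proof (rule biprod_of_section[OF regular_rep rep_tensor_is_rep[OF regular_rep V]])
  let ?n = "fst V" and ?m = "\<lambda>i j. right_hit (coef V i j)" and ?s = "\<lambda>i j. right_hit (coefS V i j)"
  note lforms = lform_right_hit_comp[OF lform_coord lform_coef[OF V]] lform_right_hit_comp[OF lform_coord lform_coefS[OF V]]
  have ci: "regular_\<iota> V j \<in> carrier_mat (hdim * ?n) hdim" and cp: "regular_\<pi> V j \<in> carrier_mat hdim (hdim * ?n)" for j
    by (simp_all add: regular_\<iota>_def regular_\<pi>_def)
  have cT: "snd (rep_tensor H regular V) a \<in> carrier_mat (hdim * ?n) (hdim * ?n)" for a
    using repD(1)[OF rep_tensor_is_rep[OF regular_rep V]] by simp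
  have cR: "snd regular a \<in> carrier_mat hdim hdim" for a using repD(1)[OF regular_rep] by simp
  show "regular_\<pi> V j \<in> carrier_mat (fst regular) (fst (rep_tensor H regular V))" for j using cp by simp
  show "regular_\<iota> V j \<in> intertwiners regular (rep_tensor H regular V)" if j: "j < ?n" for j
  proof (rule HomI)
    show "regular_\<iota> V j \<in> carrier_mat (fst (rep_tensor H regular V)) (fst regular)" using ci by simp
    fix a
    show "regular_\<iota> V j * snd regular a = snd (rep_tensor H regular V) a * regular_\<iota> V j"
    proof (rule eq_matI)
      fix p c assume "p < dim_row (snd (rep_tensor H regular V) a * regular_\<iota> V j)"
        "c < dim_col (snd (rep_tensor H regular V) a * regular_\<iota> V j)"
      then have pc: "p < hdim * ?n" "c < hdim" using cT[of a] ci[of j] by auto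
      note dm = div_mod_less[OF pc(1)]
      let ?q = "p div ?n" and ?r = "p mod ?n"
      have "(regular_\<iota> V j * snd regular a) $$ (p, c) = (\<Sum>q<hdim. coord ?q (?m ?r j (basis q)) * coord q (a * basis c))"
        using pc by (subst mult_index[OF ci cR pc]) (simp add: regular_\<iota>_def regular_index)
      also have "\<dots> = coord ?q (?m ?r j (a * basis c))" by (rule sum_coord_left[OF lforms(1)[OF dm(2) j]])
      also have "\<dots> = (\<Sum>s<?n. coord ?q (?m ?r s a * ?m s j (basis c)))"
        by (simp add: right_hit_coef_mult[OF V dm(2) j] lform_sum[OF lform_coord])
      also have "\<dots> = (\<Sum>s<?n. \<Sum>q<hdim. coord ?q (?m ?r s a * basis q) * coord q (?m s j (basis c)))"
        by (intro sum.cong refl sum_coord_left[symmetric] lform_mult_left[OF lform_coord])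
      also have "\<dots> = (\<Sum>q<hdim. \<Sum>s<?n. coord ?q (?m ?r s a * basis q) * coord q (?m s j (basis c)))"
        by (rule sum.swap)
      also have "\<dots> = (\<Sum>k<hdim * ?n. coord ?q (?m ?r (k mod ?n) a * basis (k div ?n)) * coord (k div ?n) (?m (k mod ?n) j (basis c)))"
        by (rule sum_div_mod[symmetric])
      also have "\<dots> = (snd (rep_tensor H regular V) a * regular_\<iota> V j) $$ (p, c)"
        using pc by (subst mult_index[OF cT ci pc]) (simp add: regular_\<iota>_def regular_tensor_index[OF V])
      finally show "(regular_\<iota> V j * snd regular a) $$ (p, c) = (snd (rep_tensor H regular V) a * regular_\<iota> V j) $$ (p, c)" .
    qed (use cT[of a] ci[of j] cR[of a] in auto)
  qed
  show "regular_\<pi> V j * regular_\<iota> V k = (if j = k then 1\<^sub>m (fst regular) else 0\<^sub>m (fst regular) (fst regular))"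
    if jk: "j < ?n" "k < ?n" for j k
  proof (rule eq_matI)
    fix i c assume "i < dim_row (if j = k then 1\<^sub>m (fst regular) else 0\<^sub>m (fst regular) (fst regular) :: 'k mat)"
      "c < dim_col (if j = k then 1\<^sub>m (fst regular) else 0\<^sub>m (fst regular) (fst regular) :: 'k mat)"
    then have ic: "i < hdim" "c < hdim" by (auto split: if_splits)
    have "(regular_\<pi> V j * regular_\<iota> V k) $$ (i, c)
        = (\<Sum>p<hdim * ?n. coord i (?s j (p mod ?n) (basis (p div ?n))) * coord (p div ?n) (?m (p mod ?n) k (basis c)))"
      using ic by (subst mult_index[OF cp ci ic]) (simp add: regular_\<iota>_def regular_\<pi>_def)
    also have "\<dots> = (\<Sum>q<hdim. \<Sum>s<?n. coord i (?s j s (basis q)) * coord q (?m s k (basis c)))"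
      by (rule sum_div_mod)
    also have "\<dots> = (\<Sum>s<?n. \<Sum>q<hdim. coord i (?s j s (basis q)) * coord q (?m s k (basis c)))"
      by (rule sum.swap)
    also have "\<dots> = (\<Sum>s<?n. coord i (?s j s (?m s k (basis c))))"
      using jk by (intro sum.cong refl sum_coord_left lforms) auto
    also have "\<dots> = (if j = k then coord i (basis c) else 0)" using jk(1) jk(2) by (intro coef_inverse(1)[OF V] lform_coord)
    finally show "(regular_\<pi> V j * regular_\<iota> V k) $$ (i, c) = (if j = k then 1\<^sub>m (fst regular) else 0\<^sub>m (fst regular) (fst regular)) $$ (i, c)"
      using ic by (simp add: coord_basis)
  qed (use cp[of j] ci[of k] in auto)
  show "mat_sum (fst (rep_tensor H regular V)) (fst (rep_tensor H regular V)) (\<lambda>j. regular_\<iota> V j * regular_\<pi> V j) {..<?n}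
      = 1\<^sub>m (fst (rep_tensor H regular V))"
  proof (rule eq_matI)
    fix p p' assume "p < dim_row (1\<^sub>m (fst (rep_tensor H regular V)) :: 'k mat)"
      "p' < dim_col (1\<^sub>m (fst (rep_tensor H regular V)) :: 'k mat)"
    then have p: "p < hdim * ?n" "p' < hdim * ?n" by auto
    note dm = div_mod_less[OF p(1)] div_mod_less[OF p(2)]
    have "(\<Sum>j<?n. (regular_\<iota> V j * regular_\<pi> V j) $$ (p, p'))
        = (\<Sum>j<?n. coord (p div ?n) (?m (p mod ?n) j (?s j (p' mod ?n) (basis (p' div ?n)))))"
    proof (rule sum.cong[OF refl])
      fix j assume "j \<in> {..<?n}"
      then have j: "j < ?n" by simp
      have "(regular_\<iota> V j * regular_\<pi> V j) $$ (p, p')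
          = (\<Sum>c<hdim. coord (p div ?n) (?m (p mod ?n) j (basis c)) * coord c (?s j (p' mod ?n) (basis (p' div ?n))))"
        using p by (subst mult_index[OF ci cp p]) (simp add: regular_\<iota>_def regular_\<pi>_def)
      then show "(regular_\<iota> V j * regular_\<pi> V j) $$ (p, p') = coord (p div ?n) (?m (p mod ?n) j (?s j (p' mod ?n) (basis (p' div ?n))))"
        using sum_coord_left[OF lforms(1)[OF dm(2) j]] by simp
    qed
    also have "\<dots> = (if p mod ?n = p' mod ?n then coord (p div ?n) (basis (p' div ?n)) else 0)"
      using dm(2) dm(4) by (intro coef_inverse(2)[OF V] lform_coord)
    also have "\<dots> = (if p = p' then 1 else 0)"
      using coord_basis[OF dm(1,3)] by (metis div_mult_mod_eq)
    finally show "mat_sum (fst (rep_tensor H regular V)) (fst (rep_tensor H regular V)) (\<lambda>j. regular_\<iota> V j * regular_\<pi> V j) {..<?n} $$ (p, p')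
        = 1\<^sub>m (fst (rep_tensor H regular V)) $$ (p, p')" using p by simp
  qed simp_all
qed

text \<open>
  Elements of \<open>V \<otimes> A\<^sup>*\<close> are linear maps \<open>h : A \<rightarrow> V\<close>, on which \<open>a\<close> acts by
  \<open>(a h)(b) = a\<^sub>1 h(b a\<^sub>2)\<close>.  Passing from \<open>h\<close> to \<open>b \<mapsto> b\<^sub>1 h(b\<^sub>2)\<close> turns this into
  \<open>(a h)(b) = h(b a)\<close>, the action on \<open>n\<close> copies of \<open>A\<^sup>*\<close>; the inverse is
  \<open>h \<mapsto> (b \<mapsto> S(b\<^sub>1) h(b\<^sub>2))\<close>.
\<close>

lemma tensor_coregular_biprod:
  assumes V: "is_rep H V"
  shows "\<exists>\<iota> \<pi>. biprod (fst V) coregular (rep_tensor H V coregular) \<iota> \<pi>"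
proof -
  let ?n = "fst V" and ?m = "\<lambda>i j. left_hit (coef V i j)" and ?s = "\<lambda>i j. left_hit (coefS V i j)"
  define \<iota> where "\<iota> j = mat (?n * hdim) hdim (\<lambda>(p, c). coord c (?s (p div hdim) j (basis (p mod hdim))))" for j
  define \<pi> where "\<pi> j = mat hdim (?n * hdim) (\<lambda>(i, p). coord (p mod hdim) (?m j (p div hdim) (basis i)))" for j
  note lforms = lform_left_hit_comp[OF lform_coord lform_coef[OF V]] lform_left_hit_comp[OF lform_coord lform_coefS[OF V]]
  have ci: "\<iota> j \<in> carrier_mat (?n * hdim) hdim" and cp: "\<pi> j \<in> carrier_mat hdim (?n * hdim)" for j
    by (simp_all add: \<iota>_def \<pi>_def)
  have cT: "snd (rep_tensor H V coregular) a \<in> carrier_mat (?n * hdim) (?n * hdim)" for a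
    using repD(1)[OF rep_tensor_is_rep[OF V coregular_rep]] by simp
  have cR: "snd coregular a \<in> carrier_mat hdim hdim" for a using repD(1)[OF coregular_rep] by simp
  have "biprod ?n coregular (rep_tensor H V coregular) \<iota> \<pi>"
  proof (rule biprod_of_retraction[OF coregular_rep rep_tensor_is_rep[OF V coregular_rep]])
    show "\<iota> j \<in> carrier_mat (fst (rep_tensor H V coregular)) (fst coregular)" for j using ci by simp
    show "\<pi> j \<in> intertwiners (rep_tensor H V coregular) coregular" if j: "j < ?n" for j
    proof (rule HomI)
      show "\<pi> j \<in> carrier_mat (fst coregular) (fst (rep_tensor H V coregular))" using cp by simp
      fix a
      show "\<pi> j * snd (rep_tensor H V coregular) a = snd coregular a * \<pi> j"
      proof (rule eq_matI)
        fix i p assume "i < dim_row (snd coregular a * \<pi> j)" "p < dim_col (snd coregular a * \<pi> j)"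
        then have ip: "i < hdim" "p < ?n * hdim" using cR[of a] cp[of j] by auto
        note dm = div_mod_less[OF ip(2)]
        let ?s = "p div hdim" and ?c = "p mod hdim"
        have "(\<pi> j * snd (rep_tensor H V coregular) a) $$ (i, p)
            = (\<Sum>k<?n * hdim. coord (k mod hdim) (?m j (k div hdim) (basis i)) * coord ?c (basis (k mod hdim) * ?m (k div hdim) ?s a))"
          using ip by (subst mult_index[OF cp cT ip]) (simp add: \<pi>_def tensor_coregular_index[OF V])
        also have "\<dots> = (\<Sum>r<?n. \<Sum>q<hdim. coord q (?m j r (basis i)) * coord ?c (basis q * ?m r ?s a))"
          by (rule sum_div_mod)
        also have "\<dots> = (\<Sum>r<?n. coord ?c (?m j r (basis i) * ?m r ?s a))"
          by (intro sum.cong refl sum_coord_right lform_mult_right[OF lform_coord])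
        also have "\<dots> = coord ?c (?m j ?s (basis i * a))"
          by (simp add: left_hit_coef_mult[OF V j dm(1)] lform_sum[OF lform_coord])
        also have "\<dots> = (\<Sum>q<hdim. coord q (basis i * a) * coord ?c (?m j ?s (basis q)))"
          by (rule sum_coord_right[OF lforms(1)[OF j dm(1)], symmetric])
        also have "\<dots> = (snd coregular a * \<pi> j) $$ (i, p)"
          using ip by (subst mult_index[OF cR cp ip]) (simp add: \<pi>_def coregular_index)
        finally show "(\<pi> j * snd (rep_tensor H V coregular) a) $$ (i, p) = (snd coregular a * \<pi> j) $$ (i, p)" .
      qed (use cT[of a] cp[of j] cR[of a] in auto)
    qed
    show "\<pi> j * \<iota> k = (if j = k then 1\<^sub>m (fst coregular) else 0\<^sub>m (fst coregular) (fst coregular))"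
      if jk: "j < ?n" "k < ?n" for j k
    proof (rule eq_matI)
      fix i c assume "i < dim_row (if j = k then 1\<^sub>m (fst coregular) else 0\<^sub>m (fst coregular) (fst coregular) :: 'k mat)"
        "c < dim_col (if j = k then 1\<^sub>m (fst coregular) else 0\<^sub>m (fst coregular) (fst coregular) :: 'k mat)"
      then have ic: "i < hdim" "c < hdim" by (auto split: if_splits)
      have "(\<pi> j * \<iota> k) $$ (i, c)
          = (\<Sum>p<?n * hdim. coord (p mod hdim) (?m j (p div hdim) (basis i)) * coord c (?s (p div hdim) k (basis (p mod hdim))))"
        using ic by (subst mult_index[OF cp ci ic]) (simp add: \<iota>_def \<pi>_def)
      also have "\<dots> = (\<Sum>s<?n. \<Sum>q<hdim. coord q (?m j s (basis i)) * coord c (?s s k (basis q)))"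
        by (rule sum_div_mod)
      also have "\<dots> = (\<Sum>s<?n. coord c (?s s k (?m j s (basis i))))"
        using jk by (intro sum.cong refl sum_coord_right lforms) auto
      also have "\<dots> = (if j = k then coord c (basis i) else 0)" using jk(1) jk(2) by (intro coef_inverse(3)[OF V] lform_coord)
      finally show "(\<pi> j * \<iota> k) $$ (i, c) = (if j = k then 1\<^sub>m (fst coregular) else 0\<^sub>m (fst coregular) (fst coregular)) $$ (i, c)"
        using ic by (simp add: coord_basis)
    qed (use cp[of j] ci[of k] in auto)
    show "mat_sum (fst (rep_tensor H V coregular)) (fst (rep_tensor H V coregular)) (\<lambda>j. \<iota> j * \<pi> j) {..<?n}
        = 1\<^sub>m (fst (rep_tensor H V coregular))"
    proof (rule eq_matI)
      fix p p' assume "p < dim_row (1\<^sub>m (fst (rep_tensor H V coregular)) :: 'k mat)"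
        "p' < dim_col (1\<^sub>m (fst (rep_tensor H V coregular)) :: 'k mat)"
      then have p: "p < ?n * hdim" "p' < ?n * hdim" by auto
      note dm = div_mod_less[OF p(1)] div_mod_less[OF p(2)]
      have "(\<Sum>j<?n. (\<iota> j * \<pi> j) $$ (p, p'))
          = (\<Sum>j<?n. coord (p' mod hdim) (?m j (p' div hdim) (?s (p div hdim) j (basis (p mod hdim)))))"
      proof (rule sum.cong[OF refl])
        fix j assume "j \<in> {..<?n}"
        then have j: "j < ?n" by simp
        have "(\<iota> j * \<pi> j) $$ (p, p')
            = (\<Sum>c<hdim. coord c (?s (p div hdim) j (basis (p mod hdim))) * coord (p' mod hdim) (?m j (p' div hdim) (basis c)))"
          using p by (subst mult_index[OF ci cp p]) (simp add: \<iota>_def \<pi>_def)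
        then show "(\<iota> j * \<pi> j) $$ (p, p') = coord (p' mod hdim) (?m j (p' div hdim) (?s (p div hdim) j (basis (p mod hdim))))"
          using sum_coord_right[OF lforms(1)[OF j dm(3)]] by simp
      qed
      also have "\<dots> = (if p div hdim = p' div hdim then coord (p' mod hdim) (basis (p mod hdim)) else 0)"
        using dm(1) dm(3) by (intro coef_inverse(4)[OF V] lform_coord)
      also have "\<dots> = (if p = p' then 1 else 0)"
        using coord_basis[OF dm(4,2)] by (metis div_mult_mod_eq)
      finally show "mat_sum (fst (rep_tensor H V coregular)) (fst (rep_tensor H V coregular)) (\<lambda>j. \<iota> j * \<pi> j) {..<?n} $$ (p, p')
          = 1\<^sub>m (fst (rep_tensor H V coregular)) $$ (p, p')" using p by simp
    qed simp_all
  qed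
  then show ?thesis by blast
qed

end

section \<open>The negligible endomorphisms of the regular module\<close>

context fd_hopf_algebra
begin

definition right_mult :: "'a \<Rightarrow> 'k mat" where "right_mult b = mat hdim hdim (\<lambda>(i, c). coord i (basis c * b))"

definition apply_mat :: "'k mat \<Rightarrow> 'a \<Rightarrow> 'a" where
  "apply_mat f x = (\<Sum>i<hdim. scale H (\<Sum>c<hdim. f $$ (i, c) * coord c x) (basis i))"

lemma coord_sum_basis: "i < hdim \<Longrightarrow> coord i (\<Sum>q<hdim. scale H (h q) (basis q)) = h i"
proof -
  assume i: "i < hdim"
  have "coord i (\<Sum>q<hdim. scale H (h q) (basis q)) = (\<Sum>q<hdim. if q = i then h i else 0)"
    unfolding lform_sum[OF lform_coord] using i by (intro sum.cong) (auto simp: coord_basis)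
  then show ?thesis using i by simp
qed

lemma coord_eqI: "(\<And>i. i < hdim \<Longrightarrow> coord i x = coord i y) \<Longrightarrow> x = y"
  by (metis (no_types, lifting) expand lessThan_iff sum.cong)

lemma coord_apply_mat: "i < hdim \<Longrightarrow> coord i (apply_mat f x) = (\<Sum>c<hdim. f $$ (i, c) * coord c x)"
  unfolding apply_mat_def by (rule coord_sum_basis)

lemma apply_mat_basis:
  assumes "i < hdim" "c < hdim" shows "coord i (apply_mat f (basis c)) = f $$ (i, c)"
proof -
  have "coord i (apply_mat f (basis c)) = (\<Sum>q<hdim. if q = c then f $$ (i, c) else 0)"
    unfolding coord_apply_mat[OF assms(1)] using assms by (intro sum.cong) (auto simp: coord_basis)
  then show ?thesis using assms by simp
qed

lemma apply_mat_mult: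
  assumes "f \<in> carrier_mat hdim hdim" "g \<in> carrier_mat hdim hdim"
  shows "apply_mat (f * g) x = apply_mat f (apply_mat g x)"
proof (rule coord_eqI)
  fix i assume i: "i < hdim"
  have "coord i (apply_mat (f * g) x) = (\<Sum>c<hdim. (\<Sum>q<hdim. f $$ (i, q) * g $$ (q, c)) * coord c x)"
    unfolding coord_apply_mat[OF i] using assms i by (intro sum.cong refl) (subst mult_index[of _ hdim hdim _ hdim], auto)
  also have "\<dots> = (\<Sum>q<hdim. f $$ (i, q) * (\<Sum>c<hdim. g $$ (q, c) * coord c x))"
    unfolding sum_distrib_right sum_distrib_left by (subst sum.swap) (simp add: mult.assoc)
  also have "\<dots> = coord i (apply_mat f (apply_mat g x))"
    unfolding coord_apply_mat[OF i] by (intro sum.cong refl) (simp add: coord_apply_mat)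
  finally show "coord i (apply_mat (f * g) x) = coord i (apply_mat f (apply_mat g x))" .
qed

lemma apply_mat_regular: "apply_mat (snd regular a) x = a * x"
proof (rule coord_eqI)
  fix i assume i: "i < hdim"
  have "coord i (apply_mat (snd regular a) x) = (\<Sum>c<hdim. coord i (a * basis c) * coord c x)"
    unfolding coord_apply_mat[OF i] using i by (intro sum.cong) (auto simp: regular_index)
  then show "coord i (apply_mat (snd regular a) x) = coord i (a * x)"
    by (simp add: sum_coord_left[OF lform_mult_left[OF lform_coord]])
qed

lemma apply_mat_right_mult: "apply_mat (right_mult b) x = x * b"
proof (rule coord_eqI)
  fix i assume i: "i < hdim"
  have "coord i (apply_mat (right_mult b) x) = (\<Sum>c<hdim. coord i (basis c * b) * coord c x)"
    unfolding coord_apply_mat[OF i] using i by (intro sum.cong) (auto simp: right_mult_def)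
  then show "coord i (apply_mat (right_mult b) x) = coord i (x * b)"
    by (simp add: sum_coord_left[OF lform_mult_right[OF lform_coord]])
qed

lemma apply_mat_one: "apply_mat (1\<^sub>m hdim) x = x"
proof (rule coord_eqI)
  fix i assume i: "i < hdim"
  have "coord i (apply_mat (1\<^sub>m hdim) x) = (\<Sum>c<hdim. if c = i then coord i x else 0)"
    unfolding coord_apply_mat[OF i] using i by (intro sum.cong) auto
  then show "coord i (apply_mat (1\<^sub>m hdim) x) = coord i x" using i by simp
qed

lemma apply_mat_inj:
  assumes "f \<in> carrier_mat hdim hdim" "g \<in> carrier_mat hdim hdim" "\<And>x. apply_mat f x = apply_mat g x" shows "f = g"
  using assms apply_mat_basis[of _ _ f] apply_mat_basis[of _ _ g] by (intro eq_matI) auto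

lemma right_mult_carrier [simp]: "right_mult b \<in> carrier_mat hdim hdim" by (simp add: right_mult_def)

lemma right_mult_End: "right_mult b \<in> intertwiners regular regular"
proof (rule HomI)
  fix a
  have c: "snd regular a \<in> carrier_mat hdim hdim" using repD(1)[OF regular_rep] by simp
  show "right_mult b * snd regular a = snd regular a * right_mult b"
    by (rule apply_mat_inj[OF mult_carrier_mat[OF right_mult_carrier c] mult_carrier_mat[OF c right_mult_carrier]])
      (simp add: apply_mat_mult[OF right_mult_carrier c] apply_mat_mult[OF c right_mult_carrier] apply_mat_regular apply_mat_right_mult mult.assoc)
qed simp

definition at_one :: "'k mat \<Rightarrow> 'a" where "at_one f = apply_mat f 1"

lemma End_apply_mat:
  assumes f: "f \<in> intertwiners regular regular" shows "apply_mat f x = x * at_one f"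
proof -
  have c: "f \<in> carrier_mat hdim hdim" "snd regular x \<in> carrier_mat hdim hdim"
    using HomD(1)[OF f] repD(1)[OF regular_rep] by simp_all
  have "apply_mat f (x * 1) = apply_mat (f * snd regular x) 1" by (simp only: apply_mat_mult[OF c] apply_mat_regular)
  also have "\<dots> = x * apply_mat f 1" by (simp only: HomD(4)[OF f] apply_mat_mult[OF c(2,1)] apply_mat_regular)
  finally show ?thesis by (simp add: at_one_def)
qed

lemma right_mult_at_one: "f \<in> intertwiners regular regular \<Longrightarrow> right_mult (at_one f) = f"
  using HomD(1)[of f regular regular] by (intro apply_mat_inj) (auto simp: apply_mat_right_mult End_apply_mat)

lemma at_one_right_mult: "at_one (right_mult b) = b" by (simp add: at_one_def apply_mat_right_mult)

lemma at_one_mult: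
  assumes "f \<in> intertwiners regular regular" "g \<in> intertwiners regular regular" shows "at_one (g * f) = at_one f * at_one g"
proof -
  have "at_one (g * f) = apply_mat g (apply_mat f 1)"
    using apply_mat_mult[of g f] HomD(1)[OF assms(1)] HomD(1)[OF assms(2)] by (simp add: at_one_def)
  also have "\<dots> = apply_mat f 1 * at_one g" by (rule End_apply_mat[OF assms(2)])
  finally show ?thesis by (simp add: at_one_def)
qed

lemma at_one_add:
  assumes "f \<in> intertwiners regular regular" "g \<in> intertwiners regular regular" shows "at_one (f + g) = at_one f + at_one g"
  using HomD(2,3)[OF assms(1)] HomD(2,3)[OF assms(2)]
  by (intro coord_eqI) (simp add: at_one_def coord_apply_mat algebra_simps sum.distrib)

lemma at_one_smult:
  assumes "f \<in> intertwiners regular regular" shows "at_one (c \<cdot>\<^sub>m f) = scale H c (at_one f)"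
  using HomD(2,3)[OF assms] by (intro coord_eqI) (simp add: at_one_def coord_apply_mat algebra_simps sum_distrib_left)

lemma frame_End_regular:
  "frame hdim hdim (intertwiners regular regular) {..<hdim} (\<lambda>i. right_mult (basis i)) (\<lambda>i f. coord i (at_one f))"
  unfolding frame_def
proof (intro conjI ballI)
  show "mat_subspace hdim hdim (intertwiners regular regular)" using Hom_mat_subspace[OF regular_rep regular_rep] by simp
  show "lin_form (intertwiners regular regular) (\<lambda>f. coord i (at_one f))" for i
    by (auto simp: lin_form_def at_one_add at_one_smult)
  fix f assume f: "f \<in> intertwiners regular regular"
  have "f = right_mult (at_one f)" by (rule right_mult_at_one[OF f, symmetric])
  also have "\<dots> = mat_sum hdim hdim (\<lambda>i. coord i (at_one f) \<cdot>\<^sub>m right_mult (basis i)) {..<hdim}"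
  proof (rule eq_matI)
    fix r c assume "r < dim_row (mat_sum hdim hdim (\<lambda>i. coord i (at_one f) \<cdot>\<^sub>m right_mult (basis i)) {..<hdim})"
      "c < dim_col (mat_sum hdim hdim (\<lambda>i. coord i (at_one f) \<cdot>\<^sub>m right_mult (basis i)) {..<hdim})"
    then have rc: "r < hdim" "c < hdim" by auto
    have "coord r (basis c * at_one f) = (\<Sum>q<hdim. coord q (at_one f) * coord r (basis c * basis q))"
      by (rule sum_coord_right[OF lform_mult_left[OF lform_coord], symmetric])
    then show "right_mult (at_one f) $$ (r, c) = mat_sum hdim hdim (\<lambda>i. coord i (at_one f) \<cdot>\<^sub>m right_mult (basis i)) {..<hdim} $$ (r, c)"
      using rc by (simp add: right_mult_def)
  qed (simp_all add: right_mult_def)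
  finally show "f = \<dots>" .
qed (auto simp: right_mult_End at_one_right_mult coord_basis)

lemma mat_dim_End_regular: "mat_dim hdim hdim (intertwiners regular regular) = hdim"
  using mat_dim_frame[OF frame_End_regular] by simp

text \<open>
  The bilinear map with matrix \<open>t\<close>, where \<open>A \<otimes> A\<close> has the basis of products of basis elements.
\<close>

definition bilin :: "'k mat \<Rightarrow> 'a \<Rightarrow> 'a \<Rightarrow> 'a" where
  "bilin t x y = (\<Sum>i<hdim. scale H (\<Sum>p<hdim * hdim. t $$ (i, p) * (coord (p div hdim) x * coord (p mod hdim) y)) (basis i))"

lemma coord_bilin: "i < hdim \<Longrightarrow> coord i (bilin t x y) = (\<Sum>p<hdim * hdim. t $$ (i, p) * (coord (p div hdim) x * coord (p mod hdim) y))"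
  unfolding bilin_def by (rule coord_sum_basis)

lemma div_mod_eqI: "q div n = p div n \<Longrightarrow> q mod n = p mod n \<Longrightarrow> q = (p::nat)"
  by (metis div_mult_mod_eq)

lemma bilin_basis:
  assumes "i < hdim" "p < hdim * hdim" shows "coord i (bilin t (basis (p div hdim)) (basis (p mod hdim))) = t $$ (i, p)"
proof -
  have "coord (q div hdim) (basis (p div hdim)) * coord (q mod hdim) (basis (p mod hdim)) = (if q = p then 1 else 0)"
    if "q < hdim * hdim" for q
    unfolding coord_basis[OF div_mod_less(1)[OF that] div_mod_less(1)[OF assms(2)]]
      coord_basis[OF div_mod_less(2)[OF that] div_mod_less(2)[OF assms(2)]]
    by (auto intro: div_mod_eqI)
  then have "coord i (bilin t (basis (p div hdim)) (basis (p mod hdim))) = (\<Sum>q<hdim * hdim. if q = p then t $$ (i, p) else 0)"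
    unfolding coord_bilin[OF assms(1)] by (intro sum.cong refl) auto
  then show ?thesis using assms by simp
qed

lemma bilin_inj:
  assumes "t \<in> carrier_mat hdim (hdim * hdim)" "u \<in> carrier_mat hdim (hdim * hdim)" "\<And>x y. bilin t x y = bilin u x y"
  shows "t = u"
  using assms bilin_basis[of _ _ t] bilin_basis[of _ _ u] by (intro eq_matI) auto

lemma bilin_add: "t \<in> carrier_mat hdim (hdim * hdim) \<Longrightarrow> u \<in> carrier_mat hdim (hdim * hdim) \<Longrightarrow> bilin (t + u) x y = bilin t x y + bilin u x y"
  by (intro coord_eqI) (simp add: coord_bilin algebra_simps sum.distrib)

lemma bilin_smult: "t \<in> carrier_mat hdim (hdim * hdim) \<Longrightarrow> bilin (c \<cdot>\<^sub>m t) x y = scale H c (bilin t x y)"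
  by (intro coord_eqI) (simp add: coord_bilin algebra_simps sum_distrib_left)

lemma bilin_mat_sum: "bilin (mat_sum hdim (hdim * hdim) f I) x y = (\<Sum>i\<in>I. bilin (f i) x y)"
proof (rule coord_eqI)
  fix i assume i: "i < hdim"
  show "coord i (bilin (mat_sum hdim (hdim * hdim) f I) x y) = coord i (\<Sum>i\<in>I. bilin (f i) x y)"
    using i by (simp add: coord_bilin lform_sum[OF lform_coord] sum_distrib_right) (rule sum.swap)
qed

lemma bilin_kronecker:
  assumes t: "t \<in> carrier_mat hdim (hdim * hdim)" and f: "f \<in> carrier_mat hdim hdim" and g: "g \<in> carrier_mat hdim hdim"
  shows "bilin (t * kronecker f g) x y = bilin t (apply_mat f x) (apply_mat g y)"
proof (rule coord_eqI)
  fix i assume i: "i < hdim"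
  have k: "kronecker f g \<in> carrier_mat (hdim * hdim) (hdim * hdim)" using f g by auto
  have *: "(\<Sum>p<hdim * hdim. kronecker f g $$ (q, p) * (coord (p div hdim) x * coord (p mod hdim) y))
      = coord (q div hdim) (apply_mat f x) * coord (q mod hdim) (apply_mat g y)" if q: "q < hdim * hdim" for q
  proof -
    note dm = div_mod_less[OF q]
    have "(\<Sum>p<hdim * hdim. kronecker f g $$ (q, p) * (coord (p div hdim) x * coord (p mod hdim) y))
        = (\<Sum>p<hdim * hdim. (f $$ (q div hdim, p div hdim) * coord (p div hdim) x) * (g $$ (q mod hdim, p mod hdim) * coord (p mod hdim) y))"
      using q f g by (intro sum.cong refl) (simp add: kronecker_index ac_simps)
    also have "\<dots> = (\<Sum>a<hdim. \<Sum>b<hdim. (f $$ (q div hdim, a) * coord a x) * (g $$ (q mod hdim, b) * coord b y))"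
      by (rule sum_div_mod)
    also have "\<dots> = coord (q div hdim) (apply_mat f x) * coord (q mod hdim) (apply_mat g y)"
      unfolding coord_apply_mat[OF dm(1)] coord_apply_mat[OF dm(2)] by (rule sum_product[symmetric])
    finally show ?thesis .
  qed
  have "coord i (bilin (t * kronecker f g) x y)
      = (\<Sum>p<hdim * hdim. (\<Sum>q<hdim * hdim. t $$ (i, q) * kronecker f g $$ (q, p)) * (coord (p div hdim) x * coord (p mod hdim) y))"
    unfolding coord_bilin[OF i] using i by (intro sum.cong refl) (subst mult_index[OF t k], auto)
  also have "\<dots> = (\<Sum>q<hdim * hdim. t $$ (i, q) * (\<Sum>p<hdim * hdim. kronecker f g $$ (q, p) * (coord (p div hdim) x * coord (p mod hdim) y)))"
    unfolding sum_distrib_right sum_distrib_left by (subst sum.swap) (simp add: mult.assoc)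
  also have "\<dots> = coord i (bilin t (apply_mat f x) (apply_mat g y))"
    unfolding coord_bilin[OF i] by (intro sum.cong refl) (simp add: *)
  finally show "coord i (bilin (t * kronecker f g) x y) = coord i (bilin t (apply_mat f x) (apply_mat g y))" .
qed

lemma bilin_left:
  assumes t: "t \<in> carrier_mat hdim (hdim * hdim)" and f: "f \<in> carrier_mat hdim hdim"
  shows "bilin (f * t) x y = apply_mat f (bilin t x y)"
proof (rule coord_eqI)
  fix i assume i: "i < hdim"
  have "coord i (bilin (f * t) x y)
      = (\<Sum>p<hdim * hdim. (\<Sum>q<hdim. f $$ (i, q) * t $$ (q, p)) * (coord (p div hdim) x * coord (p mod hdim) y))"
    unfolding coord_bilin[OF i] using i by (intro sum.cong refl) (subst mult_index[OF f t], auto)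
  also have "\<dots> = (\<Sum>q<hdim. f $$ (i, q) * (\<Sum>p<hdim * hdim. t $$ (q, p) * (coord (p div hdim) x * coord (p mod hdim) y)))"
    unfolding sum_distrib_right sum_distrib_left by (subst sum.swap) (simp add: mult.assoc)
  also have "\<dots> = coord i (apply_mat f (bilin t x y))"
    unfolding coord_apply_mat[OF i] by (intro sum.cong refl) (simp add: coord_bilin)
  finally show "coord i (bilin (f * t) x y) = coord i (apply_mat f (bilin t x y))" .
qed

lemma bilin_tensor:
  assumes t: "t \<in> carrier_mat hdim (hdim * hdim)"
  shows "bilin (t * snd (rep_tensor H regular regular) a) x y = (\<Sum>(u, v)\<leftarrow>comult H a. bilin t (u * x) (v * y))"
proof -
  let ?l = "length (comult H a)" and ?u = "\<lambda>k. fst (comult H a ! k)" and ?v = "\<lambda>k. snd (comult H a ! k)"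
  have c: "snd regular b \<in> carrier_mat hdim hdim" for b using repD(1)[OF regular_rep] by simp
  have "t * snd (rep_tensor H regular regular) a
      = mat_sum hdim (hdim * hdim) (\<lambda>k. t * kronecker (snd regular (?u k)) (snd regular (?v k))) {..<?l}"
    unfolding rep_tensor_mat_sum[OF regular_rep regular_rep] fst_regular
    by (rule mult_mat_sum[OF t]) (auto intro!: carrier_matI simp: carrier_matD[OF c])
  then show ?thesis
    by (simp add: bilin_mat_sum bilin_kronecker[OF t c c] apply_mat_regular sum_list_sum_nth split_def atLeast0LessThan)
qed

lemma bilin_add_left: "bilin t (x + x') y = bilin t x y + bilin t x' y"
  and bilin_scale_left: "bilin t (scale H c x) y = scale H c (bilin t x y)"
  by (rule coord_eqI; simp add: coord_bilin algebra_simps sum.distrib sum_distrib_left)+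

lemma lform_adjoint: "lform g \<Longrightarrow> g (adjoint_rep H a z) = (\<Sum>(x, y)\<leftarrow>comult H a. g (x * z * antipode H y))"
  by (simp add: adjoint_rep_def lform_sum_list split_def)

lemma adjoint_one: "adjoint_rep H 1 z = z"
proof -
  have S1: "antipode H 1 = 1"
  proof (rule lform_eqI)
    fix g assume g: "lform g"
    have "g (antipode H 1) = (\<Sum>(x, y)\<leftarrow>[(1, 1)]. g (x * antipode H y))" by simp
    also have "\<dots> = (\<Sum>(x, y)\<leftarrow>comult H 1. g (x * antipode H y))"
      by (rule comult_form[OF _ _ comult_one, symmetric])
        (auto intro: lform_mult_right[OF g] lform_antipode[OF lform_mult_left[OF g]])
    also have "\<dots> = g 1"
      using antipode_right[of 1] counit_one by (simp add: lform_sum_list[OF g, symmetric] split_def)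
    finally show "g (antipode H 1) = g 1" .
  qed
  show ?thesis
  proof (rule lform_eqI)
    fix g assume g: "lform g"
    have "g (adjoint_rep H 1 z) = (\<Sum>(x, y)\<leftarrow>[(1, 1)]. g (x * z * antipode H y))"
      unfolding lform_adjoint[OF g]
      by (rule comult_form[OF _ _ comult_one])
        (rule lform_mult_right[OF lform_mult_right[OF g]] lform_antipode[OF lform_mult_left[OF g]])+
    then show "g (adjoint_rep H 1 z) = g z" by (simp add: S1)
  qed
qed

text \<open>
  The map \<open>x \<otimes> y \<mapsto> x\<^sub>1 z S(x\<^sub>2) y\<close>, composed of right multiplications and the equivariant projections of
  \<open>A \<otimes> A\<close> onto \<open>A\<close>, which shows that it is a morphism.
\<close>

definition adjoint_action :: "'a \<Rightarrow> 'k mat" where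
  "adjoint_action z = mat_sum hdim (hdim * hdim) (\<lambda>j. right_mult (z * basis j) * regular_\<pi> regular j) {..<hdim}"

lemma adjoint_action_carrier [simp]: "adjoint_action z \<in> carrier_mat hdim (hdim * hdim)" by (simp add: adjoint_action_def)

lemma bilin_regular_\<pi>:
  assumes j: "j < hdim"
  shows "bilin (regular_\<pi> regular j) x y = (\<Sum>(u, v)\<leftarrow>comult H x. scale H (coord j (antipode H v * y)) u)"
proof (rule coord_eqI)
  fix i assume i: "i < hdim"
  have "coord i (bilin (regular_\<pi> regular j) x y)
      = (\<Sum>p<hdim * hdim. coord i (right_hit (coefS regular j (p mod hdim)) (basis (p div hdim))) * (coord (p div hdim) x * coord (p mod hdim) y))"
    unfolding coord_bilin[OF i] using i by (intro sum.cong refl) (simp add: regular_\<pi>_def)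
  also have "\<dots> = (\<Sum>q<hdim. \<Sum>s<hdim. coord i (right_hit (coefS regular j s) (basis q)) * (coord q x * coord s y))"
    by (rule sum_div_mod)
  also have "\<dots> = (\<Sum>s<hdim. (\<Sum>q<hdim. coord i (right_hit (coefS regular j s) (basis q)) * coord q x) * coord s y)"
    by (subst sum.swap) (simp add: sum_distrib_right mult.assoc)
  also have "\<dots> = (\<Sum>s<hdim. conv (coord i) (coefS regular j s) x * coord s y)"
    using sum_coord_left[OF lform_right_hit_comp[OF lform_coord lform_coefS[OF regular_rep]]] j
    by (intro sum.cong refl) (simp add: lform_right_hit[OF lform_coord])
  also have "\<dots> = (\<Sum>(u, v)\<leftarrow>comult H x. coord i u * (\<Sum>s<hdim. coord j (antipode H v * basis s) * coord s y))"
    unfolding conv_def coefS_def coef_def using j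
    by (simp add: regular_index sum_list_sum_nth split_def sum_distrib_left sum_distrib_right mult.assoc) (rule sum.swap)
  also have "\<dots> = coord i (\<Sum>(u, v)\<leftarrow>comult H x. scale H (coord j (antipode H v * y)) u)"
    by (simp add: sum_coord_left[OF lform_mult_left[OF lform_coord]] lform_sum_list[OF lform_coord] split_def mult.commute[where 'a = 'k]
        sum_coord_right[OF lform_mult_left[OF lform_coord]])
  finally show "coord i (bilin (regular_\<pi> regular j) x y)
      = coord i (\<Sum>(u, v)\<leftarrow>comult H x. scale H (coord j (antipode H v * y)) u)" .
qed

lemma bilin_adjoint_action: "bilin (adjoint_action z) x y = adjoint_rep H x z * y"
proof (rule lform_eqI)
  fix g assume g: "lform g"
  have c: "regular_\<pi> regular j \<in> carrier_mat hdim (hdim * hdim)" for j by (simp add: regular_\<pi>_def)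
  have "g (bilin (adjoint_action z) x y) = (\<Sum>j<hdim. g (bilin (regular_\<pi> regular j) x y * (z * basis j)))"
    by (simp add: adjoint_action_def bilin_mat_sum bilin_left[OF c] apply_mat_right_mult lform_sum[OF g])
  also have "\<dots> = (\<Sum>j<hdim. \<Sum>(u, v)\<leftarrow>comult H x. coord j (antipode H v * y) * g (u * z * basis j))"
    by (intro sum.cong refl)
      (simp add: bilin_regular_\<pi> sum_list_mult_const[symmetric] lform_sum_list[OF g] lform_scale[OF g] mult_scale_left split_def mult.assoc)
  also have "\<dots> = (\<Sum>(u, v)\<leftarrow>comult H x. \<Sum>j<hdim. coord j (antipode H v * y) * g (u * z * basis j))"
    unfolding sum_list_sum_nth split_def by (simp add: sum.swap[of _ "{..<hdim}"])
  also have "\<dots> = (\<Sum>(u, v)\<leftarrow>comult H x. g (u * z * (antipode H v * y)))"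
    by (simp add: sum_coord_right[OF lform_mult_left[OF g]])
  also have "\<dots> = g (adjoint_rep H x z * y)"
    by (simp add: lform_adjoint[OF lform_mult_right[OF g]] mult.assoc)
  finally show "g (bilin (adjoint_action z) x y) = g (adjoint_rep H x z * y)" .
qed

lemma regular_tensor_regular_rep: "is_rep H (rep_tensor H regular regular)" by (rule rep_tensor_is_rep[OF regular_rep regular_rep])

lemma adjoint_action_actions: "adjoint_action z \<in> actions H regular"
proof -
  have "regular_\<pi> regular j \<in> intertwiners (rep_tensor H regular regular) regular" if "j < hdim" for j
    using regular_tensor_biprod[OF regular_rep] that by (simp add: biprod_def)
  then have "adjoint_action z \<in> intertwiners (rep_tensor H regular regular) regular"
    unfolding adjoint_action_def using mat_subspace_mat_sum[OF Hom_mat_subspace[OF regular_tensor_regular_rep regular_rep], of "{..<hdim}"]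
      Hom_comp[OF regular_tensor_regular_rep regular_rep regular_rep _ right_mult_End] by simp
  moreover have "adjoint_action z * kronecker (1\<^sub>m hdim) g = g * adjoint_action z" if g: "g \<in> intertwiners regular regular" for g
  proof -
    have c: "g \<in> carrier_mat hdim hdim" using HomD(1)[OF g] by simp
    then have k: "kronecker (1\<^sub>m hdim) g \<in> carrier_mat (hdim * hdim) (hdim * hdim)" by auto
    show ?thesis
      by (rule bilin_inj[OF mult_carrier_mat[OF adjoint_action_carrier k] mult_carrier_mat[OF c adjoint_action_carrier]])
        (simp add: bilin_kronecker[OF adjoint_action_carrier _ c] bilin_left[OF adjoint_action_carrier c] apply_mat_one bilin_adjoint_action End_apply_mat[OF g] mult.assoc)
  qed
  ultimately show ?thesis by (simp add: actions_def)
qed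

definition at_one_one :: "'k mat \<Rightarrow> 'a" where "at_one_one t = bilin t 1 1"

lemma actions_carrier: "t \<in> actions H regular \<Longrightarrow> t \<in> carrier_mat hdim (hdim * hdim)"
  using actionsD(2,3)[of t H regular] by auto

text \<open>
  Let \<open>z = t(1 \<otimes> 1)\<close>.  Commuting with right multiplications gives \<open>t(x \<otimes> y) = t(x \<otimes> 1) y\<close>, and
  equivariance at \<open>1 \<otimes> 1\<close> gives \<open>t(x\<^sub>1 \<otimes> 1) x\<^sub>2 = x z\<close>.  Multiplying by the antipode of one
  further component of \<open>x\<close> yields \<open>t(x \<otimes> 1) = x\<^sub>1 z S(x\<^sub>2)\<close>.
\<close>

lemma bilin_actions:
  assumes t: "t \<in> actions H regular" shows "bilin t x y = adjoint_rep H x (at_one_one t) * y"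
proof -
  note c = actions_carrier[OF t]
  have right: "bilin t x (y * b) = bilin t x y * b" for x y b
  proof -
    have "bilin (t * kronecker (1\<^sub>m hdim) (right_mult b)) x y = bilin (right_mult b * t) x y"
      using actionsD(4)[OF t right_mult_End, of b] by simp
    then show ?thesis by (simp add: bilin_kronecker[OF c] bilin_left[OF c] apply_mat_one apply_mat_right_mult)
  qed
  have split: "bilin t x y = bilin t x 1 * y" for x y using right[of x 1 y] by simp
  have left: "(\<Sum>(u, v)\<leftarrow>comult H a. bilin t u 1 * v) = a * at_one_one t" for a
  proof -
    have "bilin (t * snd (rep_tensor H regular regular) a) 1 1 = bilin (snd regular a * t) 1 1"
      using HomD(4)[OF actionsD(1)[OF t], of a] by simp
    then show ?thesis
      using repD(1)[OF regular_rep] by (simp add: bilin_tensor[OF c] bilin_left[OF c] apply_mat_regular at_one_one_def split[symmetric])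
  qed
  have "bilin t x 1 = adjoint_rep H x (at_one_one t)"
  proof (rule lform_eqI)
    fix g assume g: "lform g"
    have "g (adjoint_rep H x (at_one_one t)) = (\<Sum>(a, b)\<leftarrow>comult H x. g ((\<Sum>(u, v)\<leftarrow>comult H a. bilin t u 1 * v) * antipode H b))"
      by (simp add: lform_adjoint[OF g] left)
    also have "\<dots> = (\<Sum>(a, b)\<leftarrow>comult H x. \<Sum>(u, v)\<leftarrow>comult H a. g (bilin t u 1 * v * antipode H b))"
      by (simp add: sum_list_mult_const[symmetric] lform_sum_list[OF g] split_def)
    also have "\<dots> = (\<Sum>(a, b)\<leftarrow>comult H x. \<Sum>(u, v)\<leftarrow>comult H b. g (bilin t a 1 * u * antipode H v))"
      by (rule comult_form_coassoc)
        (auto simp: lform_def lform_add[OF g] lform_scale[OF g] bilin_add_left bilin_scale_left antipode_add antipode_scale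
          mult_scale_left mult_scale_right algebra_simps)
    also have "\<dots> = (\<Sum>(a, b)\<leftarrow>comult H x. g (bilin t a 1 * (\<Sum>(u, v)\<leftarrow>comult H b. u * antipode H v)))"
      by (simp add: sum_list_const_mult[symmetric] lform_sum_list[OF g] split_def mult.assoc)
    also have "\<dots> = (\<Sum>(a, b)\<leftarrow>comult H x. g (bilin t a 1) * counit H b)"
      by (simp add: antipode_right mult_scale_right lform_scale[OF g] mult.commute)
    also have "\<dots> = g (bilin t x 1)"
      by (rule comult_form_counit_right) (auto simp: lform_def lform_add[OF g] lform_scale[OF g] bilin_add_left bilin_scale_left)
    finally show "g (bilin t x 1) = g (adjoint_rep H x (at_one_one t))" by simp
  qed
  then show ?thesis by (subst split) simp
qed

lemma at_one_one_adjoint_action: "at_one_one (adjoint_action z) = z" by (simp add: at_one_one_def bilin_adjoint_action adjoint_one)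

lemma adjoint_add: "adjoint_rep H a (x + y) = adjoint_rep H a x + adjoint_rep H a y"
  and adjoint_scale: "adjoint_rep H a (scale H c x) = scale H c (adjoint_rep H a x)"
  by (rule lform_eqI; simp add: lform_adjoint lform_add lform_scale split_def algebra_simps mult_scale_left mult_scale_right
      sum_list_addf sum_list_const_mult)+

lemma frame_actions_regular: "frame hdim (hdim * hdim) (actions H regular) {..<hdim} (\<lambda>i. adjoint_action (basis i)) (\<lambda>i t. coord i (at_one_one t))"
  unfolding frame_def
proof (intro conjI ballI)
  show "mat_subspace hdim (hdim * hdim) (actions H regular)" using actions_mat_subspace[OF regular_rep] by simp
  show "lin_form (actions H regular) (\<lambda>t. coord i (at_one_one t))" for i
    by (auto simp: lin_form_def at_one_one_def bilin_add actions_carrier bilin_smult)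
  fix t assume t: "t \<in> actions H regular"
  show "t = mat_sum hdim (hdim * hdim) (\<lambda>i. coord i (at_one_one t) \<cdot>\<^sub>m adjoint_action (basis i)) {..<hdim}"
  proof (rule bilin_inj[OF actions_carrier[OF t]])
    fix x y
    show "bilin t x y = bilin (mat_sum hdim (hdim * hdim) (\<lambda>i. coord i (at_one_one t) \<cdot>\<^sub>m adjoint_action (basis i)) {..<hdim}) x y"
    proof (rule lform_eqI)
      fix g assume g: "lform g"
      have "lform (\<lambda>z. g (adjoint_rep H x z * y))"
        by (rule lformI) (simp_all add: adjoint_add adjoint_scale distrib_right mult_scale_left lform_add[OF g] lform_scale[OF g])
      from sum_coord_right[OF this, of "at_one_one t"]
      show "g (bilin t x y) = g (bilin (mat_sum hdim (hdim * hdim) (\<lambda>i. coord i (at_one_one t) \<cdot>\<^sub>m adjoint_action (basis i)) {..<hdim}) x y)"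
        by (simp add: bilin_actions[OF t] bilin_mat_sum bilin_smult bilin_adjoint_action lform_sum[OF g] lform_scale[OF g])
    qed
  qed simp
qed (auto simp: adjoint_action_actions at_one_one_adjoint_action coord_basis)

lemma at_one_one_precomp:
  assumes f: "f \<in> intertwiners regular regular"
  shows "at_one_one (adjoint_action z * kronecker f (1\<^sub>m hdim)) = adjoint_rep H (at_one f) z"
  using HomD(1)[OF f] by (simp add: at_one_one_def bilin_kronecker apply_mat_one bilin_adjoint_action End_apply_mat[OF f])

text \<open>
  Both sides are the value at \<open>a \<otimes> 1\<close> of the action \<open>x \<otimes> y \<mapsto> ad(x b)(z) y\<close>, the right-hand side
  because an action is recovered from its value at \<open>1 \<otimes> 1\<close>, here \<open>ad(b)(z)\<close>.
\<close>

lemma adjoint_mult: "adjoint_rep H (a * b) = (\<lambda>z. adjoint_rep H a (adjoint_rep H b z))"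
proof (rule ext)
  fix z
  let ?t = "adjoint_action z * kronecker (right_mult b) (1\<^sub>m hdim)"
  have t: "?t \<in> actions H regular"
    using lin_mapD(1)[OF actions_precomp[OF regular_rep right_mult_End] adjoint_action_actions] by simp
  have "adjoint_rep H (a * b) z = bilin ?t a 1"
    by (simp add: bilin_kronecker apply_mat_one bilin_adjoint_action apply_mat_right_mult)
  also have "\<dots> = adjoint_rep H a (adjoint_rep H b z)"
    by (simp add: bilin_actions[OF t] at_one_one_precomp[OF right_mult_End] at_one_right_mult)
  finally show "adjoint_rep H (a * b) z = adjoint_rep H a (adjoint_rep H b z)" .
qed

lemma action_trace_regular:
  assumes f: "f \<in> intertwiners regular regular"
  shows "action_trace H regular f = endo_trace (adjoint_rep H (at_one f))"
  using trace_on_frame[OF frame_actions_regular, of "\<lambda>t. t * kronecker f (1\<^sub>m hdim)"] actions_precomp[OF regular_rep f]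
  by (simp add: action_trace_def endo_trace_coord at_one_one_precomp[OF f])

lemma negligible_regular: "negligible H regular = {f \<in> intertwiners regular regular. at_one f \<in> killing_radical H}"
proof -
  have *: "action_trace H regular (g * f) = killing_form H (at_one f) (at_one g)"
    if "f \<in> intertwiners regular regular" "g \<in> intertwiners regular regular" for f g
    using action_trace_regular[OF Hom_comp[OF regular_rep regular_rep regular_rep that]]
    by (simp add: at_one_mult[OF that] killing_form_def o_def adjoint_mult)
  show ?thesis
    unfolding negligible_def killing_radical_def using * at_one_right_mult right_mult_End by (auto; metis)
qed

text \<open>
  Right multiplications by the elements of a basis of the Killing radical form a basis of the negligible
  endomorphisms.
\<close>

lemma mat_dim_negligible_regular: "mat_dim hdim hdim (negligible H regular) = dim (killing_radical H)"
proof -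
  obtain B where B: "B \<subseteq> killing_radical H" "independent B" "killing_radical H \<subseteq> span B"
    "card B = dim (killing_radical H)" by (rule basis_exists)
  have fB: "finite B" using independent_span_bound[OF basis_set(3) B(2)] basis_set(2) by simp
  have "frame hdim hdim (negligible H regular) B right_mult (\<lambda>k f. representation B (at_one f) k)"
    unfolding frame_def
  proof (intro conjI ballI)
    have sp: "at_one f \<in> span B" if "f \<in> negligible H regular" for f using that B(3) by (auto simp: negligible_regular)
    have E: "f \<in> intertwiners regular regular" if "f \<in> negligible H regular" for f using that by (simp add: negligible_regular)
    show "finite B" by (rule fB)
    show "mat_subspace hdim hdim (negligible H regular)" using negligible_mat_subspace[OF regular_rep] by simp
    show "lin_form (negligible H regular) (\<lambda>f. representation B (at_one f) k)" for k
      by (auto simp: lin_form_def at_one_add at_one_smult E sp representation_add[OF B(2)] representation_scale[OF B(2)])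
    show "right_mult b \<in> negligible H regular" if "b \<in> B" for b using that B(1) by (auto simp: negligible_regular right_mult_End at_one_right_mult)
    show "representation B (at_one (right_mult b)) k = (if k = b then 1 else 0)" if "k \<in> B" "b \<in> B" for k b
      using that representation_basis[OF B(2)] by (simp add: at_one_right_mult)
    fix f assume f: "f \<in> negligible H regular"
    have "f = right_mult (at_one f)" by (rule right_mult_at_one[OF E[OF f], symmetric])
    also have "\<dots> = mat_sum hdim hdim (\<lambda>k. representation B (at_one f) k \<cdot>\<^sub>m right_mult k) B"
    proof (rule eq_matI)
      fix r c assume "r < dim_row (mat_sum hdim hdim (\<lambda>k. representation B (at_one f) k \<cdot>\<^sub>m right_mult k) B)"
        "c < dim_col (mat_sum hdim hdim (\<lambda>k. representation B (at_one f) k \<cdot>\<^sub>m right_mult k) B)"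
      then have rc: "r < hdim" "c < hdim" by auto
      have "coord r (basis c * at_one f) = coord r (basis c * (\<Sum>k\<in>B. scale H (representation B (at_one f) k) k))"
        using sum_representation_eq[OF B(2) sp[OF f] fB order_refl] by simp
      also have "\<dots> = (\<Sum>k\<in>B. representation B (at_one f) k * coord r (basis c * k))"
        by (simp add: sum_distrib_left lform_sum[OF lform_coord] mult_scale_right)
      finally show "right_mult (at_one f) $$ (r, c) = mat_sum hdim hdim (\<lambda>k. representation B (at_one f) k \<cdot>\<^sub>m right_mult k) B $$ (r, c)"
        using rc by (simp add: right_mult_def)
    qed (simp_all add: right_mult_def)
    finally show "f = \<dots>" .
  qed
  then show ?thesis using mat_dim_frame B(4) by metis
qed

end

section \<open>Tensor equivalences\<close>

(* representations are pairs, but statements about all of them should not be split into components *)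
declare split_paired_All [simp del] split_paired_Ex [simp del]

lemma rep_cat_simps [simp]:
  "obj (rep_cat H) = {X. is_rep H X}" "hom (rep_cat H) = intertwiners" "comp (rep_cat H) = (*)"
  "ident (rep_cat H) X = 1\<^sub>m (fst X)" "add (rep_cat H) = (+)" "tensor_cat.smult (rep_cat H) = (\<cdot>\<^sub>m)"
  "tensor (rep_cat H) = rep_tensor H" "tensor_mor (rep_cat H) = kronecker"
  by (simp_all add: rep_cat_def)

definition rep_iso where
  "rep_iso X Y f g \<longleftrightarrow> f \<in> intertwiners X Y \<and> g \<in> intertwiners Y X \<and> g * f = 1\<^sub>m (fst X) \<and> f * g = 1\<^sub>m (fst Y)"

lemma is_iso_rep_cat: "is_iso (rep_cat H) X Y f \<longleftrightarrow> (\<exists>g. rep_iso X Y f g)"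
  by (auto simp: is_iso_def rep_iso_def)

lemma rep_isoD:
  assumes "rep_iso X Y f g"
  shows "f \<in> intertwiners X Y" "g \<in> intertwiners Y X" "g * f = 1\<^sub>m (fst X)" "f * g = 1\<^sub>m (fst Y)"
    "dim_row f = fst Y" "dim_col f = fst X" "dim_row g = fst X" "dim_col g = fst Y"
  using assms HomD(2,3)[of f X Y] HomD(2,3)[of g Y X] by (auto simp: rep_iso_def)

lemma rep_iso_cancel:
  assumes "rep_iso X Y f g"
  shows "dim_row v = fst X \<Longrightarrow> g * (f * v) = v" "dim_row v = fst Y \<Longrightarrow> f * (g * v) = v"
    "dim_col v = fst Y \<Longrightarrow> v * f * g = v" "dim_col v = fst X \<Longrightarrow> v * g * f = v"
  using rep_isoD[OF assms] by (simp_all add: mat_assoc) (simp_all add: mat_assoc[symmetric])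

lemma (in fd_hopf_algebra) rep_iso_trans:
  assumes "is_rep H X" "is_rep H Y" "is_rep H Z" "rep_iso X Y f g" "rep_iso Y Z f' g'"
  shows "rep_iso X Z (f' * f) (g * g')"
  using assms(4,5) Hom_comp[OF assms(1-3), of f f'] Hom_comp[OF assms(3,2,1), of g' g]
    rep_isoD[OF assms(4)] rep_isoD[OF assms(5)] rep_iso_cancel[OF assms(4)] rep_iso_cancel[OF assms(5)]
  by (auto simp: rep_iso_def mat_assoc)

lemma (in fd_hopf_algebra) rep_iso_tensor:
  assumes "is_rep H X" "is_rep H Y" "is_rep H Z" "rep_iso Y Z f g"
  shows "rep_iso (rep_tensor H X Y) (rep_tensor H X Z) (kronecker (1\<^sub>m (fst X)) f) (kronecker (1\<^sub>m (fst X)) g)"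
  using Hom_kronecker[OF assms(1,1,2,3) Hom_one[OF assms(1)], of f]
    Hom_kronecker[OF assms(1,1,3,2) Hom_one[OF assms(1)], of g] rep_isoD[OF assms(4)]
  by (auto simp: rep_iso_def kronecker_mult kronecker_one)

definition is_power where
  "is_power n X T \<longleftrightarrow> (\<exists>\<iota> \<pi>. biprod n X T \<iota> \<pi>)"

context fd_hopf_algebra
begin

lemma is_power_dim: "is_rep H X \<Longrightarrow> is_rep H T \<Longrightarrow> is_power n X T \<Longrightarrow> fst T = n * fst X"
  and is_power_End: "is_rep H X \<Longrightarrow> is_rep H T \<Longrightarrow> is_power n X T \<Longrightarrow>
    mat_dim (fst T) (fst T) (intertwiners T T) = n\<^sup>2 * mat_dim (fst X) (fst X) (intertwiners X X)"
  and is_power_negligible: "is_rep H X \<Longrightarrow> is_rep H T \<Longrightarrow> is_power n X T \<Longrightarrow> 0 < n \<Longrightarrow>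
    mat_dim (fst T) (fst T) (negligible H T) = n\<^sup>2 * mat_dim (fst X) (fst X) (negligible H X)"
proof -
  assume X: "is_rep H X" and T: "is_rep H T" and "is_power n X T"
  then obtain \<iota> \<pi> where "biprod n X T \<iota> \<pi>" by (auto simp: is_power_def)
  then interpret module_power H n X T \<iota> \<pi> using X T by unfold_locales
  show "fst T = n * fst X" by (rule dim_power)
  show "mat_dim (fst T) (fst T) (intertwiners T T) = n\<^sup>2 * mat_dim (fst X) (fst X) (intertwiners X X)"
    by (rule mat_dim_End_power)
  show "0 < n \<Longrightarrow> mat_dim (fst T) (fst T) (negligible H T) = n\<^sup>2 * mat_dim (fst X) (fst X) (negligible H X)"
    by (rule mat_dim_negligible_power)
qed

lemma is_power_iso:
  assumes X: "is_rep H X" and T: "is_rep H T" and T': "is_rep H T'" and p: "is_power n X T"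
    and iso: "rep_iso T T' f g"
  shows "is_power n X T'"
proof -
  obtain \<iota> \<pi> where b: "biprod n X T \<iota> \<pi>" using p by (auto simp: is_power_def)
  then interpret module_power H n X T \<iota> \<pi> using X T by unfold_locales
  note d = rep_isoD[OF iso]
  have "mat_sum (fst T') (fst T') (\<lambda>j. (f * \<iota> j) * (\<pi> j * g)) {..<n}
      = mat_sum (fst T') (fst T') (\<lambda>j. f * (\<iota> j * (\<pi> j * g))) {..<n}"
    using d by (intro mat_sum_cong) (simp add: mat_assoc)
  also have "\<dots> = f * mat_sum (fst T) (fst T') (\<lambda>j. \<iota> j * (\<pi> j * g)) {..<n}"
    using d by (intro mult_mat_sum[symmetric]) (auto intro!: carrier_matI)
  also have "\<dots> = 1\<^sub>m (fst T')" using sum_cut_left[of g] d by simp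
  finally have "biprod n X T' (\<lambda>j. f * \<iota> j) (\<lambda>j. \<pi> j * g)"
    unfolding biprod_def
    using Hom_comp[OF X T T' \<iota> d(1)] Hom_comp[OF T' T X d(2) \<pi>] d rep_iso_cancel[OF iso] \<pi>_\<iota>
    by (auto simp: mat_assoc)
  then show ?thesis by (auto simp: is_power_def)
qed

lemma rep_iso_dim:
  assumes "is_rep H X" "is_rep H T" "rep_iso X T f g" shows "fst T = fst X"
proof -
  have "biprod 1 X T (\<lambda>_. f) (\<lambda>_. g)"
    using rep_isoD[OF assms(3)] by (auto simp: biprod_def intro!: eq_matI)
  then have "is_power 1 X T" by (auto simp: is_power_def)
  from is_power_dim[OF assms(1,2) this] show ?thesis by simp
qed

end

locale tensor_equivalence = A: fd_hopf_algebra A + A': fd_hopf_algebra A'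
  for A :: "('k::field, 'a::ring_1) hopf" and A' :: "('k, 'b::ring_1) hopf" +
  fixes Fo Fm J \<phi>
  assumes equivalence: "is_equivalence (rep_cat A) (rep_cat A') Fo Fm"
    and linear: "is_linear (rep_cat A) (rep_cat A') Fm"
    and tensor: "is_tensor_functor (rep_cat A) (rep_cat A') Fo Fm J \<phi>"
begin

lemma Fo_Fm_functor: "is_functor (rep_cat A) (rep_cat A') Fo Fm"
  using equivalence by (simp add: is_equivalence_def)

lemma Fo: "is_rep A X \<Longrightarrow> is_rep A' (Fo X)"
  and Fm: "is_rep A X \<Longrightarrow> is_rep A Y \<Longrightarrow> f \<in> intertwiners X Y \<Longrightarrow> Fm X Y f \<in> intertwiners (Fo X) (Fo Y)"
  and Fm_one: "is_rep A X \<Longrightarrow> Fm X X (1\<^sub>m (fst X)) = 1\<^sub>m (fst (Fo X))"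
  and Fm_comp: "is_rep A X \<Longrightarrow> is_rep A Y \<Longrightarrow> is_rep A Z \<Longrightarrow> f \<in> intertwiners X Y \<Longrightarrow>
    g \<in> intertwiners Y Z \<Longrightarrow> Fm X Z (g * f) = Fm Y Z g * Fm X Y f"
  using Fo_Fm_functor by (simp_all add: is_functor_def)

lemma Fm_lin: "is_rep A X \<Longrightarrow> is_rep A Y \<Longrightarrow>
    lin_map (intertwiners X Y) (intertwiners (Fo X) (Fo Y)) (Fm X Y)"
  using linear Fm by (simp add: is_linear_def lin_map_def)

text \<open>
  Faithfulness follows from the natural isomorphisms of \<open>G F\<close> and \<open>F G\<close> with the identity functors.
  A preimage of \<open>h\<close> is the conjugate of \<open>G h\<close> by the former; its image under \<open>F\<close> is \<open>h\<close> because
  both have the same image under the faithful functor \<open>G\<close>.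
\<close>

lemma Fm_bij:
  assumes X: "is_rep A X" and Y: "is_rep A Y"
  shows "bij_betw (Fm X Y) (intertwiners X Y) (intertwiners (Fo X) (Fo Y))"
proof -
  obtain Go Gm \<eta> \<epsilon> where G: "is_functor (rep_cat A') (rep_cat A) Go Gm"
    and \<eta>: "is_nat_iso (rep_cat A) (rep_cat A) (\<lambda>x. x) (\<lambda>x y f. f)
          (\<lambda>x. Go (Fo x)) (\<lambda>x y f. Gm (Fo x) (Fo y) (Fm x y f)) \<eta>"
    and \<epsilon>: "is_nat_iso (rep_cat A') (rep_cat A') (\<lambda>x. Fo (Go x)) (\<lambda>x y f. Fm (Go x) (Go y) (Gm x y f))
          (\<lambda>x. x) (\<lambda>x y f. f) \<epsilon>"
    using equivalence by (auto simp: is_equivalence_def)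
  have F_inj: "f = g"
    if XY: "is_rep A X" "is_rep A Y" and fg: "f \<in> intertwiners X Y" "g \<in> intertwiners X Y"
      and eq: "Gm (Fo X) (Fo Y) (Fm X Y f) = Gm (Fo X) (Fo Y) (Fm X Y g)" for X Y f g
  proof -
    obtain \<theta> where \<theta>: "rep_iso Y (Go (Fo Y)) (\<eta> Y) \<theta>"
      using \<eta> XY by (auto simp: is_nat_iso_def is_iso_rep_cat)
    have "\<eta> Y * f = \<eta> Y * g" using \<eta> XY fg eq by (simp add: is_nat_iso_def)
    then have "\<theta> * (\<eta> Y * f) = \<theta> * (\<eta> Y * g)" by simp
    then show ?thesis using rep_iso_cancel(1)[OF \<theta>] HomD(2)[OF fg(1)] HomD(2)[OF fg(2)] by simp
  qed
  have G_inj: "f = g"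
    if XY: "is_rep A' X" "is_rep A' Y" and fg: "f \<in> intertwiners X Y" "g \<in> intertwiners X Y"
      and eq: "Gm X Y f = Gm X Y g" for X Y f g
  proof -
    obtain \<theta> where \<theta>: "rep_iso (Fo (Go X)) X (\<epsilon> X) \<theta>"
      using \<epsilon> XY by (auto simp: is_nat_iso_def is_iso_rep_cat)
    have "h * \<epsilon> X = \<epsilon> Y * Fm (Go X) (Go Y) (Gm X Y h)" if "h \<in> intertwiners X Y" for h
      using \<epsilon> XY that by (simp add: is_nat_iso_def)
    then have "f * \<epsilon> X = g * \<epsilon> X" using fg eq by simp
    then have "f * \<epsilon> X * \<theta> = g * \<epsilon> X * \<theta>" by simp
    then show ?thesis using rep_iso_cancel(3)[OF \<theta>] HomD(3)[OF fg(1)] HomD(3)[OF fg(2)] by simp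
  qed
  have surj: "\<exists>f\<in>intertwiners X Y. Fm X Y f = h" if h: "h \<in> intertwiners (Fo X) (Fo Y)" for h
  proof -
    obtain \<theta>X where \<theta>X: "rep_iso X (Go (Fo X)) (\<eta> X) \<theta>X"
      using \<eta> X by (auto simp: is_nat_iso_def is_iso_rep_cat)
    obtain \<theta>Y where \<theta>Y: "rep_iso Y (Go (Fo Y)) (\<eta> Y) \<theta>Y"
      using \<eta> Y by (auto simp: is_nat_iso_def is_iso_rep_cat)
    have GX: "is_rep A (Go (Fo X))" and GY: "is_rep A (Go (Fo Y))"
      using G Fo[OF X] Fo[OF Y] by (auto simp: is_functor_def)
    have Gh: "Gm (Fo X) (Fo Y) h \<in> intertwiners (Go (Fo X)) (Go (Fo Y))"
      using G Fo[OF X] Fo[OF Y] h by (auto simp: is_functor_def)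
    note dGh = HomD(2,3)[OF Gh]
    define f where "f = \<theta>Y * (Gm (Fo X) (Fo Y) h * \<eta> X)"
    have f: "f \<in> intertwiners X Y"
      unfolding f_def
      by (rule Hom_comp[OF X GY Y Hom_comp[OF X GX GY rep_isoD(1)[OF \<theta>X] Gh] rep_isoD(2)[OF \<theta>Y]])
    have "\<eta> Y * f = Gm (Fo X) (Fo Y) (Fm X Y f) * \<eta> X"
      using \<eta> X Y f by (simp add: is_nat_iso_def)
    then have "Gm (Fo X) (Fo Y) (Fm X Y f) * \<eta> X * \<theta>X = Gm (Fo X) (Fo Y) h * \<eta> X * \<theta>X"
      using rep_iso_cancel(2)[OF \<theta>Y] dGh rep_isoD(5-8)[OF \<theta>X] by (simp add: f_def)
    then have "Gm (Fo X) (Fo Y) (Fm X Y f) = Gm (Fo X) (Fo Y) h"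
      using rep_iso_cancel(3)[OF \<theta>X] dGh G Fo[OF X] Fo[OF Y] Fm[OF X Y f]
        HomD(3)[of "Gm (Fo X) (Fo Y) (Fm X Y f)" "Go (Fo X)" "Go (Fo Y)"] by (simp add: is_functor_def)
    then have "Fm X Y f = h" using G_inj[OF Fo[OF X] Fo[OF Y] Fm[OF X Y f] h] by simp
    then show ?thesis using f by blast
  qed
  show ?thesis
    unfolding bij_betw_def inj_on_def using F_inj[OF X Y] Fm[OF X Y] surj by fastforce
qed

lemma essentially_surjective:
  assumes "is_rep A' Y" obtains X e e' where "is_rep A X" "rep_iso (Fo X) Y e e'"
proof -
  obtain Go Gm \<epsilon> where "is_functor (rep_cat A') (rep_cat A) Go Gm"
    and "is_nat_iso (rep_cat A') (rep_cat A') (\<lambda>x. Fo (Go x)) (\<lambda>x y f. Fm (Go x) (Go y) (Gm x y f))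
          (\<lambda>x. x) (\<lambda>x y f. f) \<epsilon>"
    using equivalence by (auto simp: is_equivalence_def)
  then have "is_rep A (Go Y)" "is_iso (rep_cat A') (Fo (Go Y)) Y (\<epsilon> Y)"
    using assms by (auto simp: is_functor_def is_nat_iso_def)
  then show thesis using that by (meson is_iso_rep_cat)
qed

lemma J_iso:
  assumes "is_rep A X" "is_rep A Y"
  obtains J' where "rep_iso (rep_tensor A' (Fo X) (Fo Y)) (Fo (rep_tensor A X Y)) (J X Y) J'"
proof -
  have "is_iso (rep_cat A') (rep_tensor A' (Fo X) (Fo Y)) (Fo (rep_tensor A X Y)) (J X Y)"
    using tensor assms by (simp add: is_tensor_functor_def)
  then show thesis using that by (auto simp: is_iso_rep_cat)
qed

lemma J_natural:
  assumes "is_rep A X" "is_rep A X'" "is_rep A Y" "is_rep A Y'" "f \<in> intertwiners X X'" "g \<in> intertwiners Y Y'"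
  shows "J X' Y' * kronecker (Fm X X' f) (Fm Y Y' g)
    = Fm (rep_tensor A X Y) (rep_tensor A X' Y') (kronecker f g) * J X Y"
  using tensor assms by (auto simp: is_tensor_functor_def)

lemma Fm_zero: "is_rep A X \<Longrightarrow> is_rep A Y \<Longrightarrow> Fm X Y (0\<^sub>m (fst Y) (fst X)) = 0\<^sub>m (fst (Fo Y)) (fst (Fo X))"
  using lin_map_zero[OF Hom_mat_subspace Fm_lin Hom_mat_subspace[OF Fo Fo]] by blast

lemma is_power_Fo:
  assumes X: "is_rep A X" and T: "is_rep A T" and p: "is_power n X T"
  shows "is_power n (Fo X) (Fo T)"
proof -
  obtain \<iota> \<pi> where b: "biprod n X T \<iota> \<pi>" using p by (auto simp: is_power_def)
  then interpret module_power A n X T \<iota> \<pi> using X T by unfold_locales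
  have "mat_sum (fst (Fo T)) (fst (Fo T)) (\<lambda>j. Fm X T (\<iota> j) * Fm T X (\<pi> j)) {..<n}
      = mat_sum (fst (Fo T)) (fst (Fo T)) (\<lambda>j. Fm T T (\<iota> j * \<pi> j)) {..<n}"
    using Fm_comp[OF T X T \<pi> \<iota>] by (intro mat_sum_cong) simp
  also have "\<dots> = Fm T T (mat_sum (fst T) (fst T) (\<lambda>j. \<iota> j * \<pi> j) {..<n})"
    using Hom_comp[OF T X T \<pi> \<iota>]
    by (intro lin_map_mat_sum[OF Hom_mat_subspace[OF T T] Hom_mat_subspace[OF Fo[OF T] Fo[OF T]] Fm_lin[OF T T], symmetric]) auto
  also have "\<dots> = 1\<^sub>m (fst (Fo T))" by (simp add: sum_\<iota>_\<pi> Fm_one T)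
  finally have "biprod n (Fo X) (Fo T) (\<lambda>j. Fm X T (\<iota> j)) (\<lambda>j. Fm T X (\<pi> j))"
    unfolding biprod_def using Fm[OF X T \<iota>] Fm[OF T X \<pi>] Fm_comp[OF X T X \<iota> \<pi>, symmetric] \<pi>_\<iota>
    by (auto simp: Fm_one[OF X] Fm_zero[OF X X])
  then show ?thesis by (auto simp: is_power_def)
qed

lemma mat_dim_End_Fo:
  assumes X: "is_rep A X"
  shows "mat_dim (fst (Fo X)) (fst (Fo X)) (intertwiners (Fo X) (Fo X)) = mat_dim (fst X) (fst X) (intertwiners X X)"
  by (rule mat_dim_bij[OF Hom_mat_subspace[OF X X] Hom_mat_subspace[OF Fo[OF X] Fo[OF X]] Fm_lin[OF X X] Fm_bij[OF X X], symmetric])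

text \<open>
  The tensor structure turns \<open>F(t) : F(R \<otimes> R) \<rightarrow> F(R)\<close> into a map on \<open>F(R) \<otimes> F(R)\<close>.  By naturality
  of \<open>J\<close> and fullness of \<open>F\<close> it commutes with all endomorphisms of \<open>F(R)\<close>.
\<close>

lemma actions_Fo:
  assumes R: "is_rep A R"
  shows "lin_map (actions A R) (actions A' (Fo R)) (\<lambda>t. Fm (rep_tensor A R R) R t * J R R)"
    and "bij_betw (\<lambda>t. Fm (rep_tensor A R R) R t * J R R) (actions A R) (actions A' (Fo R))"
proof -
  let ?RR = "rep_tensor A R R" and ?S = "Fo R"
  let ?SS = "rep_tensor A' ?S ?S"
  let ?L = "\<lambda>t. Fm ?RR R t * J R R"
  note RR = A.rep_tensor_is_rep[OF R R] and S = Fo[OF R] and FRR = Fo[OF A.rep_tensor_is_rep[OF R R]]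
  note SS = A'.rep_tensor_is_rep[OF S S]
  obtain J' where J': "rep_iso ?SS (Fo ?RR) (J R R) J'" by (rule J_iso[OF R R])
  note dJ = rep_isoD[OF J']
  have nat: "?L t * kronecker (1\<^sub>m (fst ?S)) (Fm R R g) = Fm ?RR R (t * kronecker (1\<^sub>m (fst R)) g) * J R R"
    if t: "t \<in> intertwiners ?RR R" and g: "g \<in> intertwiners R R" for t g
  proof -
    note dt = HomD(2,3)[OF Fm[OF RR R t]] and dg = HomD(2,3)[OF Fm[OF R R g]]
    have k: "kronecker (1\<^sub>m (fst R)) g \<in> intertwiners ?RR ?RR"
      by (rule Hom_kronecker[OF R R R R Hom_one[OF R] g])
    have "?L t * kronecker (1\<^sub>m (fst ?S)) (Fm R R g) = Fm ?RR R t * (J R R * kronecker (Fm R R (1\<^sub>m (fst R))) (Fm R R g))"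
      using dt dg dJ by (simp add: mat_assoc Fm_one[OF R])
    also have "\<dots> = Fm ?RR R t * (Fm ?RR ?RR (kronecker (1\<^sub>m (fst R)) g) * J R R)"
      unfolding J_natural[OF R R R R Hom_one[OF R] g] ..
    also have "\<dots> = (Fm ?RR R t * Fm ?RR ?RR (kronecker (1\<^sub>m (fst R)) g)) * J R R"
      using dt dJ HomD(2,3)[OF Fm[OF RR RR k]] by (simp add: mat_assoc)
    also have "\<dots> = Fm ?RR R (t * kronecker (1\<^sub>m (fst R)) g) * J R R"
      using Fm_comp[OF RR RR R k t] by simp
    finally show ?thesis .
  qed
  have nat': "Fm R R g * ?L t = Fm ?RR R (g * t) * J R R"
    if t: "t \<in> intertwiners ?RR R" and g: "g \<in> intertwiners R R" for t g
    using HomD(2,3)[OF Fm[OF RR R t]] HomD(2,3)[OF Fm[OF R R g]] dJ Fm_comp[OF RR R R t g]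
    by (simp add: mat_assoc)
  have full: "\<exists>f\<in>intertwiners R R. Fm R R f = g" if "g \<in> intertwiners ?S ?S" for g
    using Fm_bij[OF R R] that unfolding bij_betw_def by (metis imageE)
  have into: "?L t \<in> actions A' ?S" if t: "t \<in> actions A R" for t
  proof -
    note dt = actionsD[OF t]
    have "?L t \<in> intertwiners ?SS ?S"
      by (rule Hom_comp[OF SS FRR S dJ(1) Fm[OF RR R dt(1)]])
    moreover have "?L t * kronecker (1\<^sub>m (fst ?S)) g = g * ?L t" if g: "g \<in> intertwiners ?S ?S" for g
    proof -
      obtain f where f: "f \<in> intertwiners R R" "Fm R R f = g" using full[OF g] by blast
      show ?thesis using nat[OF dt(1) f(1)] nat'[OF dt(1) f(1)] dt(4)[OF f(1)] f(2) by simp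
    qed
    ultimately show ?thesis by (simp add: actions_def)
  qed
  show "lin_map (actions A R) (actions A' ?S) ?L"
    using into lin_mapD(2,3)[OF Fm_lin[OF RR R] actionsD(1)[of _ A R]] actionsD(1)[of _ A R]
      HomD(2,3)[OF Fm[OF RR R actionsD(1)[of _ A R]]] dJ
    by (auto simp: lin_map_def mat_add_mult mat_smult_mult)
  have "inj_on ?L (actions A R)"
  proof (rule inj_onI)
    fix t u assume t: "t \<in> actions A R" and u: "u \<in> actions A R" and eq: "?L t = ?L u"
    note dt = HomD(2,3)[OF Fm[OF RR R actionsD(1)[OF t]]] HomD(2,3)[OF Fm[OF RR R actionsD(1)[OF u]]]
    have "?L t * J' = ?L u * J'" using eq by simp
    then have "Fm ?RR R t = Fm ?RR R u" using rep_iso_cancel(3)[OF J'] dt by simp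
    then show "t = u" using Fm_bij[OF RR R] actionsD(1)[OF t] actionsD(1)[OF u] by (auto simp: bij_betw_def inj_on_def)
  qed
  moreover have "\<exists>t\<in>actions A R. ?L t = s" if s: "s \<in> actions A' ?S" for s
  proof -
    note ds = actionsD[OF s]
    have "s * J' \<in> intertwiners (Fo ?RR) ?S" by (rule Hom_comp[OF FRR SS S dJ(2) ds(1)])
    then obtain t where t: "t \<in> intertwiners ?RR R" "Fm ?RR R t = s * J'"
      using Fm_bij[OF RR R] unfolding bij_betw_def by (metis imageE)
    have Lt: "?L t = s" using rep_iso_cancel(4)[OF J'] t(2) ds(3) by simp
    have "t * kronecker (1\<^sub>m (fst R)) g = g * t" if g: "g \<in> intertwiners R R" for g
    proof -
      have k: "kronecker (1\<^sub>m (fst R)) g \<in> intertwiners ?RR ?RR"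
        by (rule Hom_kronecker[OF R R R R Hom_one[OF R] g])
      note m1 = Hom_comp[OF RR RR R k t(1)] and m2 = Hom_comp[OF RR R R t(1) g]
      have "Fm ?RR R (t * kronecker (1\<^sub>m (fst R)) g) * J R R * J' = Fm ?RR R (g * t) * J R R * J'"
        using nat[OF t(1) g] nat'[OF t(1) g] ds(4)[OF Fm[OF R R g]] Lt by simp
      then have "Fm ?RR R (t * kronecker (1\<^sub>m (fst R)) g) = Fm ?RR R (g * t)"
        using rep_iso_cancel(3)[OF J'] HomD(3)[OF Fm[OF RR R m1]] HomD(3)[OF Fm[OF RR R m2]] by simp
      then show ?thesis using Fm_bij[OF RR R] m1 m2 by (auto simp: bij_betw_def inj_on_def)
    qed
    then have "t \<in> actions A R" using t(1) by (simp add: actions_def)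
    then show ?thesis using Lt by blast
  qed
  ultimately show "bij_betw ?L (actions A R) (actions A' ?S)"
    unfolding bij_betw_def using into by fastforce
qed

lemma action_trace_Fo:
  assumes R: "is_rep A R" and f: "f \<in> intertwiners R R"
  shows "action_trace A' (Fo R) (Fm R R f) = action_trace A R f"
  unfolding action_trace_def
proof (rule trace_on_bij[OF A.actions_mat_subspace[OF R] A'.actions_mat_subspace[OF Fo[OF R]] actions_Fo[OF R] A.actions_precomp[OF R f], symmetric])
  let ?RR = "rep_tensor A R R"
  note RR = A.rep_tensor_is_rep[OF R R]
  fix t assume "t \<in> actions A R"
  note t = actionsD(1)[OF this]
  obtain J' where J': "rep_iso (rep_tensor A' (Fo R) (Fo R)) (Fo ?RR) (J R R) J'" by (rule J_iso[OF R R])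
  note dJ = rep_isoD[OF J']
  have k: "kronecker f (1\<^sub>m (fst R)) \<in> intertwiners ?RR ?RR"
    by (rule Hom_kronecker[OF R R R R f Hom_one[OF R]])
  note dt = HomD(2,3)[OF Fm[OF RR R t]] and df = HomD(2,3)[OF Fm[OF R R f]] and dk = HomD(2,3)[OF Fm[OF RR RR k]]
  have "Fm ?RR R (t * kronecker f (1\<^sub>m (fst R))) * J R R
      = Fm ?RR R t * (Fm ?RR ?RR (kronecker f (1\<^sub>m (fst R))) * J R R)"
    using Fm_comp[OF RR RR R k t] dt dk dJ by (simp add: mat_assoc)
  also have "\<dots> = Fm ?RR R t * (J R R * kronecker (Fm R R f) (1\<^sub>m (fst (Fo R))))"
    unfolding J_natural[OF R R R R f Hom_one[OF R], symmetric] Fm_one[OF R] ..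
  finally show "Fm ?RR R (t * kronecker f (1\<^sub>m (fst R))) * J R R
      = Fm ?RR R t * J R R * kronecker (Fm R R f) (1\<^sub>m (fst (Fo R)))"
    using dt df dJ by (simp add: mat_assoc)
qed

lemma mat_dim_negligible_Fo:
  assumes R: "is_rep A R"
  shows "mat_dim (fst (Fo R)) (fst (Fo R)) (negligible A' (Fo R)) = mat_dim (fst R) (fst R) (negligible A R)"
proof (rule mat_dim_bij[OF A.negligible_mat_subspace[OF R] A'.negligible_mat_subspace[OF Fo[OF R]], symmetric])
  note comp = Hom_comp[OF R R R]
  have full: "\<exists>f\<in>intertwiners R R. Fm R R f = g" if "g \<in> intertwiners (Fo R) (Fo R)" for g
    using Fm_bij[OF R R] that unfolding bij_betw_def by (metis imageE)
  have iff: "Fm R R f \<in> negligible A' (Fo R) \<longleftrightarrow> f \<in> negligible A R" if f: "f \<in> intertwiners R R" for f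
  proof -
    have "(\<forall>g\<in>intertwiners (Fo R) (Fo R). action_trace A' (Fo R) (g * Fm R R f) = 0)
        \<longleftrightarrow> (\<forall>g\<in>intertwiners R R. action_trace A' (Fo R) (Fm R R g * Fm R R f) = 0)"
      using full Fm[OF R R] by metis
    also have "\<dots> \<longleftrightarrow> (\<forall>g\<in>intertwiners R R. action_trace A R (g * f) = 0)"
      using Fm_comp[OF R R R f, symmetric] action_trace_Fo[OF R comp[OF f]] by simp
    finally show ?thesis using f Fm[OF R R f] by (simp add: negligible_def)
  qed
  have sub: "negligible A R \<subseteq> intertwiners R R" "negligible A' (Fo R) \<subseteq> intertwiners (Fo R) (Fo R)"
    by (auto simp: negligible_def)
  show "lin_map (negligible A R) (negligible A' (Fo R)) (Fm R R)"
    using iff sub lin_mapD[OF Fm_lin[OF R R]] unfolding lin_map_def by blast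
  have "inj_on (Fm R R) (negligible A R)" using Fm_bij[OF R R] sub by (auto simp: bij_betw_def intro: inj_on_subset)
  moreover have "Fm R R ` negligible A R = negligible A' (Fo R)"
  proof
    show "Fm R R ` negligible A R \<subseteq> negligible A' (Fo R)" using iff sub by blast
    show "negligible A' (Fo R) \<subseteq> Fm R R ` negligible A R"
    proof
      fix g assume g: "g \<in> negligible A' (Fo R)"
      then obtain f where "f \<in> intertwiners R R" "Fm R R f = g" using full sub by blast
      with g iff show "g \<in> Fm R R ` negligible A R" by blast
    qed
  qed
  ultimately show "bij_betw (Fm R R) (negligible A R) (negligible A' (Fo R))" by (simp add: bij_betw_def)
qed

end

section \<open>Gauge invariance\<close>

context tensor_equivalence
begin

text \<open>
  \<open>F(A) \<otimes> F(A) \<cong> F(A \<otimes> A) \<cong> F(A)\<^sup>d\<close> with \<open>d = dim A\<close>, and \<open>F(A)\<close> is nonzero because \<open>F\<close> is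
  faithful.
\<close>

lemma fst_Fo_regular: "fst (Fo A.regular) = A.hdim"
proof -
  let ?P = "Fo A.regular"
  let ?RR = "rep_tensor A A.regular A.regular"
  have P: "is_rep A' ?P" by (rule Fo[OF A.regular_rep])
  note RR = A.rep_tensor_is_rep[OF A.regular_rep A.regular_rep]
  obtain J' where J': "rep_iso (rep_tensor A' ?P ?P) (Fo ?RR) (J A.regular A.regular) J'"
    by (rule J_iso[OF A.regular_rep A.regular_rep])
  have "is_power A.hdim A.regular ?RR"
    using A.regular_tensor_biprod[OF A.regular_rep] by (auto simp: is_power_def)
  then have "fst (Fo ?RR) = A.hdim * fst ?P"
    by (intro A'.is_power_dim[OF P Fo[OF RR]] is_power_Fo[OF A.regular_rep RR])
  then have "fst ?P * fst ?P = A.hdim * fst ?P"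
    using A'.rep_iso_dim[OF A'.rep_tensor_is_rep[OF P P] Fo[OF RR] J'] by simp
  moreover have "fst ?P \<noteq> 0"
  proof
    assume 0: "fst ?P = 0"
    have "Fm A.regular A.regular (1\<^sub>m A.hdim) = Fm A.regular A.regular (0\<^sub>m A.hdim A.hdim)"
      using Fm_one[OF A.regular_rep] Fm_zero[OF A.regular_rep A.regular_rep] 0 by (auto intro: eq_matI)
    then have "(1\<^sub>m A.hdim :: 'k mat) = 0\<^sub>m A.hdim A.hdim"
      using Fm_bij[OF A.regular_rep A.regular_rep] Hom_one[OF A.regular_rep]
        mat_subspaceD(2)[OF Hom_mat_subspace[OF A.regular_rep A.regular_rep]] by (auto simp: bij_betw_def inj_on_def)
    then have "(1\<^sub>m A.hdim :: 'k mat) $$ (0, 0) = 0\<^sub>m A.hdim A.hdim $$ (0, 0)" by simp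
    then show False using A.hdim_pos by simp
  qed
  ultimately show ?thesis by simp
qed

text \<open>
  The module is \<open>F(A) \<otimes> A'\<^sup>*\<close>.  With \<open>A'\<^sup>* \<cong> F(W)\<close> it is isomorphic to \<open>F(A \<otimes> W)\<close>, a power of \<open>F(A)\<close>
  with exponent \<open>dim W\<close>; this exponent is found by comparing dimensions.
\<close>

lemma common_power:
  obtains T where "is_rep A' T" "is_power A'.hdim (Fo A.regular) T" "is_power A.hdim A'.coregular T"
proof -
  let ?P = "Fo A.regular"
  have P: "is_rep A' ?P" by (rule Fo[OF A.regular_rep])
  obtain W e e' where W: "is_rep A W" and e: "rep_iso (Fo W) A'.coregular e e'"
    by (rule essentially_surjective[OF A'.coregular_rep])
  let ?T = "rep_tensor A' ?P A'.coregular"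
  note RW = A.rep_tensor_is_rep[OF A.regular_rep W] and PW = A'.rep_tensor_is_rep[OF P Fo[OF W]]
  have T: "is_rep A' ?T" by (rule A'.rep_tensor_is_rep[OF P A'.coregular_rep])
  obtain J' where J': "rep_iso (rep_tensor A' ?P (Fo W)) (Fo (rep_tensor A A.regular W)) (J A.regular W) J'"
    by (rule J_iso[OF A.regular_rep W])
  then have "rep_iso (Fo (rep_tensor A A.regular W)) (rep_tensor A' ?P (Fo W)) J' (J A.regular W)"
    by (auto simp: rep_iso_def)
  from A'.rep_iso_trans[OF Fo[OF RW] PW T this A'.rep_iso_tensor[OF P Fo[OF W] A'.coregular_rep e]]
  obtain f g where iso: "rep_iso (Fo (rep_tensor A A.regular W)) ?T f g" by blast
  have "is_power (fst W) A.regular (rep_tensor A A.regular W)"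
    using A.regular_tensor_biprod[OF W] by (auto simp: is_power_def)
  then have 1: "is_power (fst W) ?P ?T"
    by (rule A'.is_power_iso[OF P Fo[OF RW] T is_power_Fo[OF A.regular_rep RW] iso])
  have 2: "is_power A.hdim A'.coregular ?T"
    using A'.tensor_coregular_biprod[OF P] by (simp add: is_power_def fst_Fo_regular)
  have "fst W = A'.hdim"
    using A'.is_power_dim[OF P T 1] A.hdim_pos by (simp add: fst_Fo_regular)
  then show thesis using that[OF T] 1 2 by simp
qed

end

text \<open>
  \<open>A \<otimes> A\<^sup>*\<close> is a power of \<open>A\<close> and of \<open>A\<^sup>*\<close> with the same exponent \<open>dim A\<close>, which cancels.
\<close>

lemma (in fd_hopf_algebra) coregular_dims:
  "mat_dim hdim hdim (intertwiners coregular coregular) = hdim"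
  "mat_dim hdim hdim (negligible H coregular) = dim (killing_radical H)"
proof -
  let ?T = "rep_tensor H regular coregular"
  have T: "is_rep H ?T" by (rule rep_tensor_is_rep[OF regular_rep coregular_rep])
  have 1: "is_power hdim regular ?T" using regular_tensor_biprod[OF coregular_rep] by (auto simp: is_power_def)
  have 2: "is_power hdim coregular ?T" using tensor_coregular_biprod[OF regular_rep] by (simp add: is_power_def)
  show "mat_dim hdim hdim (intertwiners coregular coregular) = hdim"
    using is_power_End[OF regular_rep T 1] is_power_End[OF coregular_rep T 2] hdim_pos by (simp add: mat_dim_End_regular)
  show "mat_dim hdim hdim (negligible H coregular) = dim (killing_radical H)"
    using is_power_negligible[OF regular_rep T 1 hdim_pos] is_power_negligible[OF coregular_rep T 2 hdim_pos] hdim_pos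
    by (simp add: mat_dim_negligible_regular)
qed

context tensor_equivalence
begin

text \<open>
  With \<open>d\<close> and \<open>d'\<close> the dimensions of \<open>A\<close> and \<open>A'\<close>, the endomorphism algebra of the common power has
  dimension \<open>d'\<^sup>2 d\<close> as well as \<open>d\<^sup>2 d'\<close>.
\<close>

lemma hdim_eq: "A'.hdim = A.hdim"
proof -
  obtain T where T: "is_rep A' T" "is_power A'.hdim (Fo A.regular) T" "is_power A.hdim A'.coregular T"
    by (rule common_power)
  have "A'.hdim\<^sup>2 * A.hdim = A.hdim\<^sup>2 * A'.hdim"
    using A'.is_power_End[OF Fo[OF A.regular_rep] T(1,2)] A'.is_power_End[OF A'.coregular_rep T(1,3)]
      mat_dim_End_Fo[OF A.regular_rep] by (simp add: A.mat_dim_End_regular A'.coregular_dims)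
  then show ?thesis using A.hdim_pos A'.hdim_pos by (simp add: power2_eq_square)
qed

lemma dim_killing_radical_eq: "A'.dim (killing_radical A') = A.dim (killing_radical A)"
proof -
  obtain T where T: "is_rep A' T" "is_power A'.hdim (Fo A.regular) T" "is_power A.hdim A'.coregular T"
    by (rule common_power)
  have "A'.hdim\<^sup>2 * A.dim (killing_radical A) = A.hdim\<^sup>2 * A'.dim (killing_radical A')"
    using A'.is_power_negligible[OF Fo[OF A.regular_rep] T(1,2) A'.hdim_pos] A'.is_power_negligible[OF A'.coregular_rep T(1,3) A.hdim_pos]
      mat_dim_negligible_Fo[OF A.regular_rep] by (simp add: A.mat_dim_negligible_regular A'.coregular_dims)
  then show ?thesis using A.hdim_pos by (simp add: hdim_eq)
qed

end

theorem corollary5p5: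
  fixes A :: "('k::field, 'a::ring_1) hopf" and A' :: "('k, 'b::ring_1) hopf"
  assumes "fd_hopf_algebra A"
    and "fd_hopf_algebra A'"
    and "gauge_equivalent A A'"
  shows "vector_space.dim (scale A') (killing_radical A') =
         vector_space.dim (scale A) (killing_radical A)"
proof -
  obtain Fo Fm J \<phi> where "is_equivalence (rep_cat A) (rep_cat A') Fo Fm"
    "is_linear (rep_cat A) (rep_cat A') Fm" "is_tensor_functor (rep_cat A) (rep_cat A') Fo Fm J \<phi>"
    using assms(3) by (auto simp: gauge_equivalent_def tensor_equivalent_def)
  then interpret tensor_equivalence A A' Fo Fm J \<phi>
    using assms(1,2) by (simp add: tensor_equivalence_def tensor_equivalence_axioms_def)
  show ?thesis by (rule dim_killing_radical_eq)
qed

end
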